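(* Let $d\ge 2$, and let $\mu_1,\mu_2$ be Borel probability measures on $\mathbb{R}^d$ with compact supports. Let $\theta_1,\theta_2\in[0,1]$ and write $$u=\dim_{\mathrm F}^{\theta_1}\mu_1,\qquad a=\min\left\{\frac d2,\ \dim_{\mathrm F}^{\theta_2}\mu_2,\ \frac{\dim_{\mathrm F}^{\theta_2}\mu_2}{2\theta_2}\right\},$$ where for $\theta_2=0$ the last term in the minimum is interpreted as $+\infty$. Assume $u\le d$ and define $$\beta(u):=\begin{cases}\dfrac{u+2\theta_1 a-d\theta_1}{2}, & 0\le u<d\theta_1,\\[2ex] \dfrac{ua}{d}, & d\theta_1\le u\le d.\end{cases}$$ If $\beta(u)>0$, then $$\dim_{\mathrm H} D_x(\operatorname{supp}\mu_2)\ge\min\{1,\beta(u)\}\quad\text{for } \mu_1\text{-almost all } x,$$ and, if $\beta(u)>1$, then $$\mathcal{L}^1\bigl(D_x(\operatorname{supp}\mu_2)\bigr)>0\quad\text{for } \mu_1\text{-almost all } x.$$ In particular, if $\beta(u)>0$ then $\dim_{\mathrm H} D(\operatorname{supp}\mu_1,\operatorname{supp}\mu_2)\ge\min\{1,\beta(u)\}$, and if $\beta(u)>1$ then $\mathcal{L}^1\bigl(D(\operatorname{supp}\mu_1,\operatorname{supp}\mu_2)\bigr)>0$.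
   Context: For sets $E,F\subseteq\mathbb{R}^d$ and $x\in\mathbb{R}^d$: $D(E,F)=\{|x-y|:x\in E,\ y\in F\}$ and $D_x(E)=\{|x-y|:y\in E\}$ (pinned distance set). $\dim_{\mathrm H}$ is Hausdorff dimension and $\mathcal{L}^1$ is 1-dimensional Lebesgue measure on $\mathbb{R}$. For a finite Borel measure $\mu$ on $\mathbb{R}^d$, $\widehat\mu(z)=\int e^{-2\pi i z\cdot x}\,d\mu(x)$. For $s\ge 0$ define $$\mathcal{J}_{s,\theta}(\mu)=\left(\int_{\mathbb{R}^d}|\widehat\mu(z)|^{2/\theta}|z|^{s/\theta-d}\,dz\right)^{\theta}\ (\theta\in(0,1]),\qquad \mathcal{J}_{s,0}(\mu)=\sup_{z\in\mathbb{R}^d}|\widehat\mu(z)|^2|z|^s.$$ The Fourier spectrum of $\mu$ at $\theta\in[0,1]$ is $\dim_{\mathrm F}^{\theta}\mu=\sup\{s\ge 0:\mathcal{J}_{s,\theta}(\mu)<\infty\}$ (with $\sup\emptyset=0$). *)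

theory Defs
  imports "HOL-Probability.Probability"
begin

text \<open>
  The case distinction implements the usual conventions for the summand
  \<open>diam(U)\<close> to the power \<open>s\<close>: it is 0 for the empty set, and for \<open>s = 0\<close> it is 1 for every
  nonempty set (whereas in HOL \<open>0 powr 0 = 0\<close>).
\<close>

definition diam_powr :: "real \<Rightarrow> 'a::metric_space set \<Rightarrow> ennreal" where
  "diam_powr s U =
     (if U = {} then 0 else if s = 0 then 1 else ennreal (diameter U powr s))"

text \<open>
  Boundedness of the covering sets has to be demanded explicitly, as the library's
  \<^const>\<open>diameter\<close> is real-valued and hence meaningless on unbounded sets.
\<close>

definition hausdorff_premeasure :: "real \<Rightarrow> real \<Rightarrow> 'a::metric_space set \<Rightarrow> ennreal" where
  "hausdorff_premeasure \<delta> s A =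
     (INF U \<in> {U :: nat \<Rightarrow> 'a set. A \<subseteq> (\<Union>i. U i) \<and> (\<forall>i. bounded (U i) \<and> diameter (U i) \<le> \<delta>)}.
        \<Sum>i. diam_powr s (U i))"

definition hausdorff_measure :: "real \<Rightarrow> 'a::metric_space set \<Rightarrow> ennreal" where
  "hausdorff_measure s A = (SUP \<delta> \<in> {0<..}. hausdorff_premeasure \<delta> s A)"

definition hausdorff_dim :: "'a::metric_space set \<Rightarrow> ereal" where
  "hausdorff_dim A = (INF s \<in> {s. 0 \<le> s \<and> hausdorff_measure s A = 0}. ereal s)"

definition measure_supp :: "'a::topological_space measure \<Rightarrow> 'a set" where
  "measure_supp \<mu> = {x. \<forall>U. open U \<longrightarrow> x \<in> U \<longrightarrow> emeasure \<mu> U > 0}"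

definition distance_set :: "'a::metric_space set \<Rightarrow> 'a set \<Rightarrow> real set" where
  "distance_set E F = {dist x y |x y. x \<in> E \<and> y \<in> F}"

definition pinned_distance_set :: "'a::metric_space \<Rightarrow> 'a set \<Rightarrow> real set" where
  "pinned_distance_set x E = {dist x y |y. y \<in> E}"

definition fourier_transform :: "'a::euclidean_space measure \<Rightarrow> 'a \<Rightarrow> complex" where
  "fourier_transform \<mu> z = (\<integral>x. exp (- 2 * of_real pi * \<i> * of_real (z \<bullet> x)) \<partial>\<mu>)"

definition ennreal_powr :: "ennreal \<Rightarrow> real \<Rightarrow> ennreal" where
  "ennreal_powr x p = (if x = \<infinity> then \<infinity> else ennreal (enn2real x powr p))"

text \<open>
  \<^const>\<open>ennreal_powr\<close> is only used with exponents \<open>p > 0\<close>. In \<open>fourier_energy\<close> the value of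
  \<open>norm z powr _\<close> at \<open>z = 0\<close> (which is 0) is immaterial: for \<open>\<theta> > 0\<close> a single
  point is a null set, and for \<open>\<theta> = 0\<close> it does not affect the supremum because the
  Fourier transform is continuous.
\<close>

definition fourier_energy :: "real \<Rightarrow> real \<Rightarrow> 'a::euclidean_space measure \<Rightarrow> ennreal" where
  "fourier_energy s \<theta> \<mu> =
     (if \<theta> = 0
      then (SUP z. ennreal (norm (fourier_transform \<mu> z) ^ 2 * norm z powr s))
      else ennreal_powr
             (\<integral>\<^sup>+z. ennreal (norm (fourier_transform \<mu> z) powr (2 / \<theta>)
                       * norm z powr (s / \<theta> - real DIM('a))) \<partial>lborel) \<theta>)"

text \<open>Inserting 0 realises the convention that the supremum of the empty set is 0.\<close>

definition fourier_spectrum :: "real \<Rightarrow> 'a::euclidean_space measure \<Rightarrow> ereal" where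
  "fourier_spectrum \<theta> \<mu> = Sup (insert 0 (ereal ` {s. 0 \<le> s \<and> fourier_energy s \<theta> \<mu> < \<infinity>}))"

definition beta_threshold :: "real \<Rightarrow> real \<Rightarrow> real \<Rightarrow> real \<Rightarrow> real" where
  "beta_threshold d \<theta> a u =
     (if u < d * \<theta> then (u + 2 * \<theta> * a - d * \<theta>) / 2 else u * a / d)"

end

theory Submission
  imports Defs
begin

text \<open>
  Why the theorem holds. Let \<open>f x = exp (- pi |x|\<^sup>2)\<close>. Since \<open>f > 0\<close>, the measures \<open>\<mu>\<^sub>1\<close> and
  \<open>f \<mu>\<^sub>1\<close> have the same null sets, so a property of \<open>\<mu>\<^sub>1\<close>-almost every pin can be read off
  from integrals against \<open>f \<mu>\<^sub>1\<close>. The gain is that the Fourier transform of \<open>f \<mu>\<^sub>1\<close> is the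
  convolution of that of \<open>\<mu>\<^sub>1\<close> with a Gaussian: it comes already averaged at unit scale, which
  replaces the local constancy of Fourier transforms of compactly supported measures.

  Distances are compared through their squares, because
  \<open>|x - y|\<^sup>2 - |x - y'|\<^sup>2 = |y|\<^sup>2 - |y'|\<^sup>2 - 2 x \<bullet> (y - y')\<close> is affine in \<open>x\<close>. Expanding a Gaussian of
  width \<open>\<delta>\<close> in this quantity into characters and integrating in \<open>x\<close> first bounds the
  \<open>f \<mu>\<^sub>1\<close>-average of the near-coincidences \<open>|x - y|\<^sup>2 \<approx> |x - y'|\<^sup>2\<close> by an integral over \<open>t\<close> of
  \<open>|(f \<mu>\<^sub>1)^ (2 t (y - y'))|\<close>, averaged over \<open>y\<close> and \<open>y'\<close>
  (\<open>pinned_coincidence_le_frequency_integral\<close>).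

  The law \<open>\<kappa>\<close> of \<open>y - y'\<close> has Fourier transform \<open>|\<mu>\<^sub>2^|\<^sup>2\<close>, so its \<open>L\<^sup>2\<close>-size at frequency
  \<open>r\<close> is controlled by the fourth moment of \<open>\<mu>\<^sub>2^\<close>, that is by the Fourier spectrum at
  \<open>1/2\<close>; the terms with \<open>\<theta>\<^sub>2\<close> in the definition of \<open>a\<close> bound that value from below
  (\<open>fourier_moment_half\<close>). Jensen's inequality with exponent
  \<open>1/\<theta>\<close> followed by Cauchy--Schwarz against the moment of \<open>\<mu>\<^sub>1^\<close> of order \<open>2/\<theta>\<close> gives the decay
  \<open>r powr (- (u + 2 \<theta> a - d \<theta>) / 2)\<close> up to arbitrarily small losses (\<open>gaussian_average_decay\<close>),
  provided \<open>u \<le> d \<theta>\<close>. If \<open>u < d \<theta>\<^sub>1\<close> this is \<open>\<beta>\<close> with \<open>\<theta> = \<theta>\<^sub>1\<close>. Otherwise the spectrum is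
  at least \<open>u\<close> also at \<open>\<theta> = u / d \<ge> \<theta>\<^sub>1\<close> (\<open>fourier_moment_mono_theta\<close>), for which the
  exponent is \<open>u a / d = \<beta>\<close>.

  Hence the averaged probability of a coincidence at scale \<open>\<delta>\<close> is \<open>O(\<delta> powr \<eta>)\<close> for every \<open>\<eta> < \<beta>\<close>
  with \<open>\<eta> \<le> 1\<close>. For \<open>\<eta> < 1\<close>, summing over dyadic \<open>\<delta>\<close> shows that for almost every \<open>x\<close> the
  law of \<open>|x - y|\<close> has finite energy, and the mass distribution principle bounds the Hausdorff dimension
  from below. If \<open>\<beta> > 1\<close>, then \<open>\<eta> = 1\<close> is allowed: Fatou's lemma bounds the coincidences at
  infinitely many scales by a multiple of \<open>\<delta>\<close>, and Cauchy--Schwarz then forces the neighbourhoods of the distance set to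
  have measure bounded below.
\<close>

section \<open>Gaussians and characters\<close>

lemma borel_measurable_cis [measurable]: "cis \<in> borel_measurable borel"
  by (intro borel_measurable_continuous_onI continuous_on_cis continuous_on_id)

lemma integrable_gaussian_real:
  fixes c :: real
  assumes "c > 0"
  shows "integrable lborel (\<lambda>x::real. exp (- (pi * c * x\<^sup>2)))"
proof -
  have k: "sqrt (2 * pi * c) \<noteq> 0" using assms by simp
  have "integrable lborel (\<lambda>x::real. sqrt (2*pi) * std_normal_density x)"
    by (intro integrable_mult_right) (simp add: integrable_normal_density)
  then have "integrable lborel (\<lambda>x::real. exp (- x\<^sup>2 / 2))"
    by (simp add: std_normal_density_def)
  from lborel_integrable_real_affine[OF this k, of 0]
  have "integrable lborel (\<lambda>x. exp (- (sqrt (2 * pi * c) * x)\<^sup>2 / 2))" by simp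
  then show ?thesis using assms by (simp add: power_mult_distrib mult_ac)
qed

lemma gaussian_fourier_real:
  fixes c x :: real
  assumes "c > 0"
  shows "(\<integral>y. exp (- (pi * c * y\<^sup>2)) *\<^sub>R cis (2 * pi * (y * x)) \<partial>lborel)
         = complex_of_real (c powr (- 1/2) * exp (- (pi * x\<^sup>2 / c)))"
proof -
  \<comment> \<open>the dilation by \<open>k\<close> turns the standard normal density into a multiple of \<open>exp (- pi c y\<^sup>2)\<close>\<close>
  define k where "k = sqrt (2 * pi * c)"
  have k: "k > 0" "k\<^sup>2 = 2 * pi * c" using assms by (simp_all add: k_def)
  define t where "t = 2 * pi * x / k"
  have "complex_of_real (exp (- (t^2) / 2)) = (\<integral>y. iexp (t * y) \<partial>density lborel std_normal_density)"
    using char_std_normal_distribution unfolding char_def by metis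
  also have "\<dots> = (\<integral>y. std_normal_density y *\<^sub>R iexp (t * y) \<partial>lborel)"
    by (subst integral_density) auto
  also have "\<dots> = k *\<^sub>R (\<integral>y. std_normal_density (k * y) *\<^sub>R iexp (t * (k * y)) \<partial>lborel)"
    using k by (subst lborel_integral_real_affine[where t = 0 and c = k]) auto
  also have "(\<lambda>y. std_normal_density (k * y) *\<^sub>R iexp (t * (k * y))) =
    (\<lambda>y. (1 / sqrt (2 * pi)) *\<^sub>R (exp (- (pi * c * y\<^sup>2)) *\<^sub>R cis (2 * pi * (y * x))))"
  proof
    fix y
    have "t * (k * y) = 2 * pi * (y * x)" using k by (simp add: t_def)
    moreover have "- (k * y)\<^sup>2 / 2 = - (pi * c * y\<^sup>2)" by (simp add: power_mult_distrib k)
    ultimately show "std_normal_density (k * y) *\<^sub>R iexp (t * (k * y)) =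
        (1 / sqrt (2 * pi)) *\<^sub>R (exp (- (pi * c * y\<^sup>2)) *\<^sub>R cis (2 * pi * (y * x)))"
      by (simp only: std_normal_density_def cis_conv_exp scaleR_scaleR)
  qed
  also have "k *\<^sub>R (\<integral>y. (1 / sqrt (2 * pi)) *\<^sub>R (exp (- (pi * c * y\<^sup>2)) *\<^sub>R cis (2 * pi * (y * x))) \<partial>lborel) =
     (k / sqrt (2*pi)) *\<^sub>R (\<integral>y. exp (- (pi * c * y\<^sup>2)) *\<^sub>R cis (2 * pi * (y * x)) \<partial>lborel)"
    by (subst integral_scaleR_right) (simp only: scaleR_scaleR times_divide_eq_right mult_1_right)
  finally have *: "complex_of_real (exp (- (t^2) / 2)) = \<dots>" .
  have "k / sqrt (2*pi) = sqrt c" by (simp add: k_def real_sqrt_mult)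
  moreover have "t\<^sup>2 = 2 * pi * x\<^sup>2 / c"
    unfolding t_def power_divide k(2) using assms by (simp add: field_simps power2_eq_square)
  then have "- (t^2) / 2 = - (pi * x\<^sup>2 / c)" by simp
  ultimately have "complex_of_real (exp (- (pi * x\<^sup>2 / c))) =
     sqrt c *\<^sub>R (\<integral>y. exp (- (pi * c * y\<^sup>2)) *\<^sub>R cis (2 * pi * (y * x)) \<partial>lborel)"
    using * by simp
  then show ?thesis using assms by (simp add: powr_minus powr_half_sqrt scaleR_conv_of_real field_simps)
qed

lemma exp_norm_eq_prod:
  fixes x :: "'a::euclidean_space"
  shows "exp (- (r * (norm x)\<^sup>2)) = (\<Prod>b\<in>Basis. exp (- (r * (x \<bullet> b)\<^sup>2)))"
proof -
  have "(norm x)\<^sup>2 = (\<Sum>b\<in>Basis. (x \<bullet> b)\<^sup>2)"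
    unfolding power2_norm_eq_inner by (subst euclidean_inner) (simp add: power2_eq_square)
  then show ?thesis
    by (simp add: sum_distrib_left sum_negf[symmetric] exp_sum)
qed

lemma cis_sum: "finite A \<Longrightarrow> cis (\<Sum>i\<in>A. f i) = (\<Prod>i\<in>A. cis (f i))"
  by (induction A rule: finite_induct) (auto simp: cis_mult[symmetric])

lemma integral_lborel_prod:
  fixes f :: "'a::euclidean_space \<Rightarrow> real \<Rightarrow> complex"
  assumes "\<And>b. b \<in> Basis \<Longrightarrow> integrable lborel (f b)"
  shows "(\<integral>x. (\<Prod>b\<in>Basis. f b (x \<bullet> b)) \<partial>lborel) = (\<Prod>b\<in>Basis. (\<integral>x. f b x \<partial>lborel))"
proof -
  interpret product_sigma_finite "\<lambda>b::'a. lborel :: real measure" ..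
  have [measurable]: "f b \<in> borel_measurable borel" if "b \<in> Basis" for b
    using assms[OF that] by auto
  have "(\<integral>x. (\<Prod>b\<in>Basis. f b (x \<bullet> b)) \<partial>lborel)
      = (\<integral>x. (\<Prod>b\<in>Basis. f b ((\<Sum>b\<in>Basis. x b *\<^sub>R b) \<bullet> b)) \<partial>(\<Pi>\<^sub>M b\<in>Basis. lborel))"
    by (subst lborel_eq, subst integral_distr) auto
  also have "\<dots> = (\<integral>x. (\<Prod>b\<in>Basis. f b (x b)) \<partial>(\<Pi>\<^sub>M b\<in>Basis. lborel))"
    by (intro Bochner_Integration.integral_cong prod.cong refl) (simp add: inner_sum_left inner_Basis if_distrib sum.delta cong: if_cong)
  also have "\<dots> = (\<Prod>b\<in>Basis. (\<integral>x. f b x \<partial>lborel))"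
    by (rule product_integral_prod) (auto intro: assms)
  finally show ?thesis .
qed

lemma gaussian_fourier:
  fixes x :: "'a::euclidean_space" and c :: real
  assumes "c > 0"
  shows "(\<integral>y. exp (- (pi * c * (norm y)\<^sup>2)) *\<^sub>R cis (2 * pi * (y \<bullet> x)) \<partial>lborel)
         = complex_of_real (c powr (- real DIM('a) / 2) * exp (- (pi * (norm x)\<^sup>2 / c)))"
proof -
  have 1: "exp (- (pi * c * (norm y)\<^sup>2)) *\<^sub>R cis (2 * pi * (y \<bullet> x)) =
    (\<Prod>b\<in>Basis. exp (- (pi * c * (y \<bullet> b)\<^sup>2)) *\<^sub>R cis (2 * pi * ((y \<bullet> b) * (x \<bullet> b))))" for y :: 'a
  proof -
    have "2 * pi * (y \<bullet> x) = (\<Sum>b\<in>Basis. 2 * pi * ((y \<bullet> b) * (x \<bullet> b)))"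
      by (subst euclidean_inner) (simp add: sum_distrib_left)
    then show ?thesis
      by (simp only: exp_norm_eq_prod cis_sum[OF finite_Basis]) (simp add: scaleR_conv_of_real prod.distrib)
  qed
  have "(\<integral>y. exp (- (pi * c * (norm y)\<^sup>2)) *\<^sub>R cis (2 * pi * (y \<bullet> x)) \<partial>lborel)
     = (\<Prod>b\<in>Basis. \<integral>y. exp (- (pi * c * y\<^sup>2)) *\<^sub>R cis (2 * pi * (y * (x \<bullet> b))) \<partial>lborel)"
    unfolding 1
  proof (rule integral_lborel_prod[where f = "\<lambda>b y. exp (- (pi * c * y\<^sup>2)) *\<^sub>R cis (2 * pi * (y * (x \<bullet> b)))"])
    fix b :: 'a
    show "integrable lborel (\<lambda>y. exp (- (pi * c * y\<^sup>2)) *\<^sub>R cis (2 * pi * (y * (x \<bullet> b))))"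
      by (rule Bochner_Integration.integrable_bound[OF integrable_gaussian_real[OF assms]]) auto
  qed
  also have "\<dots> = (\<Prod>b\<in>(Basis::'a set). complex_of_real (c powr (- 1/2) * exp (- (pi * (x \<bullet> b)\<^sup>2 / c))))"
    by (simp only: gaussian_fourier_real[OF assms])
  also have "\<dots> = complex_of_real ((c powr (- 1/2)) ^ DIM('a) * exp (- (pi * (norm x)\<^sup>2 / c)))"
    using exp_norm_eq_prod[of "pi / c" x] by (simp add: prod.distrib)
  also have "(c powr (- 1/2)) ^ DIM('a) = c powr (- real DIM('a) / 2)"
    using assms by (simp add: powr_realpow[symmetric] powr_powr)
  finally show ?thesis by simp
qed

lemma nn_integral_gaussian:
  fixes c :: real
  assumes "c > 0"
  shows "(\<integral>\<^sup>+y. ennreal (exp (- (pi * c * (norm (y::'a::euclidean_space))\<^sup>2))) \<partial>lborel)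
         = ennreal (c powr (- real DIM('a) / 2))"
proof -
  have 0: "(\<integral>\<^sup>+y. ennreal (exp (- (pi * c * y\<^sup>2))) \<partial>lborel) = ennreal (c powr (- 1/2))"
  proof -
    have "complex_of_real (\<integral>y. exp (- (pi * c * y\<^sup>2)) \<partial>lborel) = complex_of_real (c powr (- 1/2))"
      using gaussian_fourier_real[OF assms, of 0] by (simp add: scaleR_conv_of_real)
    then have "(\<integral>y. exp (- (pi * c * y\<^sup>2)) \<partial>lborel) = c powr (- 1/2)" by (simp only: of_real_eq_iff)
    then show ?thesis
      using nn_integral_eq_integral[OF integrable_gaussian_real[OF assms]] by simp
  qed
  have "(\<integral>\<^sup>+y. ennreal (exp (- (pi * c * (norm (y::'a))\<^sup>2))) \<partial>lborel) =
     (\<integral>\<^sup>+y. (\<Prod>b\<in>(Basis::'a set). ennreal (exp (- (pi * c * (y \<bullet> b)\<^sup>2)))) \<partial>lborel)"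
    by (simp only: exp_norm_eq_prod) (simp add: prod_ennreal)
  also have "\<dots> = (\<Prod>b\<in>(Basis::'a set). ennreal (c powr (- 1/2)))"
    by (subst nn_integral_lborel_prod) (simp_all add: 0)
  also have "\<dots> = ennreal (c powr (- real DIM('a) / 2))"
    using assms by (simp add: ennreal_power powr_realpow[symmetric] powr_powr)
  finally show ?thesis .
qed

lemma nn_integral_lborel_shift:
  fixes f :: "'a::euclidean_space \<Rightarrow> ennreal"
  assumes [measurable]: "f \<in> borel_measurable borel"
  shows "(\<integral>\<^sup>+x. f (c + x) \<partial>lborel) = (\<integral>\<^sup>+x. f x \<partial>lborel)"
proof -
  have "(\<integral>\<^sup>+x. f x \<partial>lborel) = (\<integral>\<^sup>+x. f x \<partial>distr lborel borel ((+) c))"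
    by (simp only: lborel_distr_plus)
  then show ?thesis by (simp add: nn_integral_distr)
qed

lemma ennreal_norm_integral_le:
  fixes f :: "'b \<Rightarrow> 'c::{banach, second_countable_topology}"
  shows "ennreal (norm (integral\<^sup>L M f)) \<le> (\<integral>\<^sup>+x. ennreal (norm (f x)) \<partial>M)"
  by (cases "integrable M f") (auto simp: integral_norm_bound_ennreal not_integrable_integral_eq)

text \<open>
  The tool behind every passage from space to frequency below: the Gaussian of \<open>\<phi>\<close> is a
  superposition of characters with positive weights, so by Fubini the average on the left is a
  weighted integral of the Fourier coefficients of \<open>g M\<close> along \<open>\<phi>\<close>, and the triangle inequality applies.
\<close>

lemma gaussian_average_le:
  fixes \<phi> :: "'b \<Rightarrow> 'a::euclidean_space" and g :: "'b \<Rightarrow> complex"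
  assumes "finite_measure M" and c: "c > 0"
    and [measurable]: "\<phi> \<in> borel_measurable M" "g \<in> borel_measurable M"
    and g: "\<And>x. norm (g x) \<le> 1"
  shows "ennreal (norm (\<integral>x. exp (- (pi * (norm (\<phi> x))\<^sup>2 / c)) *\<^sub>R g x \<partial>M))
    \<le> (\<integral>\<^sup>+y. ennreal (c powr (real DIM('a) / 2) * exp (- (pi * c * (norm y)\<^sup>2))) *
           ennreal (norm (\<integral>x. cis (2 * pi * (y \<bullet> \<phi> x)) * g x \<partial>M)) \<partial>lborel)"
proof -
  interpret M: finite_measure M by fact
  interpret P: pair_sigma_finite M "lborel :: 'a measure" ..
  let ?G = "\<lambda>y::'a. exp (- (pi * c * (norm y)\<^sup>2))"
  let ?H = "\<lambda>x y. ?G y *\<^sub>R (cis (2 * pi * (y \<bullet> \<phi> x)) * g x)"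
  let ?K = "c powr (real DIM('a) / 2)"
  have int: "integrable (M \<Otimes>\<^sub>M lborel) (case_prod ?H)"
  proof (rule Bochner_Integration.integrable_bound)
    show "integrable (M \<Otimes>\<^sub>M (lborel :: 'a measure)) (\<lambda>(x, y). ?G y)"
    proof (rule integrableI_bounded)
      have "(\<integral>\<^sup>+ z. ennreal (norm (case z of (x, y) \<Rightarrow> ?G y)) \<partial>(M \<Otimes>\<^sub>M lborel)) =
         (\<integral>\<^sup>+ x. \<integral>\<^sup>+ y. ennreal (?G y) \<partial>lborel \<partial>M)"
        by (subst lborel.nn_integral_fst[symmetric]) (auto simp: case_prod_unfold)
      also have "\<dots> < \<infinity>"
        by (simp add: nn_integral_gaussian[OF c] ennreal_mult_eq_top_iff less_top[symmetric])
      finally show "(\<integral>\<^sup>+ z. ennreal (norm (case z of (x, y) \<Rightarrow> ?G y)) \<partial>(M \<Otimes>\<^sub>M lborel)) < \<infinity>" .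
    qed measurable
    show "case_prod ?H \<in> borel_measurable (M \<Otimes>\<^sub>M lborel)" by measurable
    show "AE z in M \<Otimes>\<^sub>M lborel. norm (case_prod ?H z) \<le> norm (case z of (x, y) \<Rightarrow> ?G y)"
      using g by (auto simp: norm_mult case_prod_unfold intro!: mult_left_le)
  qed
  have "(\<integral>x. exp (- (pi * (norm (\<phi> x))\<^sup>2 / c)) *\<^sub>R g x \<partial>M) = (\<integral>x. ?K *\<^sub>R (\<integral>y. ?H x y \<partial>lborel) \<partial>M)"
  proof (rule Bochner_Integration.integral_cong[OF refl])
    fix x
    define I where "I = (\<integral>y. ?H x y \<partial>lborel)"
    have "I = (\<integral>y. ?G y *\<^sub>R cis (2 * pi * (y \<bullet> \<phi> x)) * g x \<partial>lborel)"
      by (simp add: I_def)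
    also have "\<dots> = (\<integral>y. ?G y *\<^sub>R cis (2 * pi * (y \<bullet> \<phi> x)) \<partial>lborel) * g x"
      by (rule integral_mult_left_zero)
    also have "\<dots> = complex_of_real (c powr (- real DIM('a) / 2) * exp (- (pi * (norm (\<phi> x))\<^sup>2 / c))) * g x"
      by (simp only: gaussian_fourier[OF c])
    finally show "exp (- (pi * (norm (\<phi> x))\<^sup>2 / c)) *\<^sub>R g x = ?K *\<^sub>R (\<integral>y. ?H x y \<partial>lborel)"
      unfolding I_def[symmetric] using c by (simp add: scaleR_conv_of_real powr_minus field_simps)
  qed
  also have "\<dots> = ?K *\<^sub>R (\<integral>x. (\<integral>y. ?H x y \<partial>lborel) \<partial>M)" by simp
  also have "(\<integral>x. (\<integral>y. ?H x y \<partial>lborel) \<partial>M) = (\<integral>y. (\<integral>x. ?H x y \<partial>M) \<partial>lborel)"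
    using P.Fubini_integral[of "\<lambda>x y. ?H x y"] int by simp
  also have "?K *\<^sub>R \<dots> = (\<integral>y. ?K *\<^sub>R ?G y *\<^sub>R (\<integral>x. cis (2 * pi * (y \<bullet> \<phi> x)) * g x \<partial>M) \<partial>lborel)"
    by (simp only: integral_scaleR_right)
  finally have eq: "(\<integral>x. exp (- (pi * (norm (\<phi> x))\<^sup>2 / c)) *\<^sub>R g x \<partial>M) = \<dots>" .
  have "ennreal (norm (\<integral>y. ?K *\<^sub>R ?G y *\<^sub>R (\<integral>x. cis (2 * pi * (y \<bullet> \<phi> x)) * g x \<partial>M) \<partial>lborel))
     \<le> (\<integral>\<^sup>+y. ennreal (norm (?K *\<^sub>R ?G y *\<^sub>R (\<integral>x. cis (2 * pi * (y \<bullet> \<phi> x)) * g x \<partial>M))) \<partial>lborel)"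
    by (rule ennreal_norm_integral_le)
  also have "\<dots> = (\<integral>\<^sup>+y. ennreal (?K * ?G y) * ennreal (norm (\<integral>x. cis (2 * pi * (y \<bullet> \<phi> x)) * g x \<partial>M)) \<partial>lborel)"
    by (intro nn_integral_cong) (simp add: ennreal_mult[symmetric] mult.assoc)
  finally show ?thesis using eq by simp
qed

section \<open>Integrability of powers of the norm\<close>

lemma dyadic_shell_ge_1:
  fixes t :: real
  assumes "1 \<le> t"
  obtains k :: nat where "2 ^ k \<le> t" "t < 2 ^ (k + 1)"
proof
  define k where "k = nat \<lfloor>log 2 t\<rfloor>"
  have 0: "0 \<le> log 2 t" using assms by simp
  have "2 powr (real k) \<le> 2 powr (log 2 t)" using 0 unfolding k_def by (intro powr_mono) auto
  then show "2 ^ k \<le> t" using assms powr_realpow[of 2 k] by simp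
  have "2 powr (log 2 t) < 2 powr (real (k + 1))" using 0 unfolding k_def by (intro powr_less_mono) linarith+
  then show "t < 2 ^ (k + 1)" using assms powr_realpow[of 2 "k + 1"] by simp
qed

lemma dyadic_shell_le_1:
  fixes t :: real
  assumes "0 < t" "t \<le> 1"
  obtains k :: nat where "(1/2) ^ (k + 1) < t" "t \<le> (1/2) ^ k"
proof -
  have "1 \<le> 1 / t" using assms by simp
  then obtain k where "2 ^ k \<le> 1 / t" "1 / t < 2 ^ (k + 1)" by (rule dyadic_shell_ge_1)
  then have "(1/2) ^ (k + 1) < t" "t \<le> (1/2) ^ k"
    using assms by (auto simp: field_simps power_one_over)
  then show ?thesis by (rule that)
qed

lemma half_power_eq_powr: "(1/2::real) ^ n = 2 powr (- real n)"
  by (simp add: powr_minus powr_realpow power_one_over inverse_eq_divide)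

lemma four_power_eq_powr: "(4::real) ^ n = 2 powr (2 * real n)"
  using powr_realpow[of 2 "2 * n"] by (simp add: power_mult)

lemma quarter_power_eq_powr: "(1/4::real) ^ n = 2 powr (- 2 * real n)"
  using half_power_eq_powr[of "2 * n"] by (simp add: power_mult power2_eq_square)

lemma suminf_geometric_ennreal_finite:
  fixes q c :: real
  assumes "0 \<le> c" "0 \<le> q" "q < 1"
  shows "(\<Sum>k. ennreal (c * q ^ k)) < \<infinity>"
proof -
  have "summable (\<lambda>k. c * q ^ k)" using assms by (intro summable_mult summable_geometric) auto
  then show ?thesis using assms by (subst suminf_ennreal2) auto
qed

text \<open>
  Near the origin the power is dominated by a lacunary series of Gaussians of widths
  \<open>2 powr (- k)\<close>; their integrals are known exactly and form a geometric series. The exponent is first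
  lowered to at most \<open>1 - d\<close>, so that it is not positive and the power is decreasing.
\<close>

lemma nn_integral_norm_powr_near:
  fixes e :: real
  assumes "e > 0"
  shows "(\<integral>\<^sup>+z. ennreal (norm z powr (e - real DIM('a))) * indicator {z. norm z \<le> 1} z
           \<partial>(lborel :: 'a::euclidean_space measure)) < \<infinity>"
proof -
  define d where "d = real DIM('a)"
  have d1: "d \<ge> 1" by (simp add: d_def Suc_leI)
  define \<alpha> where "\<alpha> = d - min e 1"
  have \<alpha>: "\<alpha> \<ge> 0" using d1 by (simp add: \<alpha>_def)
  define C where "C = 2 powr \<alpha> * exp pi"
  define q where "q = 2 powr (- min e 1)"
  have q: "0 < q" "q < 1" using assms by (auto simp: q_def powr_less_one)
  define g where "g k z = ennreal (C * 2 powr (\<alpha> * real k) * exp (- (pi * 4 ^ k * (norm (z::'a))\<^sup>2)))" for k z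
  have [measurable]: "g k \<in> borel_measurable borel" for k unfolding g_def by measurable
  have "(\<integral>\<^sup>+z. ennreal (norm z powr (e - d)) * indicator {z. norm z \<le> 1} z \<partial>(lborel :: 'a measure))
      \<le> (\<integral>\<^sup>+z. (\<Sum>k. g k z) \<partial>lborel)"
  proof (rule nn_integral_mono)
    fix z :: 'a
    show "ennreal (norm z powr (e - d)) * indicator {z. norm z \<le> 1} z \<le> (\<Sum>k. g k z)"
    proof (cases "0 < norm z \<and> norm z \<le> 1")
      case True
      then obtain k where k: "(1/2) ^ (k + 1) < norm z" "norm z \<le> (1/2) ^ k"
        using dyadic_shell_le_1 by blast
      have "(norm z)\<^sup>2 \<le> ((1/2) ^ k)\<^sup>2" using k by (intro power_mono) auto
      then have "4 ^ k * (norm z)\<^sup>2 \<le> 4 ^ k * ((1/2) ^ k)\<^sup>2" by (intro mult_left_mono) auto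
      also have "\<dots> = 1" by (simp add: power2_eq_square power_mult_distrib[symmetric])
      finally have "exp pi * exp (- (pi * 4 ^ k * (norm z)\<^sup>2)) \<ge> 1"
        by (simp add: exp_add[symmetric] mult.assoc)
      moreover have "norm z powr (e - d) \<le> 2 powr \<alpha> * 2 powr (\<alpha> * real k)"
      proof -
        have "norm z powr (e - d) \<le> norm z powr (- \<alpha>)"
          using True by (intro powr_mono') (auto simp: \<alpha>_def)
        also have "\<dots> \<le> ((1/2) ^ (k + 1)) powr (- \<alpha>)"
          using k \<alpha> by (intro powr_mono2') auto
        also have "((1/2::real) ^ (k + 1)) = 2 powr (- real (k + 1))"
          by (rule half_power_eq_powr)
        also have "(2 powr (- real (k + 1))) powr (- \<alpha>) = 2 powr (real (k + 1) * \<alpha>)"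
          unfolding powr_powr by (simp add: algebra_simps)
        also have "\<dots> = 2 powr \<alpha> * 2 powr (\<alpha> * real k)"
          by (simp add: powr_add[symmetric] algebra_simps)
        finally show ?thesis .
      qed
      ultimately have "norm z powr (e - d) * 1 \<le>
          (2 powr \<alpha> * 2 powr (\<alpha> * real k)) * (exp pi * exp (- (pi * 4 ^ k * (norm z)\<^sup>2)))"
        by (intro mult_mono) auto
      then have "ennreal (norm z powr (e - d)) \<le> g k z"
        unfolding g_def C_def by (intro ennreal_leI) (simp add: mult_ac)
      also have "g k z \<le> (\<Sum>k. g k z)" using sum_le_suminf[OF summableI, of "{k}" "\<lambda>k. g k z"] by simp
      finally show ?thesis using True by simp
    qed (auto simp: indicator_def)
  qed
  also have "\<dots> = (\<Sum>k. \<integral>\<^sup>+z. g k z \<partial>lborel)" by (rule nn_integral_suminf) measurable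
  also have "\<dots> = (\<Sum>k. ennreal (C * q ^ k))"
  proof (rule suminf_cong)
    fix k
    have "(\<integral>\<^sup>+z. g k z \<partial>lborel) = ennreal (C * 2 powr (\<alpha> * real k)) * ennreal ((4 ^ k) powr (- d / 2))"
      unfolding g_def d_def
      by (subst nn_integral_gaussian[symmetric]) (auto simp: ennreal_mult nn_integral_cmult C_def)
    also have "(4 ^ k) powr (- d / 2) = 2 powr (- d * real k)"
      by (simp add: four_power_eq_powr powr_powr mult_ac)
    also have "ennreal (C * 2 powr (\<alpha> * real k)) * ennreal (2 powr (- d * real k)) = ennreal (C * q ^ k)"
      by (simp add: ennreal_mult[symmetric] C_def q_def powr_realpow[symmetric] powr_powr
            powr_add[symmetric] \<alpha>_def algebra_simps)
    finally show "(\<integral>\<^sup>+z. g k z \<partial>lborel) = ennreal (C * q ^ k)" .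
  qed
  also have "\<dots> < \<infinity>" using q by (intro suminf_geometric_ennreal_finite) (auto simp: C_def)
  finally show ?thesis unfolding d_def .
qed

text \<open>
  The same domination, now by Gaussians of widths \<open>2 powr k\<close>.
\<close>

lemma nn_integral_norm_powr_far:
  fixes e :: real
  assumes "e > 0"
  shows "(\<integral>\<^sup>+z. ennreal (norm z powr (- real DIM('a) - e)) * indicator {z. norm z \<ge> 1} z
           \<partial>(lborel :: 'a::euclidean_space measure)) < \<infinity>"
proof -
  define d where "d = real DIM('a)"
  define \<alpha> where "\<alpha> = d + e"
  have \<alpha>: "\<alpha> \<ge> 0" using assms by (simp add: \<alpha>_def d_def)
  define C where "C = exp (4 * pi)"
  define q where "q = 2 powr (- e)"
  have q: "0 < q" "q < 1" using assms by (auto simp: q_def powr_less_one)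
  define g where "g k z = ennreal (C * 2 powr (- \<alpha> * real k) * exp (- (pi * (1/4) ^ k * (norm (z::'a))\<^sup>2)))" for k z
  have [measurable]: "g k \<in> borel_measurable borel" for k unfolding g_def by measurable
  have "(\<integral>\<^sup>+z. ennreal (norm z powr (- d - e)) * indicator {z. norm z \<ge> 1} z \<partial>(lborel :: 'a measure))
      \<le> (\<integral>\<^sup>+z. (\<Sum>k. g k z) \<partial>lborel)"
  proof (rule nn_integral_mono)
    fix z :: 'a
    show "ennreal (norm z powr (- d - e)) * indicator {z. norm z \<ge> 1} z \<le> (\<Sum>k. g k z)"
    proof (cases "1 \<le> norm z")
      case True
      then obtain k where k: "2 ^ k \<le> norm z" "norm z < 2 ^ (k + 1)"
        by (rule dyadic_shell_ge_1)
      have "(norm z)\<^sup>2 \<le> (2 ^ (k + 1))\<^sup>2" using k by (intro power_mono) auto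
      then have "(1/4) ^ k * (norm z)\<^sup>2 \<le> (1/4) ^ k * (2 ^ (k + 1))\<^sup>2" by (intro mult_left_mono) auto
      also have "\<dots> = 4" by (simp add: power2_eq_square power_mult_distrib[symmetric])
      finally have "pi * ((1/4) ^ k * (norm z)\<^sup>2) \<le> pi * 4" by (intro mult_left_mono) auto
      then have "C * exp (- (pi * (1/4) ^ k * (norm z)\<^sup>2)) \<ge> 1"
        by (simp add: exp_add[symmetric] mult.assoc C_def)
      moreover have "norm z powr (- d - e) \<le> 2 powr (- \<alpha> * real k)"
      proof -
        have "norm z powr (- \<alpha>) \<le> (2 ^ k) powr (- \<alpha>)"
          using k \<alpha> by (intro powr_mono2') auto
        also have "\<dots> = 2 powr (- \<alpha> * real k)"
          by (simp add: powr_powr powr_realpow[symmetric] mult_ac)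
        finally show ?thesis by (simp add: \<alpha>_def)
      qed
      ultimately have "norm z powr (- d - e) * 1 \<le>
          (2 powr (- \<alpha> * real k)) * (C * exp (- (pi * (1/4) ^ k * (norm z)\<^sup>2)))"
        by (intro mult_mono) auto
      then have "ennreal (norm z powr (- d - e)) \<le> g k z"
        unfolding g_def by (intro ennreal_leI) (simp add: mult_ac)
      also have "g k z \<le> (\<Sum>k. g k z)" using sum_le_suminf[OF summableI, of "{k}" "\<lambda>k. g k z"] by simp
      finally show ?thesis using True by simp
    qed (auto simp: indicator_def)
  qed
  also have "\<dots> = (\<Sum>k. \<integral>\<^sup>+z. g k z \<partial>lborel)" by (rule nn_integral_suminf) measurable
  also have "\<dots> = (\<Sum>k. ennreal (C * q ^ k))"
  proof (rule suminf_cong)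
    fix k
    have "(\<integral>\<^sup>+z. g k z \<partial>lborel) = ennreal (C * 2 powr (- \<alpha> * real k)) * ennreal (((1/4) ^ k) powr (- d / 2))"
      unfolding g_def d_def
      by (subst nn_integral_gaussian[symmetric]) (auto simp: ennreal_mult nn_integral_cmult C_def)
    also have "((1/4) ^ k) powr (- d / 2) = 2 powr (d * real k)"
      by (simp add: quarter_power_eq_powr powr_powr mult_ac)
    also have "ennreal (C * 2 powr (- \<alpha> * real k)) * ennreal (2 powr (d * real k)) = ennreal (C * q ^ k)"
      by (simp add: ennreal_mult[symmetric] C_def q_def powr_realpow[symmetric] powr_powr
            powr_add[symmetric] \<alpha>_def algebra_simps)
    finally show "(\<integral>\<^sup>+z. g k z \<partial>lborel) = ennreal (C * q ^ k)" .
  qed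
  also have "\<dots> < \<infinity>" using q by (intro suminf_geometric_ennreal_finite) (auto simp: C_def)
  finally show ?thesis unfolding d_def .
qed

lemma fourier_transform_cis:
  "fourier_transform \<mu> z = (\<integral>x. cis (- (2 * pi * (z \<bullet> x))) \<partial>\<mu>)"
  unfolding fourier_transform_def cis_conv_exp by (simp add: mult_ac)

lemma borel_measurable_fourier_transform [measurable]:
  fixes \<mu> :: "'a::euclidean_space measure"
  assumes "prob_space \<mu>" and [measurable_cong]: "sets \<mu> = sets borel"
  shows "fourier_transform \<mu> \<in> borel_measurable borel"
proof -
  interpret prob_space \<mu> by fact
  show ?thesis unfolding fourier_transform_cis[abs_def] by measurable
qed

lemma norm_fourier_transform_le_1:
  assumes "prob_space \<mu>"
  shows "norm (fourier_transform \<mu> z) \<le> 1"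
proof -
  interpret prob_space \<mu> by fact
  have "ennreal (norm (fourier_transform \<mu> z)) \<le> (\<integral>\<^sup>+x. ennreal (norm (cis (- (2 * pi * (z \<bullet> x))))) \<partial>\<mu>)"
    unfolding fourier_transform_cis by (rule ennreal_norm_integral_le)
  also have "\<dots> = 1" by (simp add: emeasure_space_1)
  finally show ?thesis by simp
qed

section \<open>Damped Fourier transforms and energies of differences\<close>

text \<open>
  The Fourier transform of the measure with Gaussian density \<open>exp (- pi |x|\<^sup>2)\<close> with respect to \<open>\<mu>\<close>.
\<close>

definition damped_fourier :: "'a::euclidean_space measure \<Rightarrow> 'a \<Rightarrow> complex" where
  "damped_fourier \<mu> \<xi> = (\<integral>x. exp (- (pi * (norm x)\<^sup>2)) *\<^sub>R cis (- (2 * pi * (\<xi> \<bullet> x))) \<partial>\<mu>)"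

lemma borel_measurable_damped_fourier [measurable]:
  fixes \<mu> :: "'a::euclidean_space measure"
  assumes "prob_space \<mu>" and [measurable_cong]: "sets \<mu> = sets borel"
  shows "damped_fourier \<mu> \<in> borel_measurable borel"
proof -
  interpret prob_space \<mu> by fact
  show ?thesis unfolding damped_fourier_def[abs_def] by measurable
qed

lemma norm_damped_fourier_le_1:
  assumes "prob_space \<mu>"
  shows "norm (damped_fourier \<mu> z) \<le> 1"
proof -
  interpret prob_space \<mu> by fact
  have "ennreal (norm (damped_fourier \<mu> z)) \<le>
      (\<integral>\<^sup>+x. ennreal (norm (exp (- (pi * (norm x)\<^sup>2)) *\<^sub>R cis (- (2 * pi * (z \<bullet> x))))) \<partial>\<mu>)"
    unfolding damped_fourier_def by (rule ennreal_norm_integral_le)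
  also have "\<dots> \<le> (\<integral>\<^sup>+x. 1 \<partial>\<mu>)" by (intro nn_integral_mono) simp
  also have "\<dots> = 1" by (simp add: emeasure_space_1)
  finally show ?thesis by simp
qed

lemma norm_damped_fourier_minus: "norm (damped_fourier \<mu> (- z)) = norm (damped_fourier \<mu> z)"
proof -
  have "damped_fourier \<mu> (- z) = cnj (damped_fourier \<mu> z)"
    unfolding damped_fourier_def by (subst Bochner_Integration.integral_cnj[symmetric]) (simp add: cis_cnj)
  then show ?thesis by simp
qed

text \<open>
  The product with a Gaussian in space is a convolution with a Gaussian in frequency.
\<close>

lemma norm_damped_fourier_le_average:
  fixes \<mu> :: "'a::euclidean_space measure"
  assumes "prob_space \<mu>" and [measurable_cong]: "sets \<mu> = sets borel"
  shows "ennreal (norm (damped_fourier \<mu> \<xi>)) \<le>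
    (\<integral>\<^sup>+\<eta>. ennreal (exp (- (pi * (norm \<eta>)\<^sup>2))) * ennreal (norm (fourier_transform \<mu> (\<xi> - \<eta>))) \<partial>lborel)"
proof -
  interpret prob_space \<mu> by fact
  have [simp]: "(\<integral>x. cis (2 * pi * (y \<bullet> x)) * cis (- (2 * pi * (\<xi> \<bullet> x))) \<partial>\<mu>) = fourier_transform \<mu> (\<xi> - y)" for y
    unfolding fourier_transform_cis by (simp add: cis_mult inner_diff_left algebra_simps)
  show ?thesis
    using gaussian_average_le[of \<mu> 1 "\<lambda>x. x" "\<lambda>x. cis (- (2 * pi * (\<xi> \<bullet> x)))"]
    by (simp add: damped_fourier_def finite_measure_axioms)
qed

text \<open>
  A one-dimensional Gaussian in the affine phase \<open>\<tau> - 2 x \<bullet> v\<close> sees \<open>\<mu>\<close> only through its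
  damped transform on the line spanned by \<open>v\<close>; the constant \<open>\<tau>\<close> contributes a unimodular factor.
\<close>

lemma gaussian_of_linear_phase_le:
  fixes \<mu> :: "'a::euclidean_space measure"
  assumes "prob_space \<mu>" and [measurable_cong]: "sets \<mu> = sets borel" and "\<delta> > 0"
  shows "ennreal (\<integral>x. exp (- (pi * (norm x)\<^sup>2)) * exp (- (pi * (\<tau> - 2 * (x \<bullet> v))\<^sup>2 / \<delta>\<^sup>2)) \<partial>\<mu>)
    \<le> (\<integral>\<^sup>+t. ennreal (\<delta> * exp (- (pi * \<delta>\<^sup>2 * t\<^sup>2))) * ennreal (norm (damped_fourier \<mu> ((2 * t) *\<^sub>R v))) \<partial>lborel)"
proof -
  interpret prob_space \<mu> by fact
  have 1: "norm (\<integral>x. cis (2 * pi * (t * (\<tau> - 2 * (x \<bullet> v)))) * complex_of_real (exp (- (pi * (norm x)\<^sup>2))) \<partial>\<mu>)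
      = norm (damped_fourier \<mu> ((2 * t) *\<^sub>R v))" for t
  proof -
    have "(\<integral>x. cis (2 * pi * (t * (\<tau> - 2 * (x \<bullet> v)))) * complex_of_real (exp (- (pi * (norm x)\<^sup>2))) \<partial>\<mu>)
       = (\<integral>x. cis (2 * pi * t * \<tau>) * (exp (- (pi * (norm x)\<^sup>2)) *\<^sub>R cis (- (2 * pi * (((2 * t) *\<^sub>R v) \<bullet> x)))) \<partial>\<mu>)"
      by (intro Bochner_Integration.integral_cong refl)
         (simp add: scaleR_conv_of_real cis_mult mult.commute mult.left_commute inner_commute[of v] algebra_simps)
    also have "\<dots> = cis (2 * pi * t * \<tau>) * damped_fourier \<mu> ((2 * t) *\<^sub>R v)"
      unfolding damped_fourier_def by (rule integral_mult_right_zero)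
    finally show ?thesis by (simp add: norm_mult)
  qed
  define X where "X = (\<integral>x. exp (- (pi * (norm x)\<^sup>2)) * exp (- (pi * (\<tau> - 2 * (x \<bullet> v))\<^sup>2 / \<delta>\<^sup>2)) \<partial>\<mu>)"
  have X: "X \<ge> 0" unfolding X_def by (intro integral_nonneg_AE) auto
  have "complex_of_real X = (\<integral>x. exp (- (pi * (norm (\<tau> - 2 * (x \<bullet> v)))\<^sup>2 / \<delta>\<^sup>2)) *\<^sub>R complex_of_real (exp (- (pi * (norm x)\<^sup>2))) \<partial>\<mu>)"
    unfolding X_def by (subst integral_complex_of_real[symmetric]) (simp add: scaleR_conv_of_real mult.commute)
  then have "ennreal X = ennreal (norm (\<integral>x. exp (- (pi * (norm (\<tau> - 2 * (x \<bullet> v)))\<^sup>2 / \<delta>\<^sup>2)) *\<^sub>R complex_of_real (exp (- (pi * (norm x)\<^sup>2))) \<partial>\<mu>))"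
    using X by (metis abs_of_nonneg norm_of_real)
  also have "\<dots> \<le> (\<integral>\<^sup>+t. ennreal ((\<delta>\<^sup>2) powr (real DIM(real) / 2) * exp (- (pi * \<delta>\<^sup>2 * (norm t)\<^sup>2))) *
      ennreal (norm (\<integral>x. cis (2 * pi * (t \<bullet> (\<tau> - 2 * (x \<bullet> v)))) * complex_of_real (exp (- (pi * (norm x)\<^sup>2))) \<partial>\<mu>)) \<partial>lborel)"
    using assms by (intro gaussian_average_le) (auto simp: finite_measure_axioms)
  also have "(\<delta>\<^sup>2) powr (real DIM(real) / 2) = \<delta>"
    using assms by (simp add: powr_half_sqrt)
  finally show ?thesis
    unfolding X_def[symmetric] by (simp add: 1)
qed

text \<open>
  The law of the difference of two independent points has a transform of modulus \<open>|N^|\<^sup>2\<close>; in this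
  form it serves both for \<open>\<mu>\<^sub>2\<close> and for the law of the differences itself.
\<close>

lemma norm_integral_cis_difference:
  fixes N :: "'a::euclidean_space measure"
  assumes "prob_space N" and [measurable_cong]: "sets N = sets borel"
  shows "norm (\<integral>p. cis (2 * pi * (\<eta> \<bullet> (fst p - snd p))) \<partial>(N \<Otimes>\<^sub>M N)) = (norm (fourier_transform N \<eta>))\<^sup>2"
proof -
  interpret prob_space N by fact
  interpret P: pair_prob_space N N ..
  have int: "integrable (N \<Otimes>\<^sub>M N) (\<lambda>p. cis (2 * pi * (\<eta> \<bullet> (fst p - snd p))))"
    by (rule P.integrable_const_bound[where B = 1]) auto
  have "(\<integral>p. cis (2 * pi * (\<eta> \<bullet> (fst p - snd p))) \<partial>(N \<Otimes>\<^sub>M N))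
      = (\<integral>x. \<integral>y. cis (2 * pi * (\<eta> \<bullet> (x - y))) \<partial>N \<partial>N)"
    using P.integral_fst'[OF int] by simp
  also have "\<dots> = (\<integral>x. cis (2 * pi * (\<eta> \<bullet> x)) * fourier_transform N \<eta> \<partial>N)"
  proof (rule Bochner_Integration.integral_cong[OF refl])
    fix x
    have "(\<integral>y. cis (2 * pi * (\<eta> \<bullet> (x - y))) \<partial>N) = (\<integral>y. cis (2 * pi * (\<eta> \<bullet> x)) * cis (- (2 * pi * (\<eta> \<bullet> y))) \<partial>N)"
      by (simp add: cis_mult inner_diff_right right_diff_distrib)
    also have "\<dots> = cis (2 * pi * (\<eta> \<bullet> x)) * fourier_transform N \<eta>"
      unfolding fourier_transform_cis by (rule integral_mult_right_zero)
    finally show "(\<integral>y. cis (2 * pi * (\<eta> \<bullet> (x - y))) \<partial>N) = cis (2 * pi * (\<eta> \<bullet> x)) * fourier_transform N \<eta>" .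
  qed
  also have "\<dots> = (\<integral>x. cis (2 * pi * (\<eta> \<bullet> x)) \<partial>N) * fourier_transform N \<eta>"
    by (rule integral_mult_left_zero)
  also have "(\<integral>x. cis (2 * pi * (\<eta> \<bullet> x)) \<partial>N) = cnj (fourier_transform N \<eta>)"
    unfolding fourier_transform_cis by (subst Bochner_Integration.integral_cnj[symmetric]) (simp add: cis_cnj)
  finally show ?thesis by (simp add: norm_mult power2_eq_square)
qed

definition difference_law :: "'a::euclidean_space measure \<Rightarrow> 'a measure" where
  "difference_law \<mu> = distr (\<mu> \<Otimes>\<^sub>M \<mu>) borel (\<lambda>p. fst p - snd p)"

lemma sets_difference_law [simp, measurable_cong]: "sets (difference_law \<mu>) = sets borel"
  by (simp add: difference_law_def)

lemma measurable_diff_pair: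
  fixes \<mu> :: "'a::euclidean_space measure"
  assumes [measurable_cong]: "sets \<mu> = sets borel"
  shows "(\<lambda>p. fst p - snd p) \<in> borel_measurable (\<mu> \<Otimes>\<^sub>M \<mu>)"
  by measurable

lemma prob_space_difference_law:
  fixes \<mu> :: "'a::euclidean_space measure"
  assumes "prob_space \<mu>" "sets \<mu> = sets borel"
  shows "prob_space (difference_law \<mu>)"
proof -
  interpret prob_space \<mu> by fact
  interpret P: pair_prob_space \<mu> \<mu> ..
  show ?thesis unfolding difference_law_def
    by (rule P.prob_space_distr[OF measurable_diff_pair[OF assms(2)]])
qed

lemma norm_fourier_difference_law:
  fixes \<mu> :: "'a::euclidean_space measure"
  assumes "prob_space \<mu>" "sets \<mu> = sets borel"
  shows "norm (fourier_transform (difference_law \<mu>) \<eta>) = (norm (fourier_transform \<mu> \<eta>))\<^sup>2"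
proof -
  have "fourier_transform (difference_law \<mu>) \<eta>
      = (\<integral>p. cis (- (2 * pi * (\<eta> \<bullet> (fst p - snd p)))) \<partial>(\<mu> \<Otimes>\<^sub>M \<mu>))"
    unfolding fourier_transform_cis difference_law_def
    by (rule integral_distr[OF measurable_diff_pair[OF assms(2)]]) measurable
  also have "\<dots> = cnj (\<integral>p. cis (2 * pi * (\<eta> \<bullet> (fst p - snd p))) \<partial>(\<mu> \<Otimes>\<^sub>M \<mu>))"
    by (subst Bochner_Integration.integral_cnj[symmetric]) (simp add: cis_cnj)
  finally show ?thesis using norm_integral_cis_difference[OF assms] by simp
qed

lemma powr_le_exp_square:
  fixes e t :: real
  assumes "e \<ge> 0" "t > 0"
  shows "t powr e \<le> exp (e\<^sup>2) * exp (t\<^sup>2)"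
proof -
  have "t powr e = exp (e * ln t)" using assms by (simp add: powr_def)
  also have "e * ln t \<le> e * t"
    using assms ln_le_minus_one[of t] by (intro mult_left_mono) auto
  also have "e * t \<le> e\<^sup>2 + t\<^sup>2"
    using assms sum_squares_bound[of e t] mult_nonneg_nonneg[of e t] by linarith
  finally show ?thesis by (simp add: exp_add)
qed

text \<open>
  On the frequency side the left-hand side is the integral of \<open>|\<kappa>^|\<^sup>2\<close> against a Gaussian
  of width proportional to \<open>r\<close> and height proportional to \<open>r powr (- d)\<close>. Since the Gaussian decays faster
  than any power, it is dominated by the weight \<open>r powr (- 2 a) |\<eta>| powr (2 a - d)\<close>; this uses that the
  exponent \<open>2 a - d\<close> is not positive.
\<close>

lemma gaussian_energy_le:
  fixes \<kappa> :: "'a::euclidean_space measure"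
  assumes "prob_space \<kappa>" and [measurable_cong]: "sets \<kappa> = sets borel"
    and a: "2 * a \<le> real DIM('a)"
    and J: "(\<integral>\<^sup>+\<eta>. ennreal ((norm (fourier_transform \<kappa> \<eta>))\<^sup>2 * norm \<eta> powr (2 * a - real DIM('a))) \<partial>lborel) < \<infinity>"
  obtains C where "C \<ge> 0"
    "\<And>r. r > 0 \<Longrightarrow> (\<integral>\<^sup>+w. \<integral>\<^sup>+w'. ennreal (exp (- (pi / 4 * r\<^sup>2 * (norm (w - w'))\<^sup>2))) \<partial>\<kappa> \<partial>\<kappa>) \<le> ennreal (C * r powr (- 2 * a))"
proof -
  interpret prob_space \<kappa> by fact
  interpret P: pair_prob_space \<kappa> \<kappa> ..
  define d where "d = real DIM('a)"
  define J where "J = (\<integral>\<^sup>+\<eta>. ennreal ((norm (fourier_transform \<kappa> \<eta>))\<^sup>2 * norm \<eta> powr (2 * a - d)) \<partial>lborel)"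
  have J_eq: "J = ennreal (enn2real J)" using J unfolding J_def d_def by simp
  define e where "e = d - 2 * a"
  have e: "e \<ge> 0" using a by (simp add: e_def d_def)
  define K where "K = 2 powr d * exp (e\<^sup>2)"
  have [measurable]: "fourier_transform \<kappa> \<in> borel_measurable borel"
    by (rule borel_measurable_fourier_transform) fact+
  show ?thesis
  proof (rule that[of "K * enn2real J"])
    show "K * enn2real J \<ge> 0" by (simp add: K_def)
    fix r :: real assume r: "r > 0"
    let ?E = "\<lambda>p. exp (- (pi / 4 * r\<^sup>2 * (norm (fst p - snd p))\<^sup>2))"
    \<comment> \<open>the width for which \<open>pi / c\<close> is the coefficient \<open>pi / 4 * r\<^sup>2\<close> on the left-hand side\<close>
    define c where "c = 4 / r\<^sup>2"
    have c: "c > 0" using r by (simp add: c_def)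
    have int: "integrable (\<kappa> \<Otimes>\<^sub>M \<kappa>) ?E"
      by (rule P.integrable_const_bound[where B = 1]) auto
    have "(\<integral>\<^sup>+w. \<integral>\<^sup>+w'. ennreal (exp (- (pi / 4 * r\<^sup>2 * (norm (w - w'))\<^sup>2))) \<partial>\<kappa> \<partial>\<kappa>)
        = (\<integral>\<^sup>+p. ennreal (?E p) \<partial>(\<kappa> \<Otimes>\<^sub>M \<kappa>))"
      by (subst nn_integral_fst[symmetric]) auto
    also have "\<dots> = ennreal (\<integral>p. ?E p \<partial>(\<kappa> \<Otimes>\<^sub>M \<kappa>))"
      by (rule nn_integral_eq_integral[OF int]) auto
    also have "\<dots> = ennreal (norm (\<integral>p. exp (- (pi * (norm (fst p - snd p))\<^sup>2 / c)) *\<^sub>R (1::complex) \<partial>(\<kappa> \<Otimes>\<^sub>M \<kappa>)))"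
    proof -
      have "(\<integral>p. exp (- (pi * (norm (fst p - snd p))\<^sup>2 / c)) *\<^sub>R (1::complex) \<partial>(\<kappa> \<Otimes>\<^sub>M \<kappa>))
          = complex_of_real (\<integral>p. ?E p \<partial>(\<kappa> \<Otimes>\<^sub>M \<kappa>))"
        by (subst integral_complex_of_real[symmetric])
           (simp add: c_def scaleR_conv_of_real mult_ac)
      moreover have "(\<integral>p. ?E p \<partial>(\<kappa> \<Otimes>\<^sub>M \<kappa>)) \<ge> 0" by (intro integral_nonneg_AE) auto
      ultimately show ?thesis by simp
    qed
    also have "\<dots> \<le> (\<integral>\<^sup>+\<eta>. ennreal (c powr (real DIM('a) / 2) * exp (- (pi * c * (norm \<eta>)\<^sup>2))) *
        ennreal (norm (\<integral>p. cis (2 * pi * (\<eta> \<bullet> (fst p - snd p))) * 1 \<partial>(\<kappa> \<Otimes>\<^sub>M \<kappa>))) \<partial>lborel)"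
      by (rule gaussian_average_le) (use c in \<open>auto intro: P.finite_measure_axioms\<close>)
    also have "\<dots> = (\<integral>\<^sup>+\<eta>. ennreal (c powr (d / 2) * exp (- (pi * c * (norm \<eta>)\<^sup>2)) * (norm (fourier_transform \<kappa> \<eta>))\<^sup>2) \<partial>lborel)"
      unfolding mult_1_right norm_integral_cis_difference[OF assms(1,2)] d_def
      by (intro nn_integral_cong) (simp add: ennreal_mult)
    also have "\<dots> \<le> (\<integral>\<^sup>+\<eta>. ennreal (K * r powr (- 2 * a)) *
        ennreal ((norm (fourier_transform \<kappa> \<eta>))\<^sup>2 * norm \<eta> powr (2 * a - d)) \<partial>lborel)"
    proof (rule nn_integral_mono_AE)
      have "AE \<eta> in lborel. \<eta> \<noteq> (0::'a)" by (rule AE_lborel_singleton)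
      then show "AE \<eta> in lborel. ennreal (c powr (d / 2) * exp (- (pi * c * (norm \<eta>)\<^sup>2)) * (norm (fourier_transform \<kappa> \<eta>))\<^sup>2)
        \<le> ennreal (K * r powr (- 2 * a)) * ennreal ((norm (fourier_transform \<kappa> \<eta>))\<^sup>2 * norm \<eta> powr (2 * a - d))"
      proof eventually_elim
        case (elim \<eta>)
        \<comment> \<open>the claim is scale invariant in \<open>t\<close>: a Gaussian in \<open>t\<close> is at most a multiple of \<open>t powr (- e)\<close>\<close>
        define t where "t = norm \<eta> / r"
        have t: "t > 0" using elim r by (simp add: t_def)
        have "t powr e \<le> exp (e\<^sup>2) * exp (t\<^sup>2)" by (rule powr_le_exp_square) fact+
        then have "t powr e * exp (- (t\<^sup>2)) \<le> exp (e\<^sup>2)"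
          by (simp add: exp_minus field_simps)
        moreover have "exp (- (pi * c * (norm \<eta>)\<^sup>2)) \<le> exp (- (t\<^sup>2))"
        proof -
          have "pi * c * (norm \<eta>)\<^sup>2 = 4 * pi * t\<^sup>2" by (simp add: c_def t_def power_divide)
          moreover have "1 * t\<^sup>2 \<le> 4 * pi * t\<^sup>2" using pi_gt3 by (intro mult_right_mono) auto
          ultimately show ?thesis by (simp only: exp_le_cancel_iff neg_le_iff_le)
        qed
        ultimately have "t powr e * exp (- (pi * c * (norm \<eta>)\<^sup>2)) \<le> exp (e\<^sup>2)"
          by (smt (verit) mult_left_mono powr_ge_zero)
        then have 1: "exp (- (pi * c * (norm \<eta>)\<^sup>2)) \<le> exp (e\<^sup>2) * t powr (- e)"
          using t by (simp add: powr_minus field_simps)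
        have "c powr (d / 2) = 2 powr d * r powr (- d)"
        proof -
          have "c = (2 / r) powr 2" using r by (simp add: c_def power_divide)
          then have "c powr (d / 2) = (2 / r) powr d" by (simp only: powr_powr) simp
          then show ?thesis using r by (simp add: powr_divide powr_minus_divide)
        qed
        then have "c powr (d / 2) * exp (- (pi * c * (norm \<eta>)\<^sup>2)) \<le> (2 powr d * r powr (- d)) * (exp (e\<^sup>2) * t powr (- e))"
          by (metis 1 mult_left_mono powr_ge_zero)
        also have "t powr (- e) = norm \<eta> powr (2 * a - d) * r powr e"
        proof -
          have "t powr (- e) = norm \<eta> powr (- e) / r powr (- e)"
            unfolding t_def using r by (simp add: powr_divide)
          moreover have "r powr e = 1 / r powr (- e)" by (simp add: powr_minus_divide)
          moreover have "2 * a - d = - e" by (simp add: e_def)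
          ultimately show ?thesis by simp
        qed
        also have "(2 powr d * r powr (- d)) * (exp (e\<^sup>2) * (norm \<eta> powr (2 * a - d) * r powr e))
            = K * (r powr (- d) * r powr e) * norm \<eta> powr (2 * a - d)"
          by (simp add: K_def)
        also have "r powr (- d) * r powr e = r powr (- 2 * a)"
          using r by (simp add: powr_add[symmetric] e_def)
        finally have "c powr (d / 2) * exp (- (pi * c * (norm \<eta>)\<^sup>2)) * (norm (fourier_transform \<kappa> \<eta>))\<^sup>2
           \<le> K * r powr (- 2 * a) * norm \<eta> powr (2 * a - d) * (norm (fourier_transform \<kappa> \<eta>))\<^sup>2"
          by (rule mult_right_mono) simp
        then show ?case
          by (subst ennreal_mult[symmetric]) (auto simp: K_def mult_ac intro!: ennreal_leI)
      qed
    qed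
    also have "\<dots> = ennreal (K * r powr (- 2 * a)) * J"
      unfolding J_def by (rule nn_integral_cmult) measurable
    also have "\<dots> = ennreal (K * enn2real J * r powr (- 2 * a))"
      by (subst J_eq, subst ennreal_mult[symmetric]) (auto simp: K_def mult_ac)
    finally show "(\<integral>\<^sup>+w. \<integral>\<^sup>+w'. ennreal (exp (- (pi / 4 * r\<^sup>2 * (norm (w - w'))\<^sup>2))) \<partial>\<kappa> \<partial>\<kappa>)
      \<le> ennreal (K * enn2real J * r powr (- 2 * a))" .
  qed
qed

section \<open>Decay of Gaussian averages along a measure\<close>

lemma nn_integral_lborel_reflect:
  fixes f :: "'a::euclidean_space \<Rightarrow> ennreal"
  assumes [measurable]: "f \<in> borel_measurable borel"
  shows "(\<integral>\<^sup>+x. f (c - x) \<partial>lborel) = (\<integral>\<^sup>+x. f x \<partial>lborel)"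
proof -
  have "(\<integral>\<^sup>+x. f x \<partial>lborel) = (\<integral>\<^sup>+x. f x \<partial>density (distr lborel borel (\<lambda>x. c + (-1) *\<^sub>R x)) (\<lambda>_. ennreal (\<bar>- 1\<bar> ^ DIM('a))))"
    by (simp only: lborel_affine[of "-1" c, symmetric])
  then show ?thesis by (simp add: nn_integral_density nn_integral_distr)
qed

text \<open>
  A pointwise substitute for Jensen's inequality: integrated against a probability measure
  and with \<open>\<epsilon>\<close> of the size of the \<open>p\<close>-norm of \<open>x\<close>, it bounds the mean by twice that norm.
\<close>

lemma powr_le_split_at:
  fixes x \<epsilon> p :: real
  assumes "0 \<le> x" "0 < \<epsilon>" "1 \<le> p"
  shows "x \<le> \<epsilon> + \<epsilon> powr (1 - p) * x powr p"
proof (cases "x \<le> \<epsilon>")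
  case True
  then show ?thesis by (simp add: add_increasing2)
next
  case False
  then have "x = x powr (1 - p) * x powr p" using assms by (simp add: powr_add[symmetric])
  also have "\<dots> \<le> \<epsilon> powr (1 - p) * x powr p"
    using False assms by (intro mult_right_mono powr_mono2') auto
  finally show ?thesis using assms by simp
qed

text \<open>
  Used as a pointwise substitute for the Cauchy--Schwarz inequality, with \<open>l\<close> the
  expected ratio of the two norms.
\<close>

lemma mult_le_weighted_squares:
  fixes x y l :: real
  assumes "l > 0"
  shows "x * y \<le> l * x\<^sup>2 + y\<^sup>2 / l"
proof -
  have "0 \<le> (sqrt l * x - y / (2 * sqrt l))\<^sup>2" by simp
  also have "\<dots> = l * x\<^sup>2 - x * y + y\<^sup>2 / (4 * l)"
    using assms by (simp add: power2_diff power_mult_distrib power_divide)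
  finally have "x * y \<le> l * x\<^sup>2 + y\<^sup>2 / (4 * l)" by simp
  also have "y\<^sup>2 / (4 * l) \<le> y\<^sup>2 / l" using assms by (intro divide_left_mono) auto
  finally show ?thesis by simp
qed

lemma parallelogram_midpoint:
  fixes x y z :: "'a::euclidean_space"
  shows "(norm (x - z))\<^sup>2 + (norm (y - z))\<^sup>2 = 2 * (norm (z - (1/2) *\<^sub>R (x + y)))\<^sup>2 + (norm (x - y))\<^sup>2 / 2"
  by (simp add: power2_norm_eq_inner inner_simps inner_commute algebra_simps field_simps)

text \<open>
  Complete the square at the midpoint of \<open>x\<close> and \<open>y\<close>.
\<close>

lemma gaussian_overlap:
  fixes x y :: "'a::euclidean_space"
  shows "(\<integral>\<^sup>+z. ennreal (exp (- (pi / 2 * (norm (x - z))\<^sup>2))) * ennreal (exp (- (pi / 2 * (norm (y - z))\<^sup>2))) \<partial>lborel)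
    = ennreal (exp (- (pi / 4 * (norm (x - y))\<^sup>2)))"
proof -
  define m where "m = (1/2) *\<^sub>R (x + y)"
  have "ennreal (exp (- (pi / 2 * (norm (x - z))\<^sup>2))) * ennreal (exp (- (pi / 2 * (norm (y - z))\<^sup>2)))
     = ennreal (exp (- (pi / 4 * (norm (x - y))\<^sup>2))) * ennreal (exp (- (pi * 1 * (norm (- m + z))\<^sup>2)))" for z
  proof -
    have "pi / 2 * (norm (x - z))\<^sup>2 + pi / 2 * (norm (y - z))\<^sup>2 = pi / 2 * ((norm (x - z))\<^sup>2 + (norm (y - z))\<^sup>2)"
      by (simp add: algebra_simps)
    also have "\<dots> = pi / 4 * (norm (x - y))\<^sup>2 + pi * 1 * (norm (- m + z))\<^sup>2"
      unfolding parallelogram_midpoint m_def by (simp add: algebra_simps)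
    finally show ?thesis by (simp add: ennreal_mult[symmetric] exp_add[symmetric])
  qed
  then have "(\<integral>\<^sup>+z. ennreal (exp (- (pi / 2 * (norm (x - z))\<^sup>2))) * ennreal (exp (- (pi / 2 * (norm (y - z))\<^sup>2))) \<partial>lborel)
    = (\<integral>\<^sup>+z. ennreal (exp (- (pi / 4 * (norm (x - y))\<^sup>2))) * ennreal (exp (- (pi * 1 * (norm (- m + z))\<^sup>2))) \<partial>lborel)"
    by simp
  also have "\<dots> = ennreal (exp (- (pi / 4 * (norm (x - y))\<^sup>2))) * (\<integral>\<^sup>+z. ennreal (exp (- (pi * 1 * (norm (- m + z))\<^sup>2))) \<partial>lborel)"
    by (rule nn_integral_cmult) measurable
  also have "(\<integral>\<^sup>+z. ennreal (exp (- (pi * 1 * (norm (- m + z))\<^sup>2))) \<partial>lborel) = 1"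
    by (subst nn_integral_lborel_shift) (simp_all add: nn_integral_gaussian[of 1, simplified])
  finally show ?thesis by simp
qed

text \<open>
  Half of the Gaussian absorbs the polynomial weight \<open>|z| powr e\<close>, because \<open>|z|\<close> is at most
  \<open>r (L + |r w - z|)\<close>.
\<close>

lemma norm_powr_gaussian_le:
  fixes w z :: "'a::euclidean_space"
  assumes "norm w \<le> L" "r \<ge> 1" "e \<ge> 0"
  shows "norm z powr e * exp (- (pi * (norm (r *\<^sub>R w - z))\<^sup>2))
    \<le> ((L + 1) powr e * exp (e\<^sup>2)) * r powr e * exp (- (pi / 2 * (norm (r *\<^sub>R w - z))\<^sup>2))"
proof -
  define T where "T = norm (r *\<^sub>R w - z)"
  have T: "T \<ge> 0" by (simp add: T_def)
  have L: "L \<ge> 0" using assms(1) norm_ge_zero order_trans by blast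
  have "norm z \<le> norm (r *\<^sub>R w) + T"
    using norm_triangle_ineq4[of "r *\<^sub>R w" "r *\<^sub>R w - z"] by (simp add: T_def)
  also have "\<dots> \<le> r * L + r * T" using assms T by (intro add_mono) (auto intro: mult_left_mono mult_right_mono[of 1 r T, simplified])
  also have "\<dots> \<le> r * ((L + 1) * (T + 1))"
    using assms L T by (simp add: algebra_simps)
  finally have "norm z powr e \<le> (r * ((L + 1) * (T + 1))) powr e"
    using assms by (intro powr_mono2) auto
  also have "\<dots> = r powr e * ((L + 1) powr e * (T + 1) powr e)"
    using assms L T by (simp add: powr_mult)
  also have "(T + 1) powr e \<le> exp (e\<^sup>2) * exp (T\<^sup>2)"
  proof -
    have "(T + 1) powr e \<le> exp T powr e"
      using T assms by (intro powr_mono2) (auto simp: add.commute)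
    also have "\<dots> = exp (e * T)" by (simp add: powr_def)
    also have "e * T \<le> e\<^sup>2 + T\<^sup>2"
      using assms T sum_squares_bound[of e T] mult_nonneg_nonneg[of e T] by linarith
    finally show ?thesis by (simp add: exp_add)
  qed
  finally have "norm z powr e \<le> r powr e * ((L + 1) powr e * (exp (e\<^sup>2) * exp (T\<^sup>2)))"
    using L by (simp add: mult_left_mono)
  then have "norm z powr e * exp (- (pi * T\<^sup>2)) \<le> (r powr e * ((L + 1) powr e * (exp (e\<^sup>2) * exp (T\<^sup>2)))) * exp (- (pi * T\<^sup>2))"
    by (rule mult_right_mono) simp
  also have "\<dots> = ((L + 1) powr e * exp (e\<^sup>2)) * r powr e * (exp (T\<^sup>2) * exp (- (pi * T\<^sup>2)))" by simp
  also have "exp (T\<^sup>2) * exp (- (pi * T\<^sup>2)) \<le> exp (- (pi / 2 * T\<^sup>2))"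
  proof -
    have "2 * T\<^sup>2 \<le> pi * T\<^sup>2" using pi_gt3 by (intro mult_right_mono) auto
    then show ?thesis by (simp add: exp_add[symmetric])
  qed
  finally show ?thesis by (simp add: T_def mult_left_mono)
qed

text \<open>
  The analytic core. The split at \<open>\<epsilon> = r powr (- \<gamma>)\<close> reduces the claim to the average of \<open>F powr p\<close>.
  After Fubini that average is the integral of \<open>F powr p\<close> against the density \<open>K\<close> of \<open>r \<kappa>\<close> smoothed at unit
  scale. Cauchy--Schwarz with the weight \<open>|z| powr (- b)\<close> separates the assumed integral of
  \<open>F powr (2 p)\<close> from the weighted \<open>L\<^sup>2\<close>-norm of \<open>K\<close>, which is an energy of \<open>\<kappa>\<close>.
\<close>

lemma gaussian_average_decay:
  fixes \<kappa> :: "'a::euclidean_space measure" and F :: "'a \<Rightarrow> real"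
  assumes "prob_space \<kappa>" and [measurable_cong]: "sets \<kappa> = sets borel"
    and supp: "AE w in \<kappa>. norm w \<le> L"
    and F [measurable]: "F \<in> borel_measurable borel" and F0: "\<And>z. F z \<ge> 0"
    and b: "b \<ge> 0" and p: "p \<ge> 1"
    and J1: "(\<integral>\<^sup>+z. ennreal (F z powr (2 * p) * norm z powr (- b)) \<partial>lborel) < \<infinity>"
    and a: "2 * a \<le> real DIM('a)"
    and J2: "(\<integral>\<^sup>+\<eta>. ennreal ((norm (fourier_transform \<kappa> \<eta>))\<^sup>2 * norm \<eta> powr (2 * a - real DIM('a))) \<partial>lborel) < \<infinity>"
    and \<gamma>: "\<gamma> * p = a - b / 2"
  obtains C where "C \<ge> 0"
    "\<And>r. r \<ge> 1 \<Longrightarrow> (\<integral>\<^sup>+w. \<integral>\<^sup>+\<eta>. ennreal (exp (- (pi * (norm \<eta>)\<^sup>2))) * ennreal (F (r *\<^sub>R w - \<eta>)) \<partial>lborel \<partial>\<kappa>)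
       \<le> ennreal (C * r powr (- \<gamma>))"
proof -
  interpret prob_space \<kappa> by fact
  interpret P: pair_sigma_finite \<kappa> "lborel :: 'a measure" ..
  interpret P': pair_sigma_finite "lborel :: 'a measure" \<kappa> ..
  obtain C2 where C2: "C2 \<ge> 0" "\<And>r. r > 0 \<Longrightarrow>
      (\<integral>\<^sup>+w. \<integral>\<^sup>+w'. ennreal (exp (- (pi / 4 * r\<^sup>2 * (norm (w - w'))\<^sup>2))) \<partial>\<kappa> \<partial>\<kappa>) \<le> ennreal (C2 * r powr (- 2 * a))"
    using gaussian_energy_le[OF assms(1,2) a J2] by blast
  define J where "J = (\<integral>\<^sup>+z. ennreal (F z powr (2 * p) * norm z powr (- b)) \<partial>lborel)"
  have J_eq: "J = ennreal (enn2real J)" using J1 unfolding J_def by simp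
  define e where "e = b / 2"
  have e: "e \<ge> 0" using b by (simp add: e_def)
  define M where "M = (L + 1) powr e * exp (e\<^sup>2)"
  have M: "M \<ge> 0" by (simp add: M_def)
  define C1 where "C1 = enn2real J + M\<^sup>2 * C2"
  have C1: "C1 \<ge> 0" using C2 by (simp add: C1_def)
  show ?thesis
  proof (rule that[of "1 + C1"])
    show "1 + C1 \<ge> 0" using C1 by simp
    fix r :: real assume r: "r \<ge> 1"
    \<comment> \<open>\<open>K\<close> is the smoothed density of \<open>r \<kappa>\<close>; the wider \<open>K'\<close> absorbs the weight\<close>
    define K where "K z = (\<integral>\<^sup>+w. ennreal (exp (- (pi * (norm (r *\<^sub>R w - z))\<^sup>2))) \<partial>\<kappa>)" for z
    define K' where "K' z = (\<integral>\<^sup>+w. ennreal (exp (- (pi / 2 * (norm (r *\<^sub>R w - z))\<^sup>2))) \<partial>\<kappa>)" for z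
    have [measurable]: "K \<in> borel_measurable borel" "K' \<in> borel_measurable borel"
      unfolding K_def[abs_def] K'_def[abs_def] by measurable
    have K_le: "K z \<le> 1" "K' z \<le> 1" for z
    proof -
      have "K z \<le> (\<integral>\<^sup>+w. 1 \<partial>\<kappa>)" unfolding K_def by (intro nn_integral_mono) simp
      then show "K z \<le> 1" by (simp add: emeasure_space_1)
      have "K' z \<le> (\<integral>\<^sup>+w. 1 \<partial>\<kappa>)" unfolding K'_def by (intro nn_integral_mono) simp
      then show "K' z \<le> 1" by (simp add: emeasure_space_1)
    qed
    have weight: "ennreal (norm z powr e) * K z \<le> ennreal (M * r powr e) * K' z" for z
    proof -
      have "ennreal (norm z powr e) * K z = (\<integral>\<^sup>+w. ennreal (norm z powr e) * ennreal (exp (- (pi * (norm (r *\<^sub>R w - z))\<^sup>2))) \<partial>\<kappa>)"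
        unfolding K_def by (rule nn_integral_cmult[symmetric]) measurable
      also have "\<dots> \<le> (\<integral>\<^sup>+w. ennreal (M * r powr e) * ennreal (exp (- (pi / 2 * (norm (r *\<^sub>R w - z))\<^sup>2))) \<partial>\<kappa>)"
      proof (rule nn_integral_mono_AE)
        show "AE w in \<kappa>. ennreal (norm z powr e) * ennreal (exp (- (pi * (norm (r *\<^sub>R w - z))\<^sup>2)))
           \<le> ennreal (M * r powr e) * ennreal (exp (- (pi / 2 * (norm (r *\<^sub>R w - z))\<^sup>2)))"
          using supp
        proof eventually_elim
          case (elim w)
          show ?case
            using norm_powr_gaussian_le[OF elim r e, of z] M
            by (subst (1 2) ennreal_mult[symmetric]) (auto simp: M_def intro!: ennreal_leI)
        qed
      qed
      also have "\<dots> = ennreal (M * r powr e) * K' z"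
        unfolding K'_def by (rule nn_integral_cmult) measurable
      finally show ?thesis .
    qed
    have K'2: "(\<integral>\<^sup>+z. K' z * K' z \<partial>lborel) \<le> ennreal (C2 * r powr (- 2 * a))"
    proof -
      let ?g = "\<lambda>w z. ennreal (exp (- (pi / 2 * (norm (r *\<^sub>R w - z))\<^sup>2)))"
      have "(\<integral>\<^sup>+z. K' z * K' z \<partial>lborel) = (\<integral>\<^sup>+z. \<integral>\<^sup>+w. \<integral>\<^sup>+w'. ?g w z * ?g w' z \<partial>\<kappa> \<partial>\<kappa> \<partial>lborel)"
      proof (rule nn_integral_cong)
        fix z :: 'a
        have "K' z * K' z = (\<integral>\<^sup>+w. ?g w z * K' z \<partial>\<kappa>)"
          by (subst nn_integral_multc) (auto simp: K'_def)
        also have "\<dots> = (\<integral>\<^sup>+w. \<integral>\<^sup>+w'. ?g w z * ?g w' z \<partial>\<kappa> \<partial>\<kappa>)"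
          unfolding K'_def by (intro nn_integral_cong nn_integral_cmult[symmetric]) measurable
        finally show "K' z * K' z = (\<integral>\<^sup>+w. \<integral>\<^sup>+w'. ?g w z * ?g w' z \<partial>\<kappa> \<partial>\<kappa>)" .
      qed
      also have "\<dots> = (\<integral>\<^sup>+w. \<integral>\<^sup>+z. \<integral>\<^sup>+w'. ?g w z * ?g w' z \<partial>\<kappa> \<partial>lborel \<partial>\<kappa>)"
        by (rule P.Fubini') measurable
      also have "\<dots> = (\<integral>\<^sup>+w. \<integral>\<^sup>+w'. \<integral>\<^sup>+z. ?g w z * ?g w' z \<partial>lborel \<partial>\<kappa> \<partial>\<kappa>)"
        by (intro nn_integral_cong P.Fubini') measurable
      also have "\<dots> = (\<integral>\<^sup>+w. \<integral>\<^sup>+w'. ennreal (exp (- (pi / 4 * r\<^sup>2 * (norm (w - w'))\<^sup>2))) \<partial>\<kappa> \<partial>\<kappa>)"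
        unfolding gaussian_overlap
        by (simp add: scaleR_diff_right[symmetric] power_mult_distrib mult.assoc)
      also have "\<dots> \<le> ennreal (C2 * r powr (- 2 * a))" using r by (intro C2) auto
      finally show ?thesis .
    qed
    have r0: "r > 0" using r by simp
    have Bp: "(\<integral>\<^sup>+w. \<integral>\<^sup>+\<eta>. ennreal (exp (- (pi * (norm \<eta>)\<^sup>2))) * ennreal (F (r *\<^sub>R w - \<eta>) powr p) \<partial>lborel \<partial>\<kappa>)
        \<le> ennreal (C1 * r powr (e - a))"
    proof -
      have "(\<integral>\<^sup>+w. \<integral>\<^sup>+\<eta>. ennreal (exp (- (pi * (norm \<eta>)\<^sup>2))) * ennreal (F (r *\<^sub>R w - \<eta>) powr p) \<partial>lborel \<partial>\<kappa>)
         = (\<integral>\<^sup>+w. \<integral>\<^sup>+z. ennreal (exp (- (pi * (norm (r *\<^sub>R w - z))\<^sup>2))) * ennreal (F z powr p) \<partial>lborel \<partial>\<kappa>)"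
      proof (rule nn_integral_cong)
        fix w
        show "(\<integral>\<^sup>+\<eta>. ennreal (exp (- (pi * (norm \<eta>)\<^sup>2))) * ennreal (F (r *\<^sub>R w - \<eta>) powr p) \<partial>lborel)
          = (\<integral>\<^sup>+z. ennreal (exp (- (pi * (norm (r *\<^sub>R w - z))\<^sup>2))) * ennreal (F z powr p) \<partial>lborel)"
          by (subst nn_integral_lborel_reflect[of _ "r *\<^sub>R w", symmetric]) auto
      qed
      also have "\<dots> = (\<integral>\<^sup>+z. \<integral>\<^sup>+w. ennreal (exp (- (pi * (norm (r *\<^sub>R w - z))\<^sup>2))) * ennreal (F z powr p) \<partial>\<kappa> \<partial>lborel)"
        by (rule P.Fubini'[symmetric]) measurable
      also have "\<dots> = (\<integral>\<^sup>+z. K z * ennreal (F z powr p) \<partial>lborel)"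
        unfolding K_def by (intro nn_integral_cong nn_integral_multc) measurable
      also have "\<dots> \<le> (\<integral>\<^sup>+z. ennreal (r powr (e - a)) * ennreal (F z powr (2 * p) * norm z powr (- b))
          + ennreal (r powr (a - e) * (M * r powr e)\<^sup>2) * (K' z * K' z) \<partial>lborel)"
      proof (rule nn_integral_mono_AE)
        have "AE z in lborel. z \<noteq> (0::'a)" by (rule AE_lborel_singleton)
        then show "AE z in lborel. K z * ennreal (F z powr p) \<le> ennreal (r powr (e - a)) * ennreal (F z powr (2 * p) * norm z powr (- b))
          + ennreal (r powr (a - e) * (M * r powr e)\<^sup>2) * (K' z * K' z)"
        proof eventually_elim
          case (elim z)
          define k where "k = enn2real (K z)"
          define k' where "k' = enn2real (K' z)"
          have "K z < \<top>" "K' z < \<top>"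
            using K_le[of z] by (auto intro: le_less_trans)
          then have Kk: "K z = ennreal k" "K' z = ennreal k'" by (auto simp: k_def k'_def)
          have k0: "k \<ge> 0" "k' \<ge> 0" by (auto simp: k_def k'_def)
          have w: "norm z powr e * k \<le> (M * r powr e) * k'"
            using weight[of z] k0 M unfolding Kk
            by (subst (asm) (1 2) ennreal_mult[symmetric]) auto
          \<comment> \<open>the two factors of Cauchy--Schwarz, with ratio \<open>r powr (e - a)\<close> of their norms\<close>
          define x where "x = F z powr p * norm z powr (- e)"
          define y where "y = norm z powr e * k"
          have "k * F z powr p = x * y"
            using elim by (simp add: x_def y_def powr_minus)
          also have "\<dots> \<le> r powr (e - a) * x\<^sup>2 + y\<^sup>2 / r powr (e - a)"
            using r0 by (intro mult_le_weighted_squares) auto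
          also have "y\<^sup>2 / r powr (e - a) = r powr (a - e) * y\<^sup>2"
            using r0 by (simp add: powr_diff field_simps)
          also have "x\<^sup>2 = F z powr (2 * p) * norm z powr (- b)"
            using powr_powr[of "F z" p 2] powr_powr[of "norm z" "-e" 2] elim F0[of z]
            by (simp add: x_def power_mult_distrib e_def mult.commute)
          finally have "k * F z powr p \<le> r powr (e - a) * (F z powr (2 * p) * norm z powr (- b))
              + r powr (a - e) * y\<^sup>2" .
          moreover have "r powr (a - e) * y\<^sup>2 \<le> r powr (a - e) * ((M * r powr e) * k')\<^sup>2"
            unfolding y_def using w k0 by (intro mult_left_mono power_mono) auto
          moreover have "r powr (a - e) * ((M * r powr e) * k')\<^sup>2 = r powr (a - e) * (M * r powr e)\<^sup>2 * (k' * k')"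
            by (simp add: power2_eq_square)
          ultimately have "k * F z powr p \<le> r powr (e - a) * (F z powr (2 * p) * norm z powr (- b))
              + r powr (a - e) * (M * r powr e)\<^sup>2 * (k' * k')"
            by linarith
          then have "ennreal (k * F z powr p) \<le> ennreal (r powr (e - a) * (F z powr (2 * p) * norm z powr (- b))
              + r powr (a - e) * (M * r powr e)\<^sup>2 * (k' * k'))" by (rule ennreal_leI)
          then show ?case unfolding Kk using k0 by (simp add: ennreal_mult ennreal_plus mult.assoc)
        qed
      qed
      also have "\<dots> = ennreal (r powr (e - a)) * J + ennreal (r powr (a - e) * (M * r powr e)\<^sup>2) * (\<integral>\<^sup>+z. K' z * K' z \<partial>lborel)"
        unfolding J_def by (subst nn_integral_add) (auto simp: nn_integral_cmult)
      also have "\<dots> \<le> ennreal (r powr (e - a)) * ennreal (enn2real J)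
          + ennreal (r powr (a - e) * (M * r powr e)\<^sup>2) * ennreal (C2 * r powr (- 2 * a))"
        using J_eq K'2 by (intro add_mono mult_left_mono) auto
      also have "\<dots> = ennreal (r powr (e - a) * enn2real J + r powr (a - e) * (M * r powr e)\<^sup>2 * (C2 * r powr (- 2 * a)))"
        using C2 by (simp add: ennreal_mult ennreal_plus)
      also have "r powr (a - e) * (M * r powr e)\<^sup>2 * (C2 * r powr (- 2 * a))
          = M\<^sup>2 * C2 * (r powr (a - e) * (r powr e * r powr e) * r powr (- 2 * a))"
        by (simp add: power2_eq_square)
      also have "r powr (a - e) * (r powr e * r powr e) * r powr (- 2 * a) = r powr (e - a)"
        using r0 by (simp add: powr_add[symmetric])
      finally show ?thesis by (simp add: C1_def algebra_simps)
    qed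
    define \<epsilon> where "\<epsilon> = r powr (- \<gamma>)"
    have \<epsilon>: "\<epsilon> > 0" using r0 by (simp add: \<epsilon>_def)
    have split: "(\<integral>\<^sup>+\<eta>. ennreal (exp (- (pi * (norm \<eta>)\<^sup>2))) * ennreal (F (r *\<^sub>R w - \<eta>)) \<partial>lborel)
      \<le> ennreal \<epsilon> + ennreal (\<epsilon> powr (1 - p)) *
        (\<integral>\<^sup>+\<eta>. ennreal (exp (- (pi * (norm \<eta>)\<^sup>2))) * ennreal (F (r *\<^sub>R w - \<eta>) powr p) \<partial>lborel)" for w
    proof -
      have "(\<integral>\<^sup>+\<eta>. ennreal (exp (- (pi * (norm \<eta>)\<^sup>2))) * ennreal (F (r *\<^sub>R w - \<eta>)) \<partial>lborel)
        \<le> (\<integral>\<^sup>+\<eta>. ennreal \<epsilon> * ennreal (exp (- (pi * 1 * (norm \<eta>)\<^sup>2))) +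
           ennreal (\<epsilon> powr (1 - p)) * (ennreal (exp (- (pi * (norm \<eta>)\<^sup>2))) * ennreal (F (r *\<^sub>R w - \<eta>) powr p)) \<partial>lborel)"
      proof (rule nn_integral_mono)
        fix \<eta>
        let ?g = "exp (- (pi * (norm \<eta>)\<^sup>2))" and ?f = "F (r *\<^sub>R w - \<eta>)"
        have "?g * ?f \<le> ?g * (\<epsilon> + \<epsilon> powr (1 - p) * ?f powr p)"
          using F0 \<epsilon> p by (intro mult_left_mono powr_le_split_at) auto
        also have "\<dots> = \<epsilon> * ?g + \<epsilon> powr (1 - p) * (?g * ?f powr p)" by (simp add: algebra_simps)
        finally have "ennreal (?g * ?f) \<le> ennreal (\<epsilon> * ?g + \<epsilon> powr (1 - p) * (?g * ?f powr p))"
          by (rule ennreal_leI)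
        then show "ennreal ?g * ennreal ?f \<le> ennreal \<epsilon> * ennreal (exp (- (pi * 1 * (norm \<eta>)\<^sup>2))) +
            ennreal (\<epsilon> powr (1 - p)) * (ennreal ?g * ennreal (?f powr p))"
          using F0 \<epsilon> by (simp add: ennreal_mult ennreal_plus)
      qed
      also have "\<dots> = ennreal \<epsilon> * (\<integral>\<^sup>+\<eta>. ennreal (exp (- (pi * 1 * (norm (\<eta>::'a))\<^sup>2))) \<partial>lborel) + ennreal (\<epsilon> powr (1 - p)) *
        (\<integral>\<^sup>+\<eta>. ennreal (exp (- (pi * (norm \<eta>)\<^sup>2))) * ennreal (F (r *\<^sub>R w - \<eta>) powr p) \<partial>lborel)"
        by (subst nn_integral_add) (auto simp: nn_integral_cmult)
      finally show ?thesis by (subst (asm) nn_integral_gaussian) auto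
    qed
    have "(\<integral>\<^sup>+w. \<integral>\<^sup>+\<eta>. ennreal (exp (- (pi * (norm \<eta>)\<^sup>2))) * ennreal (F (r *\<^sub>R w - \<eta>)) \<partial>lborel \<partial>\<kappa>)
      \<le> (\<integral>\<^sup>+w. ennreal \<epsilon> + ennreal (\<epsilon> powr (1 - p)) *
        (\<integral>\<^sup>+\<eta>. ennreal (exp (- (pi * (norm \<eta>)\<^sup>2))) * ennreal (F (r *\<^sub>R w - \<eta>) powr p) \<partial>lborel) \<partial>\<kappa>)"
      by (intro nn_integral_mono split)
    also have "\<dots> = ennreal \<epsilon> + ennreal (\<epsilon> powr (1 - p)) *
        (\<integral>\<^sup>+w. \<integral>\<^sup>+\<eta>. ennreal (exp (- (pi * (norm \<eta>)\<^sup>2))) * ennreal (F (r *\<^sub>R w - \<eta>) powr p) \<partial>lborel \<partial>\<kappa>)"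
      by (subst nn_integral_add) (auto simp: nn_integral_cmult emeasure_space_1)
    also have "\<dots> \<le> ennreal \<epsilon> + ennreal (\<epsilon> powr (1 - p)) * ennreal (C1 * r powr (e - a))"
      by (intro add_left_mono mult_left_mono Bp) simp
    also have "\<dots> = ennreal (\<epsilon> + C1 * (\<epsilon> powr (1 - p) * r powr (e - a)))"
      using \<epsilon> C1 by (simp add: ennreal_mult[symmetric] ennreal_plus[symmetric] mult_ac del: ennreal_plus)
    also have "\<epsilon> powr (1 - p) * r powr (e - a) = \<epsilon>"
    proof -
      have "\<epsilon> powr (1 - p) * r powr (e - a) = r powr (- \<gamma> * (1 - p) + (e - a))"
        by (simp only: \<epsilon>_def powr_powr powr_add)
      also have "- \<gamma> * (1 - p) + (e - a) = - \<gamma>"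
        using \<gamma> by (simp add: e_def algebra_simps)
      finally show ?thesis by (simp only: \<epsilon>_def)
    qed
    finally show "(\<integral>\<^sup>+w. \<integral>\<^sup>+\<eta>. ennreal (exp (- (pi * (norm \<eta>)\<^sup>2))) * ennreal (F (r *\<^sub>R w - \<eta>)) \<partial>lborel \<partial>\<kappa>)
       \<le> ennreal ((1 + C1) * r powr (- \<gamma>))"
      by (simp add: \<epsilon>_def algebra_simps)
  qed
qed

section \<open>Comparing Fourier moments at different parameters\<close>

text \<open>
  The integral inside \<open>fourier_energy\<close> for \<open>\<theta> > 0\<close>; it is finite exactly when the energy is.
\<close>

definition fourier_moment :: "real \<Rightarrow> real \<Rightarrow> 'a::euclidean_space measure \<Rightarrow> ennreal" where
  "fourier_moment \<theta> s \<mu> = (\<integral>\<^sup>+z. ennreal (norm (fourier_transform \<mu> z) powr (2 / \<theta>)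
      * norm z powr (s / \<theta> - real DIM('a))) \<partial>lborel)"

lemma fourier_moment_finite_of_energy:
  assumes "fourier_energy s \<theta> \<mu> < \<infinity>" "\<theta> \<noteq> 0"
  shows "fourier_moment \<theta> s \<mu> < \<infinity>"
  using assms by (auto simp: fourier_energy_def fourier_moment_def ennreal_powr_def less_top split: if_splits)

text \<open>
  Only large frequencies matter, since the transform is bounded by 1 and the weight is integrable
  at the origin when \<open>s > 0\<close>.
\<close>

lemma fourier_moment_finiteI:
  fixes \<mu> :: "'a::euclidean_space measure"
  assumes \<mu>: "prob_space \<mu>" "sets \<mu> = sets borel" and \<theta>: "\<theta> > 0" and s: "s > 0"
    and h [measurable]: "h \<in> borel_measurable borel" and h_fin: "(\<integral>\<^sup>+z. h z \<partial>lborel) < \<infinity>"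
    and far: "\<And>z. norm z \<ge> 1 \<Longrightarrow>
      ennreal (norm (fourier_transform \<mu> z) powr (2 / \<theta>) * norm z powr (s / \<theta> - real DIM('a))) \<le> h z"
  shows "fourier_moment \<theta> s \<mu> < \<infinity>"
proof -
  let ?near = "\<lambda>z::'a. ennreal (norm z powr (s / \<theta> - real DIM('a))) * indicator {z. norm z \<le> 1} z"
  have "fourier_moment \<theta> s \<mu> \<le> (\<integral>\<^sup>+z. ?near z + h z \<partial>lborel)"
    unfolding fourier_moment_def
  proof (rule nn_integral_mono)
    fix z :: 'a
    show "ennreal (norm (fourier_transform \<mu> z) powr (2 / \<theta>) * norm z powr (s / \<theta> - real DIM('a))) \<le> ?near z + h z"
    proof (cases "norm z \<ge> 1")
      case True
      then show ?thesis using far[of z] by (simp add: add_increasing)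
    next
      case False
      have "norm (fourier_transform \<mu> z) powr (2 / \<theta>) \<le> 1"
        using norm_fourier_transform_le_1[OF \<mu>(1), of z] \<theta> by (intro powr_le1) auto
      then have "norm (fourier_transform \<mu> z) powr (2 / \<theta>) * norm z powr (s / \<theta> - real DIM('a))
          \<le> 1 * norm z powr (s / \<theta> - real DIM('a))"
        by (intro mult_right_mono) auto
      then have "ennreal (norm (fourier_transform \<mu> z) powr (2 / \<theta>) * norm z powr (s / \<theta> - real DIM('a))) \<le> ?near z"
        using False by (auto intro!: ennreal_leI)
      then show ?thesis by (simp add: add_increasing2)
    qed
  qed
  also have "\<dots> = (\<integral>\<^sup>+z. ?near z \<partial>lborel) + (\<integral>\<^sup>+z. h z \<partial>lborel)"
    by (rule nn_integral_add) measurable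
  also have "\<dots> < \<infinity>"
    using nn_integral_norm_powr_near[of "s / \<theta>", where 'a = 'a] h_fin \<theta> s by simp
  finally show ?thesis .
qed

text \<open>
  With \<open>q = m\<^sup>2 \<rho> powr s\<close> the integrands at all parameters become powers of the same quantity
  \<open>q\<close> times a power of \<open>\<rho>\<close>, so that they can be compared according to whether \<open>q \<ge> 1\<close>.
\<close>

lemma fourier_integrand_split:
  fixes m \<rho> :: real
  assumes "m \<ge> 0" "\<rho> > 0" "\<theta> > 0"
  shows "m powr (2 / \<theta>) * \<rho> powr (s' / \<theta> - d) = (m\<^sup>2 * \<rho> powr s) powr (1 / \<theta>) * \<rho> powr (- d - (s - s') / \<theta>)"
proof -
  have "(m\<^sup>2 * \<rho> powr s) powr (1 / \<theta>) = (m powr 2) powr (1 / \<theta>) * (\<rho> powr s) powr (1 / \<theta>)"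
    using assms by (simp add: powr_mult)
  also have "\<dots> = m powr (2 / \<theta>) * \<rho> powr (s / \<theta>)" by (simp add: powr_powr)
  finally have "(m\<^sup>2 * \<rho> powr s) powr (1 / \<theta>) * \<rho> powr (- d - (s - s') / \<theta>)
      = m powr (2 / \<theta>) * \<rho> powr (s / \<theta> + (- d - (s - s') / \<theta>))"
    by (simp only: powr_add mult.assoc)
  also have "s / \<theta> + (- d - (s - s') / \<theta>) = s' / \<theta> - d" by (simp add: diff_divide_distrib)
  finally show ?thesis ..
qed

text \<open>
  The Fourier spectrum does not decrease in \<open>\<theta>\<close>. Where \<open>q = |\<mu>^ z|\<^sup>2 |z| powr s\<close> is at least 1, the
  integrand at \<open>\<theta>'\<close> is at most the one at \<open>\<theta>\<close>; where \<open>q \<le> 1\<close>, the loss from \<open>s\<close> to \<open>s'\<close> makes it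
  integrable on its own. For \<open>\<theta> = 0\<close> the quantity \<open>q\<close> is bounded.
\<close>

lemma fourier_moment_mono_theta:
  fixes \<mu> :: "'a::euclidean_space measure"
  assumes \<mu>: "prob_space \<mu>" "sets \<mu> = sets borel"
    and \<theta>: "0 \<le> \<theta>" "\<theta> \<le> \<theta>'" "0 < \<theta>'" and s: "0 < s'" "s' < s"
    and fin: "fourier_energy s \<theta> \<mu> < \<infinity>"
  shows "fourier_moment \<theta>' s' \<mu> < \<infinity>"
proof -
  define d where "d = real DIM('a)"
  define \<epsilon> where "\<epsilon> = (s - s') / \<theta>'"
  have \<epsilon>: "\<epsilon> > 0" using s \<theta> by (simp add: \<epsilon>_def)
  let ?m = "\<lambda>z. norm (fourier_transform \<mu> z)"
  let ?far = "\<lambda>z::'a. ennreal (norm z powr (- d - \<epsilon>)) * indicator {z. norm z \<ge> 1} z"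
  have [measurable]: "fourier_transform \<mu> \<in> borel_measurable borel"
    by (rule borel_measurable_fourier_transform) fact+
  have far_fin: "(\<integral>\<^sup>+z. ?far z \<partial>lborel) < \<infinity>"
    unfolding d_def by (rule nn_integral_norm_powr_far[OF \<epsilon>])
  have split: "?m z powr (2 / \<theta>') * norm z powr (s' / \<theta>' - d)
      = ((?m z)\<^sup>2 * norm z powr s) powr (1 / \<theta>') * norm z powr (- d - \<epsilon>)" if "norm z \<ge> 1" for z
  proof -
    from that have "norm z > 0" by linarith
    then show ?thesis unfolding \<epsilon>_def using \<theta> by (intro fourier_integrand_split) auto
  qed
  show ?thesis
  proof (cases "\<theta> = 0")
    case True
    define C where "C = enn2real (SUP z. ennreal ((?m z)\<^sup>2 * norm z powr s))"
    have "(SUP z. ennreal ((?m z)\<^sup>2 * norm z powr s)) < \<top>"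
      using fin True by (simp add: fourier_energy_def)
    then have SC: "(SUP z. ennreal ((?m z)\<^sup>2 * norm z powr s)) = ennreal C" by (simp add: C_def)
    have C0: "C \<ge> 0" by (simp add: C_def)
    have C: "(?m z)\<^sup>2 * norm z powr s \<le> C" for z
    proof -
      have "ennreal ((?m z)\<^sup>2 * norm z powr s) \<le> (SUP z. ennreal ((?m z)\<^sup>2 * norm z powr s))"
        by (rule SUP_upper) simp
      then show ?thesis unfolding SC using C0 by simp
    qed
    show ?thesis
    proof (rule fourier_moment_finiteI[OF \<mu> \<theta>(3) s(1)])
      show "(\<lambda>z. ennreal (C powr (1 / \<theta>')) * ?far z) \<in> borel_measurable borel" by measurable
      show "(\<integral>\<^sup>+z. ennreal (C powr (1 / \<theta>')) * ?far z \<partial>lborel) < \<infinity>"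
        using far_fin by (subst nn_integral_cmult) (auto simp: ennreal_mult_less_top)
      fix z :: 'a assume z: "norm z \<ge> 1"
      have "((?m z)\<^sup>2 * norm z powr s) powr (1 / \<theta>') * norm z powr (- d - \<epsilon>) \<le> C powr (1 / \<theta>') * norm z powr (- d - \<epsilon>)"
        using C[of z] \<theta> by (intro mult_right_mono powr_mono2) auto
      then show "ennreal (?m z powr (2 / \<theta>') * norm z powr (s' / \<theta>' - real DIM('a))) \<le> ennreal (C powr (1 / \<theta>')) * ?far z"
        using split[OF z] z by (simp add: d_def ennreal_mult[symmetric] ennreal_leI)
    qed
  next
    case False
    then have \<theta>0: "\<theta> > 0" using \<theta> by simp
    let ?h = "\<lambda>z. ennreal (?m z powr (2 / \<theta>) * norm z powr (s / \<theta> - real DIM('a)))"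
    show ?thesis
    proof (rule fourier_moment_finiteI[OF \<mu> \<theta>(3) s(1)])
      show "(\<lambda>z. ?h z + ?far z) \<in> borel_measurable borel" by measurable
      show "(\<integral>\<^sup>+z. ?h z + ?far z \<partial>lborel) < \<infinity>"
        using far_fin fourier_moment_finite_of_energy[OF fin False]
        by (subst nn_integral_add) (auto simp: fourier_moment_def)
      fix z :: 'a assume z: "norm z \<ge> 1"
      then have z0: "norm z > 0" by linarith
      define q where "q = (?m z)\<^sup>2 * norm z powr s"
      have q0: "q \<ge> 0" by (simp add: q_def)
      have h_eq: "?m z powr (2 / \<theta>) * norm z powr (s / \<theta> - real DIM('a)) = q powr (1 / \<theta>) * norm z powr (- d)"
        using fourier_integrand_split[of "?m z" "norm z" \<theta> s d s] z0 \<theta>0 by (simp add: q_def d_def)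
      show "ennreal (?m z powr (2 / \<theta>') * norm z powr (s' / \<theta>' - real DIM('a))) \<le> ?h z + ?far z"
      proof (cases "q \<ge> 1")
        case True
        have "q powr (1 / \<theta>') * norm z powr (- d - \<epsilon>) \<le> q powr (1 / \<theta>) * norm z powr (- d)"
          using True \<theta> \<theta>0 \<epsilon> z by (intro mult_mono powr_mono) (auto simp: field_simps)
        then have "ennreal (?m z powr (2 / \<theta>') * norm z powr (s' / \<theta>' - real DIM('a))) \<le> ?h z"
          using split[OF z] h_eq by (simp add: d_def q_def ennreal_leI)
        then show ?thesis by (simp add: add_increasing2)
      next
        case False
        have "q powr (1 / \<theta>') * norm z powr (- d - \<epsilon>) \<le> 1 * norm z powr (- d - \<epsilon>)"
          using False q0 \<theta> by (intro mult_right_mono powr_le1) auto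
        then have "ennreal (?m z powr (2 / \<theta>') * norm z powr (s' / \<theta>' - real DIM('a))) \<le> ?far z"
          using split[OF z] z by (simp add: d_def q_def ennreal_leI)
        then show ?thesis by (simp add: add_increasing)
      qed
    qed
  qed
qed

text \<open>
  Decreasing \<open>\<theta>\<close> raises the exponent of \<open>|\<mu>^| \<le> 1\<close>, so the moment stays finite as long as the
  exponent of the weight does not grow.
\<close>

lemma fourier_moment_antimono_theta:
  fixes \<mu> :: "'a::euclidean_space measure"
  assumes \<mu>: "prob_space \<mu>" "sets \<mu> = sets borel"
    and \<theta>: "0 < \<theta>'" "\<theta>' \<le> \<theta>" and s: "0 < s'" "s' / \<theta>' \<le> s / \<theta>"
    and fin: "fourier_moment \<theta> s \<mu> < \<infinity>"
  shows "fourier_moment \<theta>' s' \<mu> < \<infinity>"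
proof -
  let ?h = "\<lambda>z. ennreal (norm (fourier_transform \<mu> z) powr (2 / \<theta>) * norm z powr (s / \<theta> - real DIM('a)))"
  have [measurable]: "fourier_transform \<mu> \<in> borel_measurable borel"
    by (rule borel_measurable_fourier_transform) fact+
  show ?thesis
  proof (rule fourier_moment_finiteI[OF \<mu> \<theta>(1) s(1)])
    show "?h \<in> borel_measurable borel" by measurable
    show "(\<integral>\<^sup>+z. ?h z \<partial>lborel) < \<infinity>" using fin by (simp add: fourier_moment_def)
    fix z :: 'a assume z: "norm z \<ge> 1"
    show "ennreal (norm (fourier_transform \<mu> z) powr (2 / \<theta>') * norm z powr (s' / \<theta>' - real DIM('a))) \<le> ?h z"
      using norm_fourier_transform_le_1[OF \<mu>(1), of z] \<theta> s z
      by (intro ennreal_leI mult_mono powr_mono' powr_mono) (auto simp: field_simps)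
  qed
qed

lemma fourier_moment_below_spectrum:
  fixes \<mu> :: "'a::euclidean_space measure"
  assumes \<mu>: "prob_space \<mu>" "sets \<mu> = sets borel"
    and \<theta>: "0 \<le> \<theta>" "\<theta> \<le> \<theta>'" "0 < \<theta>'" and s: "0 < s'" "ereal s' < fourier_spectrum \<theta> \<mu>"
  shows "fourier_moment \<theta>' s' \<mu> < \<infinity>"
proof -
  obtain s where "s' < s" "fourier_energy s \<theta> \<mu> < \<infinity>"
    using s unfolding fourier_spectrum_def less_Sup_iff by force
  then show ?thesis using fourier_moment_mono_theta[OF \<mu> \<theta> s(1)] by blast
qed

text \<open>
  The minimum bounds the spectrum at \<open>1/2\<close> from below: for \<open>\<theta> \<le> 1/2\<close> by monotonicity
  of the spectrum, for \<open>\<theta> > 1/2\<close> by comparing the weights \<open>s / \<theta>\<close> and \<open>2 a\<close>.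
\<close>

lemma fourier_moment_half:
  fixes \<mu> :: "'a::euclidean_space measure"
  assumes \<mu>: "prob_space \<mu>" "sets \<mu> = sets borel" and \<theta>: "0 \<le> \<theta>" and a: "0 < a"
    and less: "ereal a < min (fourier_spectrum \<theta> \<mu>)
       (if \<theta> = 0 then \<infinity> else fourier_spectrum \<theta> \<mu> / ereal (2 * \<theta>))"
  shows "fourier_moment (1 / 2) a \<mu> < \<infinity>"
proof (cases "\<theta> \<le> 1 / 2")
  case True
  then show ?thesis using less a by (intro fourier_moment_below_spectrum[OF \<mu> \<theta>]) auto
next
  case False
  then have "ereal a < fourier_spectrum \<theta> \<mu> / ereal (2 * \<theta>)" using less by simp
  then have "ereal (2 * \<theta> * a) < fourier_spectrum \<theta> \<mu>"
    using False by (subst (asm) ereal_less_divide_pos) auto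
  then have "fourier_moment \<theta> (2 * \<theta> * a) \<mu> < \<infinity>"
    using False a by (intro fourier_moment_below_spectrum[OF \<mu> \<theta>]) auto
  then show ?thesis
    using False a by (intro fourier_moment_antimono_theta[OF \<mu>, of "1/2" \<theta>]) auto
qed

text \<open>
  Instance of the decay estimate with \<open>F = |\<mu>\<^sub>1^|\<close>, \<open>p = 1 / \<theta>\<close>, \<open>b = d - s / \<theta>\<close> and
  \<open>\<kappa>\<close> the law of \<open>y - y'\<close>.
\<close>

lemma damped_fourier_average_decay:
  fixes \<mu>\<^sub>1 \<mu>\<^sub>2 :: "'a::euclidean_space measure"
  assumes \<mu>1: "prob_space \<mu>\<^sub>1" "sets \<mu>\<^sub>1 = sets borel"
    and \<mu>2: "prob_space \<mu>\<^sub>2" "sets \<mu>\<^sub>2 = sets borel"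
    and supp: "AE y in \<mu>\<^sub>2. norm y \<le> L"
    and \<theta>: "0 < \<theta>" "\<theta> \<le> 1" and s: "s \<le> real DIM('a) * \<theta>" and a: "2 * a \<le> real DIM('a)"
    and J1: "fourier_moment \<theta> s \<mu>\<^sub>1 < \<infinity>" and J2: "fourier_moment (1 / 2) a \<mu>\<^sub>2 < \<infinity>"
  obtains C where "C \<ge> 0"
    "\<And>r. r \<ge> 1 \<Longrightarrow> (\<integral>\<^sup>+w. ennreal (norm (damped_fourier \<mu>\<^sub>1 (r *\<^sub>R w))) \<partial>difference_law \<mu>\<^sub>2)
       \<le> ennreal (C * r powr (- ((s + 2 * \<theta> * a - real DIM('a) * \<theta>) / 2)))"
proof -
  interpret prob_space \<mu>\<^sub>2 by fact
  interpret P: pair_prob_space \<mu>\<^sub>2 \<mu>\<^sub>2 ..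
  note [measurable_cong] = \<mu>1(2) \<mu>2(2)
  define d where "d = real DIM('a)"
  define \<kappa> where "\<kappa> = difference_law \<mu>\<^sub>2"
  let ?F = "\<lambda>z. norm (fourier_transform \<mu>\<^sub>1 z)"
  have F [measurable]: "fourier_transform \<mu>\<^sub>1 \<in> borel_measurable borel"
    by (rule borel_measurable_fourier_transform) fact+
  have "AE p in \<mu>\<^sub>2 \<Otimes>\<^sub>M \<mu>\<^sub>2. norm (fst p - snd p) \<le> 2 * L"
  proof -
    have "AE p in \<mu>\<^sub>2 \<Otimes>\<^sub>M \<mu>\<^sub>2. norm (fst p) \<le> L" "AE p in \<mu>\<^sub>2 \<Otimes>\<^sub>M \<mu>\<^sub>2. norm (snd p) \<le> L"
      using supp by (intro P.AE_pair_measure; simp)+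
    then show ?thesis
    proof eventually_elim
      case (elim p)
      then show ?case using norm_triangle_ineq4[of "fst p" "snd p"] by linarith
    qed
  qed
  then have \<kappa>_supp: "AE w in \<kappa>. norm w \<le> 2 * L"
    unfolding \<kappa>_def difference_law_def by (subst AE_distr_iff[OF measurable_diff_pair[OF \<mu>2(2)]]) auto
  have p: "1 / \<theta> \<ge> 1" using \<theta> by simp
  have "(\<integral>\<^sup>+z. ennreal (?F z powr (2 * (1 / \<theta>)) * norm z powr (- (d - s / \<theta>))) \<partial>lborel) < \<infinity>"
    using J1 by (simp add: fourier_moment_def d_def)
  moreover have "(\<integral>\<^sup>+\<eta>. ennreal ((norm (fourier_transform \<kappa> \<eta>))\<^sup>2 * norm \<eta> powr (2 * a - real DIM('a))) \<partial>lborel) < \<infinity>"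
    using J2 by (simp add: fourier_moment_def \<kappa>_def norm_fourier_difference_law[OF \<mu>2] mult.commute)
  moreover have "d - s / \<theta> \<ge> 0" using s \<theta> by (simp add: d_def field_simps)
  moreover have "((s + 2 * \<theta> * a - d * \<theta>) / 2) * (1 / \<theta>) = a - (d - s / \<theta>) / 2"
    using \<theta> by (simp add: field_simps)
  ultimately obtain C where C: "C \<ge> 0"
    "\<And>r. r \<ge> 1 \<Longrightarrow> (\<integral>\<^sup>+w. \<integral>\<^sup>+\<eta>. ennreal (exp (- (pi * (norm \<eta>)\<^sup>2))) * ennreal (?F (r *\<^sub>R w - \<eta>)) \<partial>lborel \<partial>\<kappa>)
       \<le> ennreal (C * r powr (- ((s + 2 * \<theta> * a - d * \<theta>) / 2)))"
    using gaussian_average_decay[of \<kappa> "2 * L" ?F "d - s / \<theta>" "1 / \<theta>" a "(s + 2 * \<theta> * a - d * \<theta>) / 2"]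
      prob_space_difference_law[OF \<mu>2] \<kappa>_supp p a
    unfolding \<kappa>_def by auto
  show ?thesis
  proof (rule that[OF C(1)])
    fix r :: real assume "r \<ge> 1"
    have "(\<integral>\<^sup>+w. ennreal (norm (damped_fourier \<mu>\<^sub>1 (r *\<^sub>R w))) \<partial>\<kappa>)
      \<le> (\<integral>\<^sup>+w. \<integral>\<^sup>+\<eta>. ennreal (exp (- (pi * (norm \<eta>)\<^sup>2))) * ennreal (?F (r *\<^sub>R w - \<eta>)) \<partial>lborel \<partial>\<kappa>)"
      by (intro nn_integral_mono norm_damped_fourier_le_average \<mu>1)
    also have "\<dots> \<le> ennreal (C * r powr (- ((s + 2 * \<theta> * a - d * \<theta>) / 2)))" by (rule C(2)) fact
    finally show "(\<integral>\<^sup>+w. ennreal (norm (damped_fourier \<mu>\<^sub>1 (r *\<^sub>R w))) \<partial>difference_law \<mu>\<^sub>2)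
       \<le> ennreal (C * r powr (- ((s + 2 * \<theta> * a - real DIM('a) * \<theta>) / 2)))"
      by (simp add: \<kappa>_def d_def)
  qed
qed

section \<open>Coincidences of pinned squared distances\<close>

text \<open>
  A smooth version of the probability that two independent \<open>\<mu>\<close>-random points have squared
  distances to \<open>x\<close> that differ by at most \<open>\<delta>\<close>.
\<close>

definition pinned_coincidence :: "real \<Rightarrow> 'a::euclidean_space measure \<Rightarrow> 'a \<Rightarrow> ennreal" where
  "pinned_coincidence \<delta> \<mu> x = (\<integral>\<^sup>+p. ennreal (exp (- (pi *
      ((norm (x - fst p))\<^sup>2 - (norm (x - snd p))\<^sup>2)\<^sup>2 / \<delta>\<^sup>2))) \<partial>(\<mu> \<Otimes>\<^sub>M \<mu>))"

lemma borel_measurable_pinned_coincidence [measurable]: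
  fixes \<mu> :: "'a::euclidean_space measure"
  assumes "prob_space \<mu>" and [measurable_cong]: "sets \<mu> = sets borel"
  shows "pinned_coincidence \<delta> \<mu> \<in> borel_measurable borel"
proof -
  interpret prob_space \<mu> by fact
  interpret P: pair_prob_space \<mu> \<mu> ..
  show ?thesis unfolding pinned_coincidence_def[abs_def] by measurable
qed

lemma squared_distance_difference:
  fixes x y z :: "'a::euclidean_space"
  shows "(norm (x - y))\<^sup>2 - (norm (x - z))\<^sup>2 = ((norm y)\<^sup>2 - (norm z)\<^sup>2) - 2 * (x \<bullet> (y - z))"
  by (simp add: power2_norm_eq_inner inner_simps inner_commute algebra_simps)

text \<open>
  For fixed \<open>y\<close> and \<open>y'\<close> the difference of the squared distances is an affine function of the
  pin, so its Gaussian can be averaged over the pin by \<open>gaussian_of_linear_phase_le\<close>.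
\<close>

lemma pinned_coincidence_le_frequency_integral:
  fixes \<mu>\<^sub>1 \<mu>\<^sub>2 :: "'a::euclidean_space measure"
  assumes \<mu>1: "prob_space \<mu>\<^sub>1" "sets \<mu>\<^sub>1 = sets borel"
    and \<mu>2: "prob_space \<mu>\<^sub>2" "sets \<mu>\<^sub>2 = sets borel" and \<delta>: "\<delta> > 0"
  shows "(\<integral>\<^sup>+x. ennreal (exp (- (pi * (norm x)\<^sup>2))) * pinned_coincidence \<delta> \<mu>\<^sub>2 x \<partial>\<mu>\<^sub>1)
    \<le> (\<integral>\<^sup>+t. ennreal (\<delta> * exp (- (pi * \<delta>\<^sup>2 * t\<^sup>2))) *
         (\<integral>\<^sup>+w. ennreal (norm (damped_fourier \<mu>\<^sub>1 ((2 * t) *\<^sub>R w))) \<partial>difference_law \<mu>\<^sub>2) \<partial>lborel)"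
proof -
  interpret M1: prob_space \<mu>\<^sub>1 by fact
  interpret M2: prob_space \<mu>\<^sub>2 by fact
  interpret M22: pair_prob_space \<mu>\<^sub>2 \<mu>\<^sub>2 ..
  interpret P: pair_sigma_finite \<mu>\<^sub>1 "\<mu>\<^sub>2 \<Otimes>\<^sub>M \<mu>\<^sub>2" ..
  interpret Q: pair_sigma_finite "lborel :: real measure" "\<mu>\<^sub>2 \<Otimes>\<^sub>M \<mu>\<^sub>2" ..
  note [measurable_cong] = \<mu>1(2) \<mu>2(2)
  have [measurable]: "damped_fourier \<mu>\<^sub>1 \<in> borel_measurable borel"
    by (rule borel_measurable_damped_fourier) fact+
  let ?f = "\<lambda>x::'a. exp (- (pi * (norm x)\<^sup>2))"
  let ?e = "\<lambda>x p. exp (- (pi * ((norm (x - fst p))\<^sup>2 - (norm (x - snd p))\<^sup>2)\<^sup>2 / \<delta>\<^sup>2))"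
  let ?k = "\<lambda>t::real. \<delta> * exp (- (pi * \<delta>\<^sup>2 * t\<^sup>2))"
  have "(\<integral>\<^sup>+x. ennreal (?f x) * pinned_coincidence \<delta> \<mu>\<^sub>2 x \<partial>\<mu>\<^sub>1)
      = (\<integral>\<^sup>+x. \<integral>\<^sup>+p. ennreal (?f x * ?e x p) \<partial>(\<mu>\<^sub>2 \<Otimes>\<^sub>M \<mu>\<^sub>2) \<partial>\<mu>\<^sub>1)"
    unfolding pinned_coincidence_def
    by (intro nn_integral_cong, subst nn_integral_cmult[symmetric]) (auto simp: ennreal_mult)
  also have "\<dots> = (\<integral>\<^sup>+p. \<integral>\<^sup>+x. ennreal (?f x * ?e x p) \<partial>\<mu>\<^sub>1 \<partial>(\<mu>\<^sub>2 \<Otimes>\<^sub>M \<mu>\<^sub>2))"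
    by (rule P.Fubini'[symmetric]) measurable
  also have "\<dots> \<le> (\<integral>\<^sup>+p. \<integral>\<^sup>+t. ennreal (?k t) * ennreal (norm (damped_fourier \<mu>\<^sub>1 ((2 * t) *\<^sub>R (fst p - snd p)))) \<partial>lborel \<partial>(\<mu>\<^sub>2 \<Otimes>\<^sub>M \<mu>\<^sub>2))"
  proof (rule nn_integral_mono)
    fix p :: "'a \<times> 'a"
    have int: "integrable \<mu>\<^sub>1 (\<lambda>x. ?f x * ?e x p)"
      by (rule M1.integrable_const_bound[where B = 1]) (auto intro!: mult_le_one)
    have "(\<integral>\<^sup>+x. ennreal (?f x * ?e x p) \<partial>\<mu>\<^sub>1) = ennreal (\<integral>x. ?f x * ?e x p \<partial>\<mu>\<^sub>1)"
      by (rule nn_integral_eq_integral[OF int]) auto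
    also have "\<dots> \<le> (\<integral>\<^sup>+t. ennreal (?k t) * ennreal (norm (damped_fourier \<mu>\<^sub>1 ((2 * t) *\<^sub>R (fst p - snd p)))) \<partial>lborel)"
      unfolding squared_distance_difference
      by (rule gaussian_of_linear_phase_le[OF \<mu>1 \<delta>])
    finally show "(\<integral>\<^sup>+x. ennreal (?f x * ?e x p) \<partial>\<mu>\<^sub>1) \<le> \<dots>" .
  qed
  also have "\<dots> = (\<integral>\<^sup>+t. \<integral>\<^sup>+p. ennreal (?k t) * ennreal (norm (damped_fourier \<mu>\<^sub>1 ((2 * t) *\<^sub>R (fst p - snd p)))) \<partial>(\<mu>\<^sub>2 \<Otimes>\<^sub>M \<mu>\<^sub>2) \<partial>lborel)"
    by (rule Q.Fubini') measurable
  also have "\<dots> = (\<integral>\<^sup>+t. ennreal (?k t) *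
         (\<integral>\<^sup>+w. ennreal (norm (damped_fourier \<mu>\<^sub>1 ((2 * t) *\<^sub>R w))) \<partial>difference_law \<mu>\<^sub>2) \<partial>lborel)"
  proof (rule nn_integral_cong)
    fix t :: real
    have "(\<integral>\<^sup>+w. ennreal (norm (damped_fourier \<mu>\<^sub>1 ((2 * t) *\<^sub>R w))) \<partial>difference_law \<mu>\<^sub>2)
      = (\<integral>\<^sup>+p. ennreal (norm (damped_fourier \<mu>\<^sub>1 ((2 * t) *\<^sub>R (fst p - snd p)))) \<partial>(\<mu>\<^sub>2 \<Otimes>\<^sub>M \<mu>\<^sub>2))"
      unfolding difference_law_def by (rule nn_integral_distr[OF measurable_diff_pair[OF \<mu>2(2)]]) measurable
    then show "(\<integral>\<^sup>+p. ennreal (?k t) * ennreal (norm (damped_fourier \<mu>\<^sub>1 ((2 * t) *\<^sub>R (fst p - snd p)))) \<partial>(\<mu>\<^sub>2 \<Otimes>\<^sub>M \<mu>\<^sub>2))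
      = ennreal (?k t) * (\<integral>\<^sup>+w. ennreal (norm (damped_fourier \<mu>\<^sub>1 ((2 * t) *\<^sub>R w))) \<partial>difference_law \<mu>\<^sub>2)"
      by (simp add: nn_integral_cmult)
  qed
  finally show ?thesis .
qed

text \<open>
  The Gaussian cut-off restricts \<open>t\<close> to \<open>|t| \<le> 1 / \<delta>\<close> and has mass of order \<open>\<delta>\<close> on \<open>|t| \<le> 1\<close>. For larger
  \<open>t\<close> it is traded for \<open>(\<delta> |t|) powr (\<eta> - 1)\<close>, which leaves the integrable power
  \<open>|t| powr (- 1 - (\<gamma> - \<eta>))\<close>. At scales \<open>\<delta> > 1\<close> the bound is trivial.
\<close>

lemma pinned_coincidence_decay:
  fixes \<mu>\<^sub>1 \<mu>\<^sub>2 :: "'a::euclidean_space measure"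
  assumes \<mu>1: "prob_space \<mu>\<^sub>1" "sets \<mu>\<^sub>1 = sets borel"
    and \<mu>2: "prob_space \<mu>\<^sub>2" "sets \<mu>\<^sub>2 = sets borel"
    and C: "C \<ge> 0" "\<And>r. r \<ge> 1 \<Longrightarrow>
      (\<integral>\<^sup>+w. ennreal (norm (damped_fourier \<mu>\<^sub>1 (r *\<^sub>R w))) \<partial>difference_law \<mu>\<^sub>2) \<le> ennreal (C * r powr (- \<gamma>))"
    and \<eta>: "0 < \<eta>" "\<eta> \<le> 1" "\<eta> < \<gamma>"
  obtains B where "B \<ge> 0"
    "\<And>\<delta>. \<delta> > 0 \<Longrightarrow> (\<integral>\<^sup>+x. ennreal (exp (- (pi * (norm x)\<^sup>2))) * pinned_coincidence \<delta> \<mu>\<^sub>2 x \<partial>\<mu>\<^sub>1)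
       \<le> ennreal (B * \<delta> powr \<eta>)"
proof -
  interpret M1: prob_space \<mu>\<^sub>1 by fact
  interpret M2: prob_space \<mu>\<^sub>2 by fact
  interpret M22: pair_prob_space \<mu>\<^sub>2 \<mu>\<^sub>2 ..
  define \<kappa> where "\<kappa> = difference_law \<mu>\<^sub>2"
  interpret K: prob_space \<kappa> unfolding \<kappa>_def by (rule prob_space_difference_law[OF \<mu>2])
  define D where "D r = (\<integral>\<^sup>+w. ennreal (norm (damped_fourier \<mu>\<^sub>1 (r *\<^sub>R w))) \<partial>\<kappa>)" for r
  have D_le_1: "D r \<le> 1" for r
  proof -
    have "D r \<le> (\<integral>\<^sup>+w. 1 \<partial>\<kappa>)" unfolding D_def
      using norm_damped_fourier_le_1[OF \<mu>1(1)] by (intro nn_integral_mono) simp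
    then show ?thesis by (simp add: K.emeasure_space_1)
  qed
  have D_abs: "D r = D \<bar>r\<bar>" for r
    using norm_damped_fourier_minus[of \<mu>\<^sub>1] by (cases "r \<ge> 0") (auto simp: D_def)
  \<comment> \<open>the gap that makes the tail integrable\<close>
  define \<epsilon> where "\<epsilon> = \<gamma> - \<eta>"
  have \<epsilon>: "\<epsilon> > 0" using \<eta> by (simp add: \<epsilon>_def)
  define K where "K = exp ((1 - \<eta>)\<^sup>2)"
  have K: "K \<ge> 1" by (simp add: K_def)
  let ?far = "\<lambda>t::real. ennreal (norm t powr (- real DIM(real) - \<epsilon>)) * indicator {t. norm t \<ge> 1} t"
  define I where "I = (\<integral>\<^sup>+t. ?far t \<partial>lborel)"
  have I_eq: "I = ennreal (enn2real I)" using nn_integral_norm_powr_far[OF \<epsilon>, where 'a = real] by (simp add: I_def)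
  define B where "B = 2 + K * C * enn2real I"
  have B: "B \<ge> 1" using K C(1) by (simp add: B_def add_increasing2)
  show ?thesis
  proof (rule that[of B])
    show "B \<ge> 0" using B by simp
    fix \<delta> :: real assume \<delta>: "\<delta> > 0"
    show "(\<integral>\<^sup>+x. ennreal (exp (- (pi * (norm x)\<^sup>2))) * pinned_coincidence \<delta> \<mu>\<^sub>2 x \<partial>\<mu>\<^sub>1) \<le> ennreal (B * \<delta> powr \<eta>)"
    proof (cases "\<delta> \<le> 1")
      case False
      have "pinned_coincidence \<delta> \<mu>\<^sub>2 x \<le> 1" for x
      proof -
        have "pinned_coincidence \<delta> \<mu>\<^sub>2 x \<le> (\<integral>\<^sup>+p. 1 \<partial>(\<mu>\<^sub>2 \<Otimes>\<^sub>M \<mu>\<^sub>2))"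
          unfolding pinned_coincidence_def by (intro nn_integral_mono) simp
        then show ?thesis by (simp add: M22.emeasure_space_1)
      qed
      then have "(\<integral>\<^sup>+x. ennreal (exp (- (pi * (norm x)\<^sup>2))) * pinned_coincidence \<delta> \<mu>\<^sub>2 x \<partial>\<mu>\<^sub>1) \<le> (\<integral>\<^sup>+x. 1 * 1 \<partial>\<mu>\<^sub>1)"
        by (intro nn_integral_mono mult_mono) auto
      also have "\<dots> \<le> ennreal 1" by (simp add: M1.emeasure_space_1)
      also have "\<dots> \<le> ennreal (B * \<delta> powr \<eta>)"
      proof (rule ennreal_leI)
        have "1 \<le> \<delta> powr \<eta>" using False \<eta> by (intro ge_one_powr_ge_zero) auto
        then have "1 * 1 \<le> B * \<delta> powr \<eta>" using B by (intro mult_mono) auto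
        then show "1 \<le> B * \<delta> powr \<eta>" by simp
      qed
      finally show ?thesis .
    next
      case True
      have "(\<integral>\<^sup>+x. ennreal (exp (- (pi * (norm x)\<^sup>2))) * pinned_coincidence \<delta> \<mu>\<^sub>2 x \<partial>\<mu>\<^sub>1)
         \<le> (\<integral>\<^sup>+t. ennreal (\<delta> * exp (- (pi * \<delta>\<^sup>2 * t\<^sup>2))) * D (2 * t) \<partial>lborel)"
        unfolding D_def \<kappa>_def by (rule pinned_coincidence_le_frequency_integral[OF \<mu>1 \<mu>2 \<delta>])
      also have "\<dots> \<le> (\<integral>\<^sup>+t. ennreal (\<delta> powr \<eta>) * (indicator {-1..1} t + ennreal (K * C) * ?far t) \<partial>lborel)"
      proof (rule nn_integral_mono)
        fix t :: real
        show "ennreal (\<delta> * exp (- (pi * \<delta>\<^sup>2 * t\<^sup>2))) * D (2 * t)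
          \<le> ennreal (\<delta> powr \<eta>) * (indicator {-1..1} t + ennreal (K * C) * ?far t)"
        proof (cases "\<bar>t\<bar> \<le> 1")
          case t: True
          have "\<delta> = \<delta> powr 1" using \<delta> by simp
          also have "\<delta> powr 1 \<le> \<delta> powr \<eta>" using True \<delta> \<eta> by (intro powr_mono') auto
          finally have "\<delta> * exp (- (pi * \<delta>\<^sup>2 * t\<^sup>2)) \<le> \<delta> powr \<eta> * 1"
            using \<delta> by (intro mult_mono) auto
          then have "ennreal (\<delta> * exp (- (pi * \<delta>\<^sup>2 * t\<^sup>2))) * D (2 * t) \<le> ennreal (\<delta> powr \<eta> * 1) * 1"
            using D_le_1 by (intro mult_mono) (simp_all add: ennreal_leI)
          also have "\<dots> \<le> ennreal (\<delta> powr \<eta>) * (indicator {-1..1} t + ennreal (K * C) * ?far t)"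
            using t by (intro mult_mono) (auto simp: indicator_def abs_le_iff)
          finally show ?thesis .
        next
          case t: False
          define u where "u = \<bar>t\<bar>"
          have u: "u > 1" "t\<^sup>2 = u\<^sup>2" using t by (auto simp: u_def)
          have "D (2 * t) = D (2 * u)" using D_abs[of "2 * t"] by (simp add: u_def abs_mult)
          also have "\<dots> \<le> ennreal (C * (2 * u) powr (- \<gamma>))" unfolding D_def \<kappa>_def using u by (intro C(2)) auto
          also have "\<dots> \<le> ennreal (C * u powr (- \<gamma>))"
            using C(1) u \<eta> by (intro ennreal_leI mult_left_mono powr_mono2') auto
          finally have 1: "D (2 * t) \<le> ennreal (C * u powr (- \<gamma>))" .
          have "(\<delta> * u) powr (1 - \<eta>) \<le> K * exp ((\<delta> * u)\<^sup>2)"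
            unfolding K_def using \<delta> u \<eta> by (intro powr_le_exp_square) auto
          also have "\<dots> \<le> K * exp (pi * \<delta>\<^sup>2 * t\<^sup>2)"
          proof -
            have "1 * (\<delta> * u)\<^sup>2 \<le> pi * (\<delta> * u)\<^sup>2" using pi_gt3 by (intro mult_right_mono) auto
            then show ?thesis using K u by (simp add: power_mult_distrib mult.assoc)
          qed
          finally have "(\<delta> * u) powr (1 - \<eta>) * exp (- (pi * \<delta>\<^sup>2 * t\<^sup>2)) \<le> K"
            by (simp add: exp_minus field_simps)
          then have "(\<delta> * u) powr (1 - \<eta>) * exp (- (pi * \<delta>\<^sup>2 * t\<^sup>2)) * (\<delta> * u) powr (\<eta> - 1) \<le> K * (\<delta> * u) powr (\<eta> - 1)"
            by (rule mult_right_mono) simp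
          moreover have "(\<delta> * u) powr (1 - \<eta>) * (\<delta> * u) powr (\<eta> - 1) = 1"
            using \<delta> u by (simp add: powr_add[symmetric])
          ultimately have "exp (- (pi * \<delta>\<^sup>2 * t\<^sup>2)) \<le> K * (\<delta> * u) powr (\<eta> - 1)"
            by (metis mult.assoc mult.commute mult_1)
          then have "\<delta> * exp (- (pi * \<delta>\<^sup>2 * t\<^sup>2)) \<le> \<delta> powr 1 * (K * (\<delta> * u) powr (\<eta> - 1))"
            using \<delta> by simp
          also have "\<dots> = K * (\<delta> powr 1 * \<delta> powr (\<eta> - 1)) * u powr (\<eta> - 1)"
            using \<delta> u by (simp add: powr_mult)
          also have "\<delta> powr 1 * \<delta> powr (\<eta> - 1) = \<delta> powr \<eta>"
            by (simp only: powr_add[symmetric]) simp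
          finally have 2: "\<delta> * exp (- (pi * \<delta>\<^sup>2 * t\<^sup>2)) \<le> K * \<delta> powr \<eta> * u powr (\<eta> - 1)" .
          have "ennreal (\<delta> * exp (- (pi * \<delta>\<^sup>2 * t\<^sup>2))) * D (2 * t)
             \<le> ennreal (K * \<delta> powr \<eta> * u powr (\<eta> - 1)) * ennreal (C * u powr (- \<gamma>))"
            using 1 2 by (intro mult_mono) (simp_all add: ennreal_leI)
          also have "\<dots> = ennreal (\<delta> powr \<eta> * (K * C * (u powr (\<eta> - 1) * u powr (- \<gamma>))))"
            using K C(1) by (simp add: ennreal_mult[symmetric] mult_ac)
          also have "u powr (\<eta> - 1) * u powr (- \<gamma>) = u powr (- real DIM(real) - \<epsilon>)"
            by (simp add: powr_add[symmetric] \<epsilon>_def algebra_simps)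
          also have "ennreal (\<delta> powr \<eta> * (K * C * u powr (- real DIM(real) - \<epsilon>))) = ennreal (\<delta> powr \<eta>) * (ennreal (K * C) * ?far t)"
            using K C(1) t by (simp add: ennreal_mult u_def)
          also have "\<dots> \<le> ennreal (\<delta> powr \<eta>) * (indicator {-1..1} t + ennreal (K * C) * ?far t)"
            by (intro mult_left_mono) (auto simp: add_increasing)
          finally show ?thesis .
        qed
      qed
      also have "\<dots> = ennreal (\<delta> powr \<eta>) * (2 + ennreal (K * C) * I)"
        unfolding I_def by (simp add: nn_integral_cmult nn_integral_add)
      also have "\<dots> = ennreal (\<delta> powr \<eta>) * ennreal B"
        by (subst I_eq) (use K C(1) in \<open>simp add: B_def ennreal_mult ennreal_plus\<close>)
      also have "\<dots> = ennreal (B * \<delta> powr \<eta>)"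
        using B by (simp add: ennreal_mult[symmetric] mult.commute)
      finally show ?thesis .
    qed
  qed
qed

section \<open>From coincidences to dimension and measure on the line\<close>

text \<open>
  The analogue of \<open>pinned_coincidence\<close> for a measure on the line. It bounds, up to a constant,
  the probability that two independent points are within \<open>\<delta>\<close> of each other.
\<close>

definition gaussian_coincidence :: "real \<Rightarrow> real measure \<Rightarrow> ennreal" where
  "gaussian_coincidence \<delta> \<nu> = (\<integral>\<^sup>+t. \<integral>\<^sup>+t'. ennreal (exp (- (pi * (t - t')\<^sup>2 / \<delta>\<^sup>2))) \<partial>\<nu> \<partial>\<nu>)"

text \<open>
  The series is equivalent to the \<open>\<gamma>\<close>-energy of \<open>\<nu>\<close>. On a set \<open>E\<close> of positive measure the potential \<open>S\<close>
  is bounded, which gives \<open>\<nu> (cball t \<rho>) = O(\<rho> powr \<gamma>)\<close> for \<open>t \<in> E\<close>, and any cover of \<open>A\<close> must carry the mass of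
  \<open>E\<close>.
\<close>

lemma hausdorff_dim_ge_of_gaussian_coincidence:
  fixes \<nu> :: "real measure"
  assumes \<nu>: "prob_space \<nu>" and sets [measurable_cong]: "sets \<nu> = sets borel"
    and A: "AE t in \<nu>. t \<in> A" and \<gamma>: "\<gamma> > 0"
    and fin: "(\<Sum>k. ennreal (2 powr (\<gamma> * real k)) * gaussian_coincidence ((1/2) ^ k) \<nu>) < \<infinity>"
  shows "ereal \<gamma> \<le> hausdorff_dim A"
proof -
  interpret prob_space \<nu> by fact
  define P where "P k t = (\<integral>\<^sup>+t'. ennreal (exp (- (pi * (t - t')\<^sup>2 / ((1/2) ^ k)\<^sup>2))) \<partial>\<nu>)" for k :: nat and t
  define S where "S t = (\<Sum>k. ennreal (2 powr (\<gamma> * real k)) * P k t)" for t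
  have [measurable]: "P k \<in> borel_measurable borel" for k unfolding P_def[abs_def] by measurable
  have [measurable]: "S \<in> borel_measurable borel" unfolding S_def[abs_def] by measurable
  have "(\<integral>\<^sup>+t. S t \<partial>\<nu>) = (\<Sum>k. ennreal (2 powr (\<gamma> * real k)) * gaussian_coincidence ((1/2) ^ k) \<nu>)"
    unfolding S_def by (subst nn_integral_suminf) (auto simp: nn_integral_cmult gaussian_coincidence_def P_def)
  then have S_fin: "AE t in \<nu>. S t \<noteq> \<infinity>"
    using fin by (intro nn_integral_PInf_AE) auto
  have "\<exists>M::nat. emeasure \<nu> {t. S t \<le> of_nat M} > 0"
  proof (rule ccontr)
    \<comment> \<open>otherwise \<open>S\<close> would be infinite almost everywhere\<close>
    assume "\<not> ?thesis"
    then have "emeasure \<nu> {t. S t \<le> of_nat M} = 0" for M :: nat by (simp add: zero_less_iff_neq_zero)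
    moreover have "{t. S t \<le> of_nat M} \<in> sets \<nu>" for M :: nat by measurable
    ultimately have "AE t in \<nu>. t \<notin> {t. S t \<le> of_nat M}" for M :: nat
      by (intro AE_not_in) (auto simp: null_sets_def)
    then have "AE t in \<nu>. \<forall>M::nat. \<not> S t \<le> of_nat M" by (simp add: AE_all_countable)
    with S_fin have "AE t in \<nu>. False"
    proof eventually_elim
      case (elim t)
      then obtain n where "S t < of_nat n" using ennreal_Ex_less_of_nat[of "S t"] by (auto simp: less_top)
      then show False using elim(2) less_imp_le by blast
    qed
    then show False by simp
  qed
  then obtain M :: nat where M: "emeasure \<nu> {t. S t \<le> of_nat M} > 0" by blast
  define E where "E = {t. S t \<le> of_nat M}"
  have E [measurable]: "E \<in> sets borel" unfolding E_def by measurable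
  define K where "K = exp pi * real M"
  have K: "K \<ge> 0" by (simp add: K_def)
  have small: "emeasure \<nu> (cball t \<rho>) \<le> ennreal (K * (1/2) powr (\<gamma> * real k))"
    if t: "t \<in> E" and \<rho>: "\<rho> \<le> (1/2) ^ k" for t \<rho> k
  proof -
    have "ennreal (2 powr (\<gamma> * real k)) * P k t \<le> S t"
      unfolding S_def using sum_le_suminf[OF summableI, of "{k}" "\<lambda>k. ennreal (2 powr (\<gamma> * real k)) * P k t"] by simp
    also have "\<dots> \<le> ennreal (real M)" using t by (simp add: E_def ennreal_of_nat_eq_real_of_nat)
    finally have 1: "ennreal (2 powr (\<gamma> * real k)) * P k t \<le> ennreal (real M)" .
    have "emeasure \<nu> (cball t \<rho>) = (\<integral>\<^sup>+t'. indicator (cball t \<rho>) t' \<partial>\<nu>)" by simp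
    also have "\<dots> \<le> (\<integral>\<^sup>+t'. ennreal (exp pi) * ennreal (exp (- (pi * (t - t')\<^sup>2 / ((1/2) ^ k)\<^sup>2))) \<partial>\<nu>)"
    proof (rule nn_integral_mono)
      fix t'
      show "indicator (cball t \<rho>) t' \<le> ennreal (exp pi) * ennreal (exp (- (pi * (t - t')\<^sup>2 / ((1/2) ^ k)\<^sup>2)))"
      proof (cases "t' \<in> cball t \<rho>")
        case True
        then have "\<bar>t - t'\<bar> \<le> (1/2) ^ k" using \<rho> by (simp add: dist_real_def)
        then have "(t - t')\<^sup>2 \<le> ((1/2) ^ k)\<^sup>2" by (metis abs_ge_zero power2_abs power_mono)
        then have "(t - t')\<^sup>2 / ((1/2) ^ k)\<^sup>2 \<le> 1" by (simp add: divide_le_eq)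
        then have "pi * ((t - t')\<^sup>2 / ((1/2) ^ k)\<^sup>2) \<le> pi * 1" by (intro mult_left_mono) auto
        then have "1 \<le> exp pi * exp (- (pi * (t - t')\<^sup>2 / ((1/2) ^ k)\<^sup>2))"
          by (simp add: exp_add[symmetric])
        then show ?thesis using True by (simp add: ennreal_mult[symmetric] ennreal_ge_1)
      qed simp
    qed
    also have "\<dots> = ennreal (exp pi) * P k t" unfolding P_def by (rule nn_integral_cmult) measurable
    also have "\<dots> = ennreal (exp pi * (1/2) powr (\<gamma> * real k)) * (ennreal (2 powr (\<gamma> * real k)) * P k t)"
    proof -
      have "(1/2) powr (\<gamma> * real k) * 2 powr (\<gamma> * real k) = (1::real)"
        by (simp add: powr_mult[symmetric])
      then have "exp pi = exp pi * (1/2) powr (\<gamma> * real k) * 2 powr (\<gamma> * real k)" by simp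
      then have "ennreal (exp pi) = ennreal (exp pi * (1/2) powr (\<gamma> * real k)) * ennreal (2 powr (\<gamma> * real k))"
        by (subst ennreal_mult[symmetric]) auto
      then show ?thesis by (simp only: mult.assoc)
    qed
    also have "\<dots> \<le> ennreal (exp pi * (1/2) powr (\<gamma> * real k)) * ennreal (real M)"
      using 1 by (rule mult_left_mono) simp
    also have "\<dots> = ennreal (K * (1/2) powr (\<gamma> * real k))"
      by (simp add: K_def ennreal_mult[symmetric] mult_ac)
    finally show ?thesis .
  qed
  \<comment> \<open>the factor \<open>2 powr \<gamma>\<close> comes from rounding \<open>\<rho>\<close> up to a power of 2; adding 1 only makes \<open>K'\<close> positive\<close>
  define K' where "K' = K * 2 powr \<gamma> + 1"
  have K': "K' > 0" using K by (simp add: K'_def add_nonneg_pos)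
  have ball: "emeasure \<nu> (cball t \<rho>) \<le> ennreal (K' * \<rho> powr \<gamma>)"
    if t: "t \<in> E" and \<rho>: "0 \<le> \<rho>" "\<rho> \<le> 1" for t \<rho>
  proof (cases "\<rho> = 0")
    case True
    have "emeasure \<nu> (cball t \<rho>) \<le> 0"
    proof (rule LIMSEQ_le_const)
      have "(1/2::real) powr \<gamma> < 1" using powr_less_mono2[of \<gamma> "1/2" 1] \<gamma> by simp
      then have "(\<lambda>k. K * ((1/2) powr \<gamma>) ^ k) \<longlonglongrightarrow> K * 0"
        by (intro tendsto_mult tendsto_const LIMSEQ_realpow_zero) auto
      also have "(\<lambda>k. K * ((1/2) powr \<gamma>) ^ k) = (\<lambda>k. K * (1/2) powr (\<gamma> * real k))"
        by (simp add: powr_realpow[symmetric] powr_powr)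
      finally show "(\<lambda>k. ennreal (K * (1/2) powr (\<gamma> * real k))) \<longlonglongrightarrow> 0"
        using tendsto_ennrealI by fastforce
      show "\<exists>N. \<forall>k\<ge>N. emeasure \<nu> (cball t \<rho>) \<le> ennreal (K * (1/2) powr (\<gamma> * real k))"
        using small[OF t, of \<rho>] True by (intro exI[of _ 0]) simp
    qed
    then show ?thesis by simp
  next
    case False
    then obtain k where k: "(1/2) ^ (k + 1) < \<rho>" "\<rho> \<le> (1/2) ^ k"
      using dyadic_shell_le_1[of \<rho>] \<rho> by auto
    have "emeasure \<nu> (cball t \<rho>) \<le> ennreal (K * (1/2) powr (\<gamma> * real k))" by (rule small[OF t k(2)])
    also have "\<dots> \<le> ennreal (K' * \<rho> powr \<gamma>)"
    proof (rule ennreal_leI)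
      have "(1/2) powr (\<gamma> * real k) = ((1/2) ^ k) powr \<gamma>"
        by (simp add: powr_realpow[symmetric] powr_powr mult.commute)
      also have "\<dots> \<le> (2 * \<rho>) powr \<gamma>" using k \<gamma> by (intro powr_mono2) auto
      also have "\<dots> = 2 powr \<gamma> * \<rho> powr \<gamma>" using \<rho> by (simp add: powr_mult)
      finally have "K * (1/2) powr (\<gamma> * real k) \<le> K * (2 powr \<gamma> * \<rho> powr \<gamma>)" using K by (rule mult_left_mono)
      also have "\<dots> \<le> K' * \<rho> powr \<gamma>" by (simp add: K'_def algebra_simps)
      finally show "K * (1/2) powr (\<gamma> * real k) \<le> K' * \<rho> powr \<gamma>" .
    qed
    finally show ?thesis .
  qed
  have pos: "hausdorff_measure s A > 0" if s: "0 \<le> s" "s < \<gamma>" for s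
  proof -
    have "emeasure \<nu> E / ennreal K' \<le> hausdorff_premeasure 1 s A"
      unfolding hausdorff_premeasure_def
    proof (rule INF_greatest, clarsimp)
      fix U :: "nat \<Rightarrow> real set"
      assume cover: "A \<subseteq> (\<Union>i. U i)" and U: "\<forall>i. bounded (U i) \<and> diameter (U i) \<le> 1"
      \<comment> \<open>balls around points of \<open>E\<close>, because the covering sets need neither be measurable nor be centred in \<open>E\<close>\<close>
      define V where "V i = (if U i \<inter> E = {} then {} else cball (SOME t. t \<in> U i \<inter> E) (diameter (U i)))" for i
      have V_meas [measurable]: "V i \<in> sets borel" for i by (simp add: V_def)
      have some: "(SOME t. t \<in> U i \<inter> E) \<in> U i \<inter> E" if "U i \<inter> E \<noteq> {}" for i
        using that by (metis some_in_eq)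
      have UV: "U i \<inter> E \<subseteq> V i" for i
      proof
        fix t assume t: "t \<in> U i \<inter> E"
        then have ne: "U i \<inter> E \<noteq> {}" by blast
        then show "t \<in> V i"
          using some[OF ne] t U diameter_bounded_bound[of "U i"] by (simp add: V_def)
      qed
      have V: "emeasure \<nu> (V i) \<le> ennreal K' * diam_powr s (U i)" for i
      proof (cases "U i \<inter> E = {}")
        case False
        have \<rho>: "0 \<le> diameter (U i)" "diameter (U i) \<le> 1" using U by (auto intro: diameter_ge_0)
        have "emeasure \<nu> (V i) \<le> ennreal (K' * diameter (U i) powr \<gamma>)"
          using ball[OF _ \<rho>] some[OF False] False by (simp add: V_def)
        also have "\<dots> = ennreal K' * ennreal (diameter (U i) powr \<gamma>)"
          using K' by (simp add: ennreal_mult)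
        also have "ennreal (diameter (U i) powr \<gamma>) \<le> diam_powr s (U i)"
        proof (cases "s = 0")
          case True
          have "diameter (U i) powr \<gamma> \<le> 1" using \<rho> \<gamma> by (intro powr_le1) auto
          then show ?thesis using True False by (auto simp: diam_powr_def)
        next
          case s0: False
          have "diameter (U i) powr \<gamma> \<le> diameter (U i) powr s" using \<rho> s by (intro powr_mono') auto
          then show ?thesis using s0 False by (auto simp: diam_powr_def intro: ennreal_leI)
        qed
        finally show ?thesis by (simp add: mult_left_mono)
      qed (simp add: V_def)
      have "emeasure \<nu> E \<le> emeasure \<nu> (\<Union>i. V i)"
      proof (rule emeasure_mono_AE)
        show "AE t in \<nu>. t \<in> E \<longrightarrow> t \<in> (\<Union>i. V i)"
          using A
        proof eventually_elim
          case (elim t)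
          then show ?case using cover UV by blast
        qed
      qed measurable
      also have "\<dots> \<le> (\<Sum>i. emeasure \<nu> (V i))" by (rule emeasure_subadditive_countably) (auto simp: sets)
      also have "\<dots> \<le> (\<Sum>i. ennreal K' * diam_powr s (U i))" by (intro suminf_le V) auto
      also have "\<dots> = ennreal K' * (\<Sum>i. diam_powr s (U i))" by simp
      finally show "emeasure \<nu> E / ennreal K' \<le> (\<Sum>i. diam_powr s (U i))"
        using K' by (intro divide_le_posI_ennreal) (auto simp: mult.commute)
    qed
    moreover have "emeasure \<nu> E / ennreal K' > 0"
      using M by (simp add: E_def ennreal_zero_less_divide)
    moreover have "hausdorff_premeasure 1 s A \<le> hausdorff_measure s A"
      unfolding hausdorff_measure_def by (rule SUP_upper) simp
    ultimately show ?thesis by (meson less_le_trans)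
  qed
  show ?thesis
    unfolding hausdorff_dim_def
  proof (rule INF_greatest)
    fix s assume "s \<in> {s. 0 \<le> s \<and> hausdorff_measure s A = 0}"
    then show "ereal \<gamma> \<le> ereal s" using pos[of s] by (cases "s < \<gamma>") auto
  qed
qed

text \<open>
  Let \<open>f\<close> be the convolution of \<open>\<nu>\<close> with the indicator of \<open>[- \<delta>, \<delta>]\<close>. Its integral is \<open>2 \<delta>\<close>, its
  squared \<open>L\<^sup>2\<close>-norm is \<open>O(\<delta>\<^sup>2)\<close> at the scales in question, and it lives on the \<open>\<delta>\<close>-neighbourhood of
  \<open>A\<close>. By Cauchy--Schwarz the measures of these neighbourhoods are bounded below, and for compact \<open>A\<close> they
  converge to the measure of \<open>A\<close>.
\<close>

lemma emeasure_pos_of_gaussian_coincidence: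
  fixes \<nu> :: "real measure"
  assumes \<nu>: "prob_space \<nu>" and sets [measurable_cong]: "sets \<nu> = sets borel"
    and AE: "AE t in \<nu>. t \<in> A" and A: "compact A"
    and b: "b > 0" and freq: "\<exists>\<^sub>F k in sequentially. ennreal (2 ^ k) * gaussian_coincidence ((1/2) ^ k) \<nu> \<le> ennreal b"
  shows "emeasure lborel A > 0"
proof (rule ccontr)
  interpret prob_space \<nu> by fact
  interpret P: pair_sigma_finite \<nu> "lborel :: real measure" ..
  assume "\<not> emeasure lborel A > 0"
  then have A0: "emeasure lborel A = 0" by (simp add: zero_less_iff_neq_zero)
  have "A \<noteq> {}"
  proof
    assume "A = {}"
    then have "AE t in \<nu>. False" using AE by simp
    then show False by simp
  qed
  define N where "N k = {t. infdist t A \<le> (1/2) ^ k}" for k :: nat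
  have N_closed: "closed (N k)" for k
    unfolding N_def by (intro closed_Collect_le continuous_intros)
  have N_sets: "N k \<in> sets lborel" for k using N_closed by simp
  have "(\<lambda>k. emeasure lborel (N k)) \<longlonglongrightarrow> emeasure lborel (\<Inter>k. N k)"
  proof (rule Lim_emeasure_decseq)
    show "range N \<subseteq> sets lborel" using N_sets by auto
    show "decseq N"
      unfolding N_def decseq_def by (auto intro: order_trans power_decreasing)
    fix k
    obtain R where R: "\<And>y. y \<in> A \<Longrightarrow> \<bar>y\<bar> \<le> R" using compact_imp_bounded[OF A] by (auto simp: bounded_iff)
    have "N k \<subseteq> cball 0 (R + 1)"
    proof
      fix t assume "t \<in> N k"
      moreover have "(1/2::real) ^ k \<le> 1" by (rule power_le_one) auto
      ultimately have "infdist t A \<le> 1" by (simp add: N_def)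
      moreover obtain y where "y \<in> A" "infdist t A = dist t y"
        using infdist_attains_inf[OF compact_imp_closed[OF A] \<open>A \<noteq> {}\<close>] by blast
      ultimately have "\<bar>y\<bar> \<le> R" "\<bar>t - y\<bar> \<le> 1" using R by (auto simp: dist_real_def)
      then show "t \<in> cball 0 (R + 1)" by (simp add: dist_real_def)
    qed
    then have "emeasure lborel (N k) \<le> emeasure lborel (cball 0 (R + 1) :: real set)"
      by (intro emeasure_mono) auto
    also have "\<dots> < \<infinity>" by (rule emeasure_lborel_cball_finite)
    finally show "emeasure lborel (N k) \<noteq> \<infinity>" by simp
  qed
  moreover have "(\<Inter>k. N k) = A"
  proof
    show "A \<subseteq> (\<Inter>k. N k)" by (auto simp: N_def)
    show "(\<Inter>k. N k) \<subseteq> A"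
    proof
      fix t assume "t \<in> (\<Inter>k. N k)"
      then have "infdist t A \<le> (1/2) ^ k" for k by (auto simp: N_def)
      moreover have "(\<lambda>k. (1/2::real) ^ k) \<longlonglongrightarrow> 0" by (rule LIMSEQ_realpow_zero) auto
      ultimately have "infdist t A \<le> 0" by (intro LIMSEQ_le_const) auto
      then have "infdist t A = 0" using infdist_nonneg[of t A] by linarith
      then show "t \<in> A"
        using in_closed_iff_infdist_zero[OF compact_imp_closed[OF A] \<open>A \<noteq> {}\<close>] by simp
    qed
  qed
  ultimately have lim: "(\<lambda>k. emeasure lborel (N k)) \<longlonglongrightarrow> 0" using A0 by simp
  \<comment> \<open>the squared \<open>L\<^sup>2\<close>-norm of \<open>f\<close> below is at most \<open>c \<delta>\<^sup>2\<close>\<close>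
  define c where "c = 2 * exp (4 * pi) * b"
  have c: "c > 0" using b by (simp add: c_def)
  have "eventually (\<lambda>k. emeasure lborel (N k) < ennreal (1 / (2 * c))) sequentially"
    using lim c by (intro order_tendstoD) auto
  then obtain k0 where k0: "\<And>k. k \<ge> k0 \<Longrightarrow> emeasure lborel (N k) < ennreal (1 / (2 * c))"
    by (auto simp: eventually_sequentially)
  obtain k where k: "k \<ge> k0" "ennreal (2 ^ k) * gaussian_coincidence ((1/2) ^ k) \<nu> \<le> ennreal b"
    using freq by (auto simp: frequently_sequentially)
  define \<delta> where "\<delta> = (1/2::real) ^ k"
  have \<delta>: "\<delta> > 0" by (simp add: \<delta>_def)
  define G where "G = gaussian_coincidence \<delta> \<nu>"
  have G: "G \<le> ennreal (b * \<delta>)"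
  proof -
    have "G = ennreal \<delta> * (ennreal (2 ^ k) * G)"
      by (simp add: mult.assoc[symmetric] ennreal_mult[symmetric] \<delta>_def power_mult_distrib[symmetric])
    also have "\<dots> \<le> ennreal \<delta> * ennreal b"
      using k(2) by (intro mult_left_mono) (auto simp: G_def \<delta>_def)
    finally show ?thesis using \<delta> b by (simp add: ennreal_mult[symmetric] mult.commute)
  qed
  let ?I = "\<lambda>s t. indicator {t. \<bar>s - t\<bar> \<le> \<delta>} t :: ennreal"
  have I_meas [measurable]: "(\<lambda>(s, t). ?I s t) \<in> borel_measurable (borel \<Otimes>\<^sub>M borel)"
  proof -
    have "(\<lambda>(s, t). ?I s t) = indicator {p. \<bar>fst p - snd p\<bar> \<le> \<delta>}" by (auto simp: indicator_def fun_eq_iff)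
    moreover have "{p :: real \<times> real. \<bar>fst p - snd p\<bar> \<le> \<delta>} \<in> sets (borel \<Otimes>\<^sub>M borel)"
      unfolding borel_prod by (intro borel_closed closed_Collect_le continuous_intros)
    ultimately show ?thesis by simp
  qed
  have length: "(\<integral>\<^sup>+t. ?I s t \<partial>lborel) = ennreal (2 * \<delta>)" for s
  proof -
    have "{t. \<bar>s - t\<bar> \<le> \<delta>} = {s - \<delta>..s + \<delta>}" by auto
    then show ?thesis using \<delta> by simp
  qed
  define f where "f t = (\<integral>\<^sup>+s. ?I s t \<partial>\<nu>)" for t
  have f_meas [measurable]: "f \<in> borel_measurable borel" unfolding f_def[abs_def] by measurable
  have f_int: "(\<integral>\<^sup>+t. f t \<partial>lborel) = ennreal (2 * \<delta>)"
  proof -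
    have "(\<integral>\<^sup>+t. f t \<partial>lborel) = (\<integral>\<^sup>+s. \<integral>\<^sup>+t. ?I s t \<partial>lborel \<partial>\<nu>)"
      unfolding f_def by (rule P.Fubini') measurable
    then show ?thesis by (simp add: length emeasure_space_1)
  qed
  have f_le: "f t \<le> 1" for t
  proof -
    have "f t \<le> (\<integral>\<^sup>+s. 1 \<partial>\<nu>)" unfolding f_def by (intro nn_integral_mono) (simp add: indicator_def)
    then show ?thesis by (simp add: emeasure_space_1)
  qed
  have f_supp: "f t = 0" if "t \<notin> N k" for t
  proof -
    have "AE s in \<nu>. ?I s t = 0"
      using AE
    proof eventually_elim
      case (elim s)
      then have "infdist t A \<le> \<bar>s - t\<bar>" using infdist_le[of s A t] by (simp add: dist_real_def abs_minus_commute)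
      then show ?case using that by (auto simp: N_def \<delta>_def indicator_def)
    qed
    then have "f t = (\<integral>\<^sup>+s. 0 \<partial>\<nu>)" unfolding f_def by (intro nn_integral_cong_AE) auto
    then show ?thesis by simp
  qed
  have f_sq: "(\<integral>\<^sup>+t. f t * f t \<partial>lborel) \<le> ennreal (\<delta> * \<delta> * c)"
  proof -
    have "(\<integral>\<^sup>+t. f t * f t \<partial>lborel) = (\<integral>\<^sup>+t. \<integral>\<^sup>+s. \<integral>\<^sup>+s'. ?I s t * ?I s' t \<partial>\<nu> \<partial>\<nu> \<partial>lborel)"
    proof (rule nn_integral_cong)
      fix t :: real
      have "f t * f t = (\<integral>\<^sup>+s. ?I s t * f t \<partial>\<nu>)"
        by (subst nn_integral_multc) (auto simp: f_def)
      also have "\<dots> = (\<integral>\<^sup>+s. \<integral>\<^sup>+s'. ?I s t * ?I s' t \<partial>\<nu> \<partial>\<nu>)"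
        unfolding f_def by (intro nn_integral_cong nn_integral_cmult[symmetric]) measurable
      finally show "f t * f t = (\<integral>\<^sup>+s. \<integral>\<^sup>+s'. ?I s t * ?I s' t \<partial>\<nu> \<partial>\<nu>)" .
    qed
    also have "\<dots> = (\<integral>\<^sup>+s. \<integral>\<^sup>+t. \<integral>\<^sup>+s'. ?I s t * ?I s' t \<partial>\<nu> \<partial>lborel \<partial>\<nu>)"
      by (rule P.Fubini') measurable
    also have "\<dots> = (\<integral>\<^sup>+s. \<integral>\<^sup>+s'. \<integral>\<^sup>+t. ?I s t * ?I s' t \<partial>lborel \<partial>\<nu> \<partial>\<nu>)"
      by (intro nn_integral_cong P.Fubini') measurable
    also have "\<dots> \<le> (\<integral>\<^sup>+s. \<integral>\<^sup>+s'. ennreal (2 * \<delta> * exp (4 * pi)) * ennreal (exp (- (pi * (s - s')\<^sup>2 / \<delta>\<^sup>2))) \<partial>\<nu> \<partial>\<nu>)"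
    proof (intro nn_integral_mono)
      fix s s' :: real
      show "(\<integral>\<^sup>+t. ?I s t * ?I s' t \<partial>lborel) \<le> ennreal (2 * \<delta> * exp (4 * pi)) * ennreal (exp (- (pi * (s - s')\<^sup>2 / \<delta>\<^sup>2)))"
      proof (cases "\<bar>s - s'\<bar> \<le> 2 * \<delta>")
        case True
        have "(s - s')\<^sup>2 \<le> (2 * \<delta>)\<^sup>2" using True by (metis abs_ge_zero power2_abs power_mono)
        then have "(s - s')\<^sup>2 / \<delta>\<^sup>2 \<le> 4" using \<delta> by (simp add: divide_le_eq power_mult_distrib)
        then have "pi * ((s - s')\<^sup>2 / \<delta>\<^sup>2) \<le> pi * 4" by (intro mult_left_mono) auto
        then have "1 \<le> exp (4 * pi) * exp (- (pi * (s - s')\<^sup>2 / \<delta>\<^sup>2))"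
          by (simp add: exp_add[symmetric] mult.commute)
        then have "2 * \<delta> * 1 \<le> 2 * \<delta> * (exp (4 * pi) * exp (- (pi * (s - s')\<^sup>2 / \<delta>\<^sup>2)))"
          using \<delta> by (intro mult_left_mono) auto
        then have *: "ennreal (2 * \<delta>) \<le> ennreal (2 * \<delta> * exp (4 * pi)) * ennreal (exp (- (pi * (s - s')\<^sup>2 / \<delta>\<^sup>2)))"
          using \<delta> by (simp add: ennreal_mult[symmetric] ennreal_leI mult.assoc)
        have "(\<integral>\<^sup>+t. ?I s t * ?I s' t \<partial>lborel) \<le> (\<integral>\<^sup>+t. ?I s t \<partial>lborel)"
          by (intro nn_integral_mono) (auto simp: indicator_def)
        then show ?thesis using * length[of s] by simp
      next
        case False
        then have "(\<integral>\<^sup>+t. ?I s t * ?I s' t \<partial>lborel) = (\<integral>\<^sup>+(t::real). 0 \<partial>lborel)"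
          by (intro nn_integral_cong) (auto simp: indicator_def)
        then show ?thesis by simp
      qed
    qed
    also have "\<dots> = ennreal (2 * \<delta> * exp (4 * pi)) * G"
      unfolding G_def gaussian_coincidence_def by (simp add: nn_integral_cmult)
    also have "\<dots> \<le> ennreal (2 * \<delta> * exp (4 * pi)) * ennreal (b * \<delta>)" using G by (rule mult_left_mono) simp
    also have "\<dots> = ennreal (\<delta> * \<delta> * c)"
      using \<delta> b by (simp add: ennreal_mult[symmetric] c_def mult_ac)
    finally show ?thesis .
  qed
  \<comment> \<open>with this weight the quadratic term is only \<open>\<delta>\<close>, half of the integral of \<open>f\<close>\<close>
  define \<Lambda> where "\<Lambda> = \<delta> * c"
  have \<Lambda>: "\<Lambda> > 0" using \<delta> c by (simp add: \<Lambda>_def)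
  have "ennreal (2 * \<delta>) = (\<integral>\<^sup>+t. f t \<partial>lborel)" by (simp add: f_int)
  also have "\<dots> \<le> (\<integral>\<^sup>+t. ennreal \<Lambda> * indicator (N k) t + ennreal (1 / \<Lambda>) * (f t * f t) \<partial>lborel)"
  proof (rule nn_integral_mono)
    fix t :: real
    show "f t \<le> ennreal \<Lambda> * indicator (N k) t + ennreal (1 / \<Lambda>) * (f t * f t)"
    proof (cases "t \<in> N k")
      case True
      define y where "y = enn2real (f t)"
      have "f t < \<top>" using f_le[of t] by (auto intro: le_less_trans)
      then have y: "f t = ennreal y" "y \<ge> 0" by (auto simp: y_def)
      have "y \<le> \<Lambda> + 1 / \<Lambda> * (y * y)"
        using mult_le_weighted_squares[OF \<Lambda>, of 1 y] by (simp add: power2_eq_square)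
      then have "ennreal y \<le> ennreal (\<Lambda> + 1 / \<Lambda> * (y * y))" by (rule ennreal_leI)
      then show ?thesis using True y \<Lambda> by (simp add: ennreal_mult[symmetric] ennreal_plus[symmetric] del: ennreal_plus)
    qed (simp add: f_supp)
  qed
  also have "\<dots> = ennreal \<Lambda> * emeasure lborel (N k) + ennreal (1 / \<Lambda>) * (\<integral>\<^sup>+t. f t * f t \<partial>lborel)"
    using N_sets by (subst nn_integral_add) (auto simp: nn_integral_cmult nn_integral_cmult_indicator)
  also have "\<dots> \<le> ennreal \<Lambda> * ennreal (1 / (2 * c)) + ennreal (1 / \<Lambda>) * ennreal (\<delta> * \<delta> * c)"
    using k0[OF k(1)] f_sq by (intro add_mono mult_left_mono) auto
  also have "\<dots> = ennreal (\<Lambda> * (1 / (2 * c)) + 1 / \<Lambda> * (\<delta> * \<delta> * c))"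
    using \<Lambda> c \<delta> by (simp add: ennreal_mult[symmetric] ennreal_plus[symmetric] del: ennreal_plus)
  also have "\<Lambda> * (1 / (2 * c)) + 1 / \<Lambda> * (\<delta> * \<delta> * c) = 3 / 2 * \<delta>"
    using \<delta> c by (simp add: \<Lambda>_def field_simps)
  finally show False using \<delta> by simp
qed

section \<open>Pinned distances\<close>

text \<open>
  By the Lindelof property the complement of the support is a countable union of open null sets.
\<close>

lemma AE_in_measure_supp:
  fixes \<mu> :: "'a::euclidean_space measure"
  assumes sets: "sets \<mu> = sets borel"
  shows "AE x in \<mu>. x \<in> measure_supp \<mu>"
proof -
  define \<U> where "\<U> = {U. open U \<and> emeasure \<mu> U = 0}"
  obtain \<V> where \<V>: "\<V> \<subseteq> \<U>" "countable \<V>" "\<Union>\<V> = \<Union>\<U>"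
    using Lindelof[of \<U>] by (auto simp: \<U>_def)
  have "\<Union>\<V> \<in> null_sets \<mu>"
  proof -
    have "(\<Union>V\<in>\<V>. V) \<in> null_sets \<mu>"
      using \<V> by (intro null_sets_UN') (auto simp: \<U>_def null_sets_def sets)
    then show ?thesis by simp
  qed
  then have "AE x in \<mu>. x \<notin> \<Union>\<V>" by (rule AE_not_in)
  then show ?thesis
  proof eventually_elim
    case (elim x)
    then show ?case unfolding \<V>(3) by (auto simp: \<U>_def measure_supp_def zero_less_iff_neq_zero)
  qed
qed

lemma pinned_distance_set_eq_image: "pinned_distance_set x E = dist x ` E"
  by (auto simp: pinned_distance_set_def)

lemma compact_pinned_distance_set: "compact E \<Longrightarrow> compact (pinned_distance_set x E)"
  unfolding pinned_distance_set_eq_image by (intro compact_continuous_image continuous_intros)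

lemma compact_distance_set:
  assumes "compact E" "compact F"
  shows "compact (distance_set E F)"
proof -
  have "distance_set E F = (\<lambda>p. dist (fst p) (snd p)) ` (E \<times> F)"
    unfolding distance_set_def by force
  then show ?thesis using assms
    by (auto intro!: compact_continuous_image continuous_intros compact_Times)
qed

lemma pinned_distance_set_subset: "x \<in> E \<Longrightarrow> pinned_distance_set x F \<subseteq> distance_set E F"
  by (auto simp: pinned_distance_set_def distance_set_def)

lemma hausdorff_dim_mono:
  assumes "A \<subseteq> B"
  shows "hausdorff_dim A \<le> hausdorff_dim B"
proof -
  have "hausdorff_premeasure \<delta> s A \<le> hausdorff_premeasure \<delta> s B" for \<delta> s
    unfolding hausdorff_premeasure_def using assms by (intro INF_superset_mono) auto
  then have "hausdorff_measure s A \<le> hausdorff_measure s B" for s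
    unfolding hausdorff_measure_def by (intro SUP_mono') auto
  then have "hausdorff_measure s A = 0" if "hausdorff_measure s B = 0" for s
    using that by (metis le_zero_eq)
  then show ?thesis
    unfolding hausdorff_dim_def by (intro INF_superset_mono) auto
qed

text \<open>
  On bounded sets \<open>t \<mapsto> t\<^sup>2\<close> is Lipschitz with constant \<open>2 \<Lambda>\<close>, so distances that are close have close
  squares.
\<close>

lemma gaussian_coincidence_le_pinned:
  fixes \<mu> :: "'a::euclidean_space measure"
  assumes \<mu>: "prob_space \<mu>" and sets [measurable_cong]: "sets \<mu> = sets borel"
    and \<Lambda>: "\<Lambda> > 0" "AE y in \<mu>. dist x y \<le> \<Lambda>" and \<delta>: "\<delta> > 0"
  shows "gaussian_coincidence \<delta> (distr \<mu> borel (dist x)) \<le> pinned_coincidence (2 * \<Lambda> * \<delta>) \<mu> x"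
proof -
  interpret prob_space \<mu> by fact
  interpret P: pair_prob_space \<mu> \<mu> ..
  have [measurable]: "dist x \<in> borel_measurable \<mu>" by measurable
  interpret D: prob_space "distr \<mu> borel (dist x)" by (rule prob_space_distr) measurable
  have "gaussian_coincidence \<delta> (distr \<mu> borel (dist x))
      = (\<integral>\<^sup>+y. \<integral>\<^sup>+y'. ennreal (exp (- (pi * (dist x y - dist x y')\<^sup>2 / \<delta>\<^sup>2))) \<partial>\<mu> \<partial>\<mu>)"
    unfolding gaussian_coincidence_def by (simp add: nn_integral_distr)
  also have "\<dots> = (\<integral>\<^sup>+p. ennreal (exp (- (pi * (dist x (fst p) - dist x (snd p))\<^sup>2 / \<delta>\<^sup>2))) \<partial>(\<mu> \<Otimes>\<^sub>M \<mu>))"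
    by (subst nn_integral_fst[symmetric]) auto
  also have "\<dots> \<le> pinned_coincidence (2 * \<Lambda> * \<delta>) \<mu> x"
    unfolding pinned_coincidence_def
  proof (rule nn_integral_mono_AE)
    have "AE p in \<mu> \<Otimes>\<^sub>M \<mu>. dist x (fst p) \<le> \<Lambda>" "AE p in \<mu> \<Otimes>\<^sub>M \<mu>. dist x (snd p) \<le> \<Lambda>"
      using \<Lambda> by (intro P.AE_pair_measure; simp)+
    then show "AE p in \<mu> \<Otimes>\<^sub>M \<mu>. ennreal (exp (- (pi * (dist x (fst p) - dist x (snd p))\<^sup>2 / \<delta>\<^sup>2)))
      \<le> ennreal (exp (- (pi * ((norm (x - fst p))\<^sup>2 - (norm (x - snd p))\<^sup>2)\<^sup>2 / (2 * \<Lambda> * \<delta>)\<^sup>2)))"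
    proof eventually_elim
      case (elim p)
      define s where "s = dist x (fst p)"
      define t where "t = dist x (snd p)"
      have st: "0 \<le> s" "0 \<le> t" "s \<le> \<Lambda>" "t \<le> \<Lambda>" using elim by (auto simp: s_def t_def)
      have "(s\<^sup>2 - t\<^sup>2)\<^sup>2 = (s - t)\<^sup>2 * (s + t)\<^sup>2" by (simp add: power2_eq_square algebra_simps)
      also have "\<dots> \<le> (s - t)\<^sup>2 * (2 * \<Lambda>)\<^sup>2"
        using st by (intro mult_left_mono power_mono) auto
      finally have "(s\<^sup>2 - t\<^sup>2)\<^sup>2 / (2 * \<Lambda> * \<delta>)\<^sup>2 \<le> (s - t)\<^sup>2 * (2 * \<Lambda>)\<^sup>2 / (2 * \<Lambda> * \<delta>)\<^sup>2"
        by (rule divide_right_mono) simp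
      also have "\<dots> = (s - t)\<^sup>2 / \<delta>\<^sup>2"
        using \<Lambda> \<delta> by (simp add: power_mult_distrib)
      finally have "pi * ((s\<^sup>2 - t\<^sup>2)\<^sup>2 / (2 * \<Lambda> * \<delta>)\<^sup>2) \<le> pi * ((s - t)\<^sup>2 / \<delta>\<^sup>2)"
        by (rule mult_left_mono) simp
      then show ?case
        unfolding s_def t_def dist_norm by (intro ennreal_leI) simp
    qed
  qed
  finally show ?thesis .
qed

text \<open>
  The two branches of the threshold are one formula: in both of them there is a \<open>\<theta> \<ge> \<theta>\<^sub>1\<close> with
  \<open>u \<le> d \<theta>\<close> and \<open>\<beta> = (u + 2 \<theta> a - d \<theta>) / 2\<close>. The suprema \<open>u\<close> and \<open>a\<close> need not be attained, which
  costs the gap between \<open>\<eta>\<close> and \<open>\<beta>\<close>.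
\<close>

lemma pinned_coincidence_decay_below_threshold:
  fixes \<mu>\<^sub>1 \<mu>\<^sub>2 :: "'a::euclidean_space measure"
  assumes \<mu>1: "prob_space \<mu>\<^sub>1" "sets \<mu>\<^sub>1 = sets borel"
    and \<mu>2: "prob_space \<mu>\<^sub>2" "sets \<mu>\<^sub>2 = sets borel"
    and supp: "AE y in \<mu>\<^sub>2. norm y \<le> L"
    and \<theta>: "\<theta>\<^sub>1 \<in> {0..1}" "\<theta>\<^sub>2 \<in> {0..1}"
    and u: "ereal u = fourier_spectrum \<theta>\<^sub>1 \<mu>\<^sub>1" "u \<le> real DIM('a)"
    and a: "ereal a = min (ereal (real DIM('a) / 2))
                     (min (fourier_spectrum \<theta>\<^sub>2 \<mu>\<^sub>2)
                          (if \<theta>\<^sub>2 = 0 then \<infinity> else fourier_spectrum \<theta>\<^sub>2 \<mu>\<^sub>2 / ereal (2 * \<theta>\<^sub>2)))"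
    and \<eta>: "0 < \<eta>" "\<eta> \<le> 1" "\<eta> < beta_threshold (real DIM('a)) \<theta>\<^sub>1 a u"
  obtains B where "B \<ge> 0"
    "\<And>\<delta>. \<delta> > 0 \<Longrightarrow> (\<integral>\<^sup>+x. ennreal (exp (- (pi * (norm x)\<^sup>2))) * pinned_coincidence \<delta> \<mu>\<^sub>2 x \<partial>\<mu>\<^sub>1)
       \<le> ennreal (B * \<delta> powr \<eta>)"
proof -
  define d where "d = real DIM('a)"
  have d: "d > 0" by (simp add: d_def)
  define \<beta> where "\<beta> = beta_threshold d \<theta>\<^sub>1 a u"
  have \<beta>: "\<eta> < \<beta>" "\<beta> > 0" using \<eta> by (auto simp: \<beta>_def d_def)
  have u0: "u \<ge> 0"
  proof -
    have "ereal 0 \<le> fourier_spectrum \<theta>\<^sub>1 \<mu>\<^sub>1"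
      unfolding fourier_spectrum_def by (rule Sup_upper) (simp add: zero_ereal_def)
    then show ?thesis using u(1) by (metis ereal_less_eq(3))
  qed
  have "ereal a \<le> ereal (d / 2)" using a by (simp add: d_def)
  then have ad: "2 * a \<le> d" by simp
  have a_le: "ereal a \<le> min (fourier_spectrum \<theta>\<^sub>2 \<mu>\<^sub>2)
      (if \<theta>\<^sub>2 = 0 then \<infinity> else fourier_spectrum \<theta>\<^sub>2 \<mu>\<^sub>2 / ereal (2 * \<theta>\<^sub>2))"
    unfolding a by (rule min.cobounded2)
  obtain \<theta> where \<theta>': "0 < \<theta>" "\<theta> \<le> 1" "\<theta>\<^sub>1 \<le> \<theta>" "u \<le> d * \<theta>" "\<beta> = (u + 2 * \<theta> * a - d * \<theta>) / 2"
    and pos: "u > 0" "a > 0"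
  proof (cases "u < d * \<theta>\<^sub>1")
    case True
    then have \<theta>1: "\<theta>\<^sub>1 > 0" using u0 d by (metis less_le_trans not_less mult_nonneg_nonpos less_imp_le)
    have *: "\<beta> = (u + 2 * \<theta>\<^sub>1 * a - d * \<theta>\<^sub>1) / 2" using True by (simp add: \<beta>_def beta_threshold_def)
    then have **: "2 * (\<theta>\<^sub>1 * a) > d * \<theta>\<^sub>1 - u" using \<beta> by simp
    then have "\<theta>\<^sub>1 * a > 0" using True by linarith
    then have "a > 0" using \<theta>1 by (simp add: zero_less_mult_iff)
    moreover have "\<theta>\<^sub>1 * (2 * a) \<le> \<theta>\<^sub>1 * d" using ad \<theta>1 by (intro mult_left_mono) auto
    then have "u > 0" using ** by (simp add: mult.commute)
    ultimately show ?thesis using that[of \<theta>\<^sub>1] \<theta>1 \<theta> True * by auto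
  next
    case False
    then have *: "\<beta> = u * a / d" by (simp add: \<beta>_def beta_threshold_def)
    then have "u * a > 0" using \<beta> d by (simp add: zero_less_divide_iff)
    then have "u > 0" "a > 0" using u0 by (auto simp: zero_less_mult_iff)
    moreover have "\<theta>\<^sub>1 \<le> u / d" "u / d \<le> 1" using False d u(2) by (auto simp: field_simps d_def)
    \<comment> \<open>at \<open>\<theta> = u / d\<close> the terms \<open>u\<close> and \<open>d \<theta>\<close> cancel in the formula for \<open>\<beta>\<close>\<close>
    ultimately show ?thesis using that[of "u / d"] d * by simp
  qed
  \<comment> \<open>the loss in both parameters; it costs at most \<open>3 \<tau> / 2\<close>, less than \<open>\<beta> - \<eta>\<close>\<close>
  define \<tau> where "\<tau> = min ((\<beta> - \<eta>) / 2) (min (u / 2) (a / 2))"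
  have \<tau>_pos: "\<tau> > 0" using pos \<beta> by (simp add: \<tau>_def)
  have "\<tau> \<le> (\<beta> - \<eta>) / 2" "\<tau> \<le> u / 2" "\<tau> \<le> a / 2"
    unfolding \<tau>_def by (meson min.cobounded1 min.cobounded2 order_trans)+
  note \<tau> = \<tau>_pos this
  have "fourier_moment \<theta> (u - \<tau>) \<mu>\<^sub>1 < \<infinity>"
  proof (rule fourier_moment_below_spectrum[OF \<mu>1])
    show "ereal (u - \<tau>) < fourier_spectrum \<theta>\<^sub>1 \<mu>\<^sub>1" unfolding u(1)[symmetric] using \<tau> by simp
  qed (use \<theta> \<theta>' \<tau> pos in auto)
  moreover have "fourier_moment (1 / 2) (a - \<tau>) \<mu>\<^sub>2 < \<infinity>"
  proof (rule fourier_moment_half[OF \<mu>2])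
    have "ereal (a - \<tau>) < ereal a" using \<tau> by simp
    then show "ereal (a - \<tau>) < min (fourier_spectrum \<theta>\<^sub>2 \<mu>\<^sub>2)
       (if \<theta>\<^sub>2 = 0 then \<infinity> else fourier_spectrum \<theta>\<^sub>2 \<mu>\<^sub>2 / ereal (2 * \<theta>\<^sub>2))"
      using a_le by (rule less_le_trans)
  qed (use \<theta> \<tau> pos in auto)
  moreover have "u - \<tau> \<le> real DIM('a) * \<theta>" "2 * (a - \<tau>) \<le> real DIM('a)"
    using \<theta>' \<tau> ad by (auto simp: d_def)
  ultimately obtain C where C: "C \<ge> 0"
    "\<And>r. r \<ge> 1 \<Longrightarrow> (\<integral>\<^sup>+w. ennreal (norm (damped_fourier \<mu>\<^sub>1 (r *\<^sub>R w))) \<partial>difference_law \<mu>\<^sub>2)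
       \<le> ennreal (C * r powr (- ((u - \<tau> + 2 * \<theta> * (a - \<tau>) - real DIM('a) * \<theta>) / 2)))"
    using damped_fourier_average_decay[OF \<mu>1 \<mu>2 supp \<theta>'(1,2), of "u - \<tau>" "a - \<tau>"] by blast
  have "\<eta> < (u - \<tau> + 2 * \<theta> * (a - \<tau>) - real DIM('a) * \<theta>) / 2"
  proof -
    define q where "q = \<theta> * \<tau>"
    have q: "q \<le> \<tau>" unfolding q_def using \<theta>' \<tau> by (intro mult_left_le_one_le) auto
    have "\<eta> < \<beta> - \<tau> / 2 - q" using q \<tau>(1,2) by (simp add: field_simps)
    moreover have "(u - \<tau> + 2 * \<theta> * (a - \<tau>) - d * \<theta>) / 2 = \<beta> - \<tau> / 2 - q"
      unfolding \<theta>'(5) q_def by (simp add: field_simps)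
    ultimately show ?thesis by (simp only: d_def)
  qed
  from pinned_coincidence_decay[OF \<mu>1 \<mu>2 C \<eta>(1,2) this] show ?thesis using that by blast
qed

lemma frequently_le_of_liminf_finite:
  fixes X :: "nat \<Rightarrow> ennreal"
  assumes "liminf X < \<infinity>"
  obtains b where "b > 0" "\<exists>\<^sub>F k in sequentially. X k \<le> ennreal b"
proof -
  obtain n :: nat where "liminf X < of_nat n"
    using assms ennreal_Ex_less_of_nat[of "liminf X"] by (auto simp: less_top)
  also have "(of_nat n :: ennreal) = ennreal (real n)" by (simp add: ennreal_of_nat_eq_real_of_nat)
  also have "\<dots> \<le> ennreal (real n + 1)" by (intro ennreal_leI) simp
  finally have b: "liminf X < ennreal (real n + 1)" .
  have "\<exists>\<^sub>F k in sequentially. X k \<le> ennreal (real n + 1)"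
  proof (rule ccontr)
    assume "\<not> ?thesis"
    then have "\<forall>\<^sub>F k in sequentially. ennreal (real n + 1) \<le> X k"
      unfolding not_frequently by (rule eventually_mono) auto
    then have "ennreal (real n + 1) \<le> liminf X" by (rule Liminf_bounded)
    then show False using b by simp
  qed
  then show ?thesis by (intro that[of "real n + 1"]) auto
qed

theorem theorem2p1:
  fixes \<mu>\<^sub>1 \<mu>\<^sub>2 :: "'a::euclidean_space measure"
    and \<theta>\<^sub>1 \<theta>\<^sub>2 u a \<beta> :: real
  assumes "DIM('a) \<ge> 2"
    and "prob_space \<mu>\<^sub>1" and "sets \<mu>\<^sub>1 = sets borel" and "compact (measure_supp \<mu>\<^sub>1)"
    and "prob_space \<mu>\<^sub>2" and "sets \<mu>\<^sub>2 = sets borel" and "compact (measure_supp \<mu>\<^sub>2)"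
    and "\<theta>\<^sub>1 \<in> {0..1}" and "\<theta>\<^sub>2 \<in> {0..1}"
    and "ereal u = fourier_spectrum \<theta>\<^sub>1 \<mu>\<^sub>1"
    and "ereal a = min (ereal (real DIM('a) / 2))
                     (min (fourier_spectrum \<theta>\<^sub>2 \<mu>\<^sub>2)
                          (if \<theta>\<^sub>2 = 0 then \<infinity> else fourier_spectrum \<theta>\<^sub>2 \<mu>\<^sub>2 / ereal (2 * \<theta>\<^sub>2)))"
    and "u \<le> real DIM('a)"
    and "\<beta> = beta_threshold (real DIM('a)) \<theta>\<^sub>1 a u"
  shows "(\<beta> > 0 \<longrightarrow>
            (AE x in \<mu>\<^sub>1. hausdorff_dim (pinned_distance_set x (measure_supp \<mu>\<^sub>2)) \<ge> ereal (min 1 \<beta>)))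
       \<and> (\<beta> > 1 \<longrightarrow>
            (AE x in \<mu>\<^sub>1. emeasure lebesgue (pinned_distance_set x (measure_supp \<mu>\<^sub>2)) > 0))
       \<and> (\<beta> > 0 \<longrightarrow>
            hausdorff_dim (distance_set (measure_supp \<mu>\<^sub>1) (measure_supp \<mu>\<^sub>2)) \<ge> ereal (min 1 \<beta>))
       \<and> (\<beta> > 1 \<longrightarrow>
            emeasure lebesgue (distance_set (measure_supp \<mu>\<^sub>1) (measure_supp \<mu>\<^sub>2)) > 0)"
proof -
  interpret M1: prob_space \<mu>\<^sub>1 by fact
  interpret M2: prob_space \<mu>\<^sub>2 by fact
  note [measurable_cong] = assms(3,6)
  define S where "S = measure_supp \<mu>\<^sub>1"
  define T where "T = measure_supp \<mu>\<^sub>2"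
  have compact: "compact S" "compact T" using assms by (simp_all add: S_def T_def)
  have AE_S: "AE x in \<mu>\<^sub>1. x \<in> S" and AE_T: "AE y in \<mu>\<^sub>2. y \<in> T"
    unfolding S_def T_def by (intro AE_in_measure_supp assms)+
  obtain R1 where R1: "\<And>x. x \<in> S \<Longrightarrow> norm x \<le> R1"
    using compact_imp_bounded[OF compact(1)] by (auto simp: bounded_iff)
  obtain R2 where R2: "\<And>y. y \<in> T \<Longrightarrow> norm y \<le> R2"
    using compact_imp_bounded[OF compact(2)] by (auto simp: bounded_iff)
  have supp: "AE y in \<mu>\<^sub>2. norm y \<le> R2" using AE_T by eventually_elim (rule R2)
  \<comment> \<open>a bound on all distances involved, at least 1 so as to be positive\<close>
  define \<Lambda> where "\<Lambda> = max 1 (R1 + R2)"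
  have \<Lambda>: "\<Lambda> > 0" by (simp add: \<Lambda>_def)
  have dist_le: "AE y in \<mu>\<^sub>2. dist x y \<le> \<Lambda>" if "x \<in> S" for x
    using AE_T
  proof eventually_elim
    case (elim y)
    have "dist x y \<le> norm x + norm y" by (simp add: dist_norm norm_triangle_ineq4)
    then show ?case using R1[OF that] R2[OF elim] by (simp add: \<Lambda>_def)
  qed
  define \<nu> where "\<nu> x = distr \<mu>\<^sub>2 borel (dist x)" for x
  have \<nu>: "prob_space (\<nu> x)" "sets (\<nu> x) = sets borel" for x
    unfolding \<nu>_def by (auto intro!: M2.prob_space_distr)
  have \<nu>_supp: "AE t in \<nu> x. t \<in> pinned_distance_set x T" for x
  proof -
    have "{t. t \<in> pinned_distance_set x T} \<in> sets borel"
      using compact_pinned_distance_set[OF compact(2), of x] by (simp add: borel_compact)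
    then show ?thesis unfolding \<nu>_def
      by (subst AE_distr_iff) (use AE_T in \<open>auto simp: pinned_distance_set_eq_image elim: eventually_mono\<close>)
  qed
  define f where "f x = exp (- (pi * (norm x)\<^sup>2))" for x :: 'a
  define Q where "Q k x = pinned_coincidence (2 * \<Lambda> * (1/2) ^ k) \<mu>\<^sub>2 x" for k :: nat and x
  have [measurable]: "Q k \<in> borel_measurable borel" for k
    unfolding Q_def by (rule borel_measurable_pinned_coincidence[OF assms(5,6)])
  have [measurable]: "f \<in> borel_measurable borel" unfolding f_def[abs_def] by measurable
  have f_pos: "f x > 0" for x by (simp add: f_def)
  have G_le: "gaussian_coincidence ((1/2) ^ k) (\<nu> x) \<le> Q k x" if "x \<in> S" for x k
    unfolding \<nu>_def Q_def by (rule gaussian_coincidence_le_pinned[OF assms(5,6) \<Lambda> dist_le[OF that]]) simp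
  note decay = pinned_coincidence_decay_below_threshold[OF assms(2,3,5,6) supp assms(8-10,12,11)]
  have Q_decay: "\<exists>B\<ge>0. \<forall>k. (\<integral>\<^sup>+x. ennreal (f x) * Q k x \<partial>\<mu>\<^sub>1) \<le> ennreal (B * (1/2) powr (\<eta> * real k))"
    if \<eta>: "0 < \<eta>" "\<eta> \<le> 1" "\<eta> < \<beta>" for \<eta>
  proof -
    obtain B where B: "B \<ge> 0"
      "\<And>\<delta>. \<delta> > 0 \<Longrightarrow> (\<integral>\<^sup>+x. ennreal (exp (- (pi * (norm x)\<^sup>2))) * pinned_coincidence \<delta> \<mu>\<^sub>2 x \<partial>\<mu>\<^sub>1)
         \<le> ennreal (B * \<delta> powr \<eta>)"
      using decay[OF \<eta>(1,2)] \<eta>(3) assms(13) by metis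
    show ?thesis
    proof (intro exI[of _ "B * (2 * \<Lambda>) powr \<eta>"] conjI allI)
      fix k :: nat
      have "(\<integral>\<^sup>+x. ennreal (f x) * Q k x \<partial>\<mu>\<^sub>1) \<le> ennreal (B * (2 * \<Lambda> * (1/2) ^ k) powr \<eta>)"
        unfolding f_def Q_def using \<Lambda> by (intro B) auto
      also have "(2 * \<Lambda> * (1/2) ^ k) powr \<eta> = (2 * \<Lambda>) powr \<eta> * (1/2) powr (\<eta> * real k)"
        using \<Lambda> by (subst powr_mult) (auto simp: powr_realpow[symmetric] powr_powr mult.commute)
      finally show "(\<integral>\<^sup>+x. ennreal (f x) * Q k x \<partial>\<mu>\<^sub>1) \<le> ennreal (B * (2 * \<Lambda>) powr \<eta> * (1/2) powr (\<eta> * real k))"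
        by (simp add: mult.assoc)
    qed (use B in simp)
  qed

  have dim_ge: "AE x in \<mu>\<^sub>1. ereal \<gamma> \<le> hausdorff_dim (pinned_distance_set x T)"
    if \<gamma>: "0 < \<gamma>" "\<gamma> < min 1 \<beta>" for \<gamma>
  proof -
    \<comment> \<open>room between \<open>\<gamma>\<close> and the threshold makes the dyadic series geometric\<close>
    define \<eta> where "\<eta> = (\<gamma> + min 1 \<beta>) / 2"
    have \<eta>: "0 < \<eta>" "\<eta> \<le> 1" "\<eta> < \<beta>" "\<gamma> < \<eta>" using \<gamma> by (auto simp: \<eta>_def)
    obtain B where B: "B \<ge> 0" "\<And>k. (\<integral>\<^sup>+x. ennreal (f x) * Q k x \<partial>\<mu>\<^sub>1) \<le> ennreal (B * (1/2) powr (\<eta> * real k))"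
      using Q_decay[OF \<eta>(1-3)] by blast
    have "(\<integral>\<^sup>+x. (\<Sum>k. ennreal (2 powr (\<gamma> * real k)) * (ennreal (f x) * Q k x)) \<partial>\<mu>\<^sub>1)
        = (\<Sum>k. ennreal (2 powr (\<gamma> * real k)) * (\<integral>\<^sup>+x. ennreal (f x) * Q k x \<partial>\<mu>\<^sub>1))"
      by (subst nn_integral_suminf) (auto simp: nn_integral_cmult)
    also have "\<dots> \<le> (\<Sum>k. ennreal (B * (2 powr (\<gamma> - \<eta>)) ^ k))"
    proof (intro suminf_le)
      fix k
      have "ennreal (2 powr (\<gamma> * real k)) * (\<integral>\<^sup>+x. ennreal (f x) * Q k x \<partial>\<mu>\<^sub>1)
          \<le> ennreal (2 powr (\<gamma> * real k)) * ennreal (B * (1/2) powr (\<eta> * real k))"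
        by (intro mult_left_mono B) simp
      also have "\<dots> = ennreal (B * (2 powr (\<gamma> * real k) * (1/2) powr (\<eta> * real k)))"
        using B by (simp add: ennreal_mult[symmetric] mult_ac)
      also have "2 powr (\<gamma> * real k) * (1/2) powr (\<eta> * real k) = (2 powr (\<gamma> - \<eta>)) ^ k"
      proof -
        have "(1/2::real) powr (\<eta> * real k) = 2 powr (- (\<eta> * real k))"
          by (simp add: powr_divide powr_minus_divide)
        then show ?thesis
          by (simp add: powr_realpow[symmetric] powr_powr powr_add[symmetric] algebra_simps)
      qed
      finally show "ennreal (2 powr (\<gamma> * real k)) * (\<integral>\<^sup>+x. ennreal (f x) * Q k x \<partial>\<mu>\<^sub>1)
          \<le> ennreal (B * (2 powr (\<gamma> - \<eta>)) ^ k)" .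
    qed auto
    also have "\<dots> < \<infinity>"
      using B \<eta> by (intro suminf_geometric_ennreal_finite) (auto intro: powr_less_one)
    finally have "AE x in \<mu>\<^sub>1. (\<Sum>k. ennreal (2 powr (\<gamma> * real k)) * (ennreal (f x) * Q k x)) \<noteq> \<infinity>"
      by (intro nn_integral_PInf_AE) auto
    with AE_S show ?thesis
    proof eventually_elim
      case (elim x)
      have "(\<Sum>k. ennreal (2 powr (\<gamma> * real k)) * (ennreal (f x) * Q k x))
          = ennreal (f x) * (\<Sum>k. ennreal (2 powr (\<gamma> * real k)) * Q k x)"
        by (subst ennreal_suminf_cmult[symmetric]) (simp add: mult_ac)
      then have "(\<Sum>k. ennreal (2 powr (\<gamma> * real k)) * Q k x) \<noteq> \<infinity>"
        using elim(2) f_pos[of x] by (auto simp: ennreal_mult_eq_top_iff)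
      moreover have "(\<Sum>k. ennreal (2 powr (\<gamma> * real k)) * gaussian_coincidence ((1/2) ^ k) (\<nu> x))
          \<le> (\<Sum>k. ennreal (2 powr (\<gamma> * real k)) * Q k x)"
        using G_le[OF elim(1)] by (intro suminf_le mult_left_mono) auto
      ultimately have "(\<Sum>k. ennreal (2 powr (\<gamma> * real k)) * gaussian_coincidence ((1/2) ^ k) (\<nu> x)) < \<infinity>"
        by (auto simp: less_top top_unique)
      then show ?case
        by (rule hausdorff_dim_ge_of_gaussian_coincidence[OF \<nu> \<nu>_supp \<gamma>(1)])
    qed
  qed

  have pinned_dim: "AE x in \<mu>\<^sub>1. ereal (min 1 \<beta>) \<le> hausdorff_dim (pinned_distance_set x T)" if "\<beta> > 0"
  proof -
    define m where "m = min 1 \<beta>"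
    have m: "m > 0" using that by (simp add: m_def)
    \<comment> \<open>the exceptional null sets depend on the exponent, so only countably many exponents are used\<close>
    define \<gamma> where "\<gamma> n = m * (1 - inverse (real (Suc (Suc n))))" for n
    have "0 < \<gamma> n" "\<gamma> n < m" for n
    proof -
      have "0 < inverse (real (Suc (Suc n)))" "inverse (real (Suc (Suc n))) < 1"
        by (auto simp: field_simps)
      then show "0 < \<gamma> n" "\<gamma> n < m" using m by (auto simp: \<gamma>_def)
    qed
    then have "AE x in \<mu>\<^sub>1. \<forall>n. ereal (\<gamma> n) \<le> hausdorff_dim (pinned_distance_set x T)"
      unfolding AE_all_countable by (auto intro: dim_ge simp: m_def)
    moreover have "\<gamma> \<longlonglongrightarrow> m * (1 - 0)"
      unfolding \<gamma>_def by (intro tendsto_intros LIMSEQ_Suc[OF LIMSEQ_inverse_real_of_nat])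
    then have "(\<lambda>n. ereal (\<gamma> n)) \<longlonglongrightarrow> ereal m" by simp
    ultimately show ?thesis
      unfolding m_def[symmetric] by (auto elim!: eventually_mono intro: LIMSEQ_le_const2)
  qed

  have pinned_measure: "AE x in \<mu>\<^sub>1. emeasure lborel (pinned_distance_set x T) > 0" if \<beta>: "\<beta> > 1"
  proof -
    obtain B where B: "B \<ge> 0" "\<And>k. (\<integral>\<^sup>+x. ennreal (f x) * Q k x \<partial>\<mu>\<^sub>1) \<le> ennreal (B * (1/2) powr (1 * real k))"
      using Q_decay[of 1] \<beta> by auto
    have "(\<integral>\<^sup>+x. liminf (\<lambda>k. ennreal (2 ^ k) * (ennreal (f x) * Q k x)) \<partial>\<mu>\<^sub>1)
        \<le> liminf (\<lambda>k. \<integral>\<^sup>+x. ennreal (2 ^ k) * (ennreal (f x) * Q k x) \<partial>\<mu>\<^sub>1)"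
      by (rule nn_integral_liminf) measurable
    also have "\<dots> \<le> liminf (\<lambda>k::nat. ennreal B)"
    proof (intro Liminf_mono always_eventually allI)
      fix k
      have "(\<integral>\<^sup>+x. ennreal (2 ^ k) * (ennreal (f x) * Q k x) \<partial>\<mu>\<^sub>1)
          = ennreal (2 ^ k) * (\<integral>\<^sup>+x. ennreal (f x) * Q k x \<partial>\<mu>\<^sub>1)"
        by (rule nn_integral_cmult) measurable
      also have "\<dots> \<le> ennreal (2 ^ k) * ennreal (B * (1/2) powr (1 * real k))"
        by (intro mult_left_mono B) simp
      also have "\<dots> = ennreal B"
        using B by (simp add: ennreal_mult[symmetric] powr_realpow power_mult_distrib[symmetric] power_one_over)
      finally show "(\<integral>\<^sup>+x. ennreal (2 ^ k) * (ennreal (f x) * Q k x) \<partial>\<mu>\<^sub>1) \<le> ennreal B" .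
    qed
    also have "\<dots> < \<infinity>" by (simp add: Liminf_const)
    finally have "AE x in \<mu>\<^sub>1. liminf (\<lambda>k. ennreal (2 ^ k) * (ennreal (f x) * Q k x)) \<noteq> \<infinity>"
      by (intro nn_integral_PInf_AE) auto
    with AE_S show ?thesis
    proof eventually_elim
      case (elim x)
      have "liminf (\<lambda>k. ennreal (2 ^ k) * (ennreal (f x) * Q k x)) < \<infinity>"
        using elim(2) by (simp add: less_top)
      then obtain b where b: "b > 0" "\<exists>\<^sub>F k in sequentially. ennreal (2 ^ k) * (ennreal (f x) * Q k x) \<le> ennreal b"
        by (rule frequently_le_of_liminf_finite)
      from b(2) have "\<exists>\<^sub>F k in sequentially. ennreal (2 ^ k) * gaussian_coincidence ((1/2) ^ k) (\<nu> x) \<le> ennreal (b / f x)"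
      proof (rule frequently_elim1)
        fix k
        assume k: "ennreal (2 ^ k) * (ennreal (f x) * Q k x) \<le> ennreal b"
        have "ennreal (2 ^ k) * Q k x = ennreal (1 / f x) * (ennreal (2 ^ k) * (ennreal (f x) * Q k x))"
        proof -
          have "ennreal (1 / f x) * ennreal (f x) = 1"
            using f_pos[of x] by (simp add: ennreal_mult[symmetric])
          then show ?thesis by (metis mult.assoc mult.commute mult_1)
        qed
        also have "\<dots> \<le> ennreal (1 / f x) * ennreal b" by (rule mult_left_mono[OF k]) simp
        also have "\<dots> = ennreal (b / f x)"
          using b f_pos[of x] by (simp add: ennreal_mult[symmetric])
        finally show "ennreal (2 ^ k) * gaussian_coincidence ((1/2) ^ k) (\<nu> x) \<le> ennreal (b / f x)"
          using mult_left_mono[OF G_le[OF elim(1), of k], of "ennreal (2 ^ k)"] by (auto intro: order_trans)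
      qed
      then show ?case
        using b f_pos[of x]
        by (intro emeasure_pos_of_gaussian_coincidence[OF \<nu> \<nu>_supp compact_pinned_distance_set[OF compact(2)], of "b / f x"]) auto
    qed
  qed

  have lebesgue: "emeasure lebesgue A = emeasure lborel A" if "compact A" for A :: "real set"
    using that by (simp add: borel_compact)
  have ex: "\<exists>x\<in>S. P x" if "AE x in \<mu>\<^sub>1. P x" for P
  proof (rule ccontr)
    assume *: "\<not> ?thesis"
    have "AE x in \<mu>\<^sub>1. x \<in> S \<and> P x" using AE_S that by (rule AE_conjI)
    then have "AE x in \<mu>\<^sub>1. False" by (rule eventually_mono) (use * in blast)
    then show False by simp
  qed
  have full_dim: "ereal (min 1 \<beta>) \<le> hausdorff_dim (distance_set S T)" if \<beta>: "\<beta> > 0"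
  proof -
    obtain x where "x \<in> S" "ereal (min 1 \<beta>) \<le> hausdorff_dim (pinned_distance_set x T)"
      using ex[OF pinned_dim[OF \<beta>]] by blast
    then show ?thesis
      using hausdorff_dim_mono[OF pinned_distance_set_subset] order_trans by blast
  qed
  have full_measure: "emeasure lborel (distance_set S T) > 0" if \<beta>: "\<beta> > 1"
  proof -
    obtain x where x: "x \<in> S" "emeasure lborel (pinned_distance_set x T) > 0"
      using ex[OF pinned_measure[OF \<beta>]] by blast
    have "emeasure lborel (pinned_distance_set x T) \<le> emeasure lborel (distance_set S T)"
      using compact_distance_set[OF compact]
      by (intro emeasure_mono pinned_distance_set_subset x) (simp add: borel_compact)
    then show ?thesis using x by simp
  qed
  show ?thesis
    unfolding S_def[symmetric] T_def[symmetric]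
    using pinned_dim pinned_measure full_dim full_measure
    by (simp add: lebesgue compact_pinned_distance_set compact_distance_set compact)
qed

end
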